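(* Let $f:\mathbb{R}^d\to\mathbb{R}$ be continuous with a unique $x^*\in\mathbb{R}^d$ such that $f(x^* )=\min f=:\underline f$; assume there is $L_f>0$ with $|f(x)-f(y)|\le L_f(1+|x|+|y|)|x-y|$ for all $x,y\in\mathbb{R}^d$, and there are $c_\ell,c_u,M>0$ with $f(x)-\underline f\le c_u(|x|^2+1)$ for all $x\in\mathbb{R}^d$ and $c_\ell|x|^2\le f(x)-\underline f$ for $|x|\ge M$. Let $\lambda,\delta>0$. Let $\rho_t^\alpha$ be the unique solution (law) of the $\delta$-CBO dynamics $dX_t=-\lambda(X_t-X^\alpha(\rho_t^\alpha))dt+\delta\,dB_t$, $\rho^\alpha_t=\mathrm{Law}(X_t)$, with initial data $X_0\sim\rho_0\in\mathcal P_4(\mathbb{R}^d)$ (not necessarily Gaussian). Let $r=2S$, where $S>0$ is a constant such that, for all sufficiently large $\alpha$ and all $t\ge0$, $\mathbb E_{\rho_t^\alpha}[|x|^q]\le S$ for $q\in\mathbb N$, $q\le 4$, and $|X^\alpha(\rho_t^\alpha)|\le S$, and such that $x^*\in B_S(0)$ and $\mathbb E_{\rho_0}[x]\in B_S(0)$. Let $\mathcal T^\alpha(\mu)=X^\alpha(\mathcal N(\mu,\tfrac{\delta^2}{2\lambda}I_d))$, let $\boldsymbol\mu_\infty^\alpha$ be the unique fixed point of $\mathcal T^\alpha$ in $B_r(x^* )$ (for $\alpha$ large), and let $\boldsymbol\rho_\infty^\alpha=\mathcal N(\boldsymbol\mu_\infty^\alpha,\tfrac{\delta^2}{2\lambda}I_d)$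 be the corresponding invariant measure. Then, for $\alpha$ sufficiently large and all $t\ge 0$, $$W_2(\rho_t^\alpha,\boldsymbol\rho_\infty^\alpha)\le e^{-\lambda t}D+|\mathbb E_{\rho_0}[x]-\boldsymbol\mu_\infty^\alpha|\,e^{-\lambda(1-L_\alpha)t}+\frac{L_X}{L_\alpha}D\big(e^{-\lambda(1-L_\alpha)t}-e^{-\lambda t}\big),$$ where $D:=W_2\big(\rho_0,\mathcal N(\mathbb E_{\rho_0}[x],\tfrac{\delta^2}{2\lambda}I_d)\big)$, $L_X>0$ is the constant (depending on $R=S$) such that $|X^\alpha(\mu)-X^\alpha(\nu)|\le L_XW_2(\mu,\nu)$ for all $\mu,\nu\in\mathcal P_4(\mathbb{R}^d)$ with fourth moment bounded by $R=S$, and $L_\alpha$ is a Lipschitz constant of $\mathcal T^\alpha$ on $B_r(x^* )$, with $L_\alpha\to0$ as $\alpha\to\infty$. In particular, for any $e^{-\lambda}<\gamma<1$ and for $\alpha$ sufficiently large, $$W_2(\rho_t^\alpha,\boldsymbol\rho_\infty^\alpha)\le C_\alpha\gamma^t\quad\forall t\ge0,$$ for some $C_\alpha>0$.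
   Context: For a probability measure $\rho$ on $\mathbb{R}^d$ and $\alpha>0$, the consensus point is $X^\alpha(\rho)=\frac{\int x e^{-\alpha f(x)}d\rho(x)}{\int e^{-\alpha f(x)}d\rho(x)}$. $W_2$ is the 2-Wasserstein distance; $\mathcal P_4(\mathbb{R}^d)$ is the set of probability measures with finite fourth moment; balls are closed. For every $r>0$ and $\alpha$ sufficiently large, $\mathcal T^\alpha$ is a contraction of $B_r(x^* )$ into itself with a Lipschitz constant $L_\alpha$ such that $L_\alpha\to0$ as $\alpha\to\infty$; $\boldsymbol\mu_\infty^\alpha$ is its unique fixed point in $B_r(x^* )$, and $\boldsymbol\rho_\infty^\alpha=\mathcal N(\boldsymbol\mu_\infty^\alpha,\tfrac{\delta^2}{2\lambda}I_d)$ is an invariant measure of the $\delta$-CBO dynamics. A constant $S$ as in the claim exists under the stated assumptions on $f$, and for each $R>0$ a constant $L_X$ depending on $R$ exists. *)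

theory Defs
  imports "HOL-Probability.Probability"
begin

text \<open>The space of dimension \<open>d\<close> is an arbitrary type of class \<open>euclidean_space\<close>.\<close>

definition P4 :: "'a::euclidean_space measure set" where
  "P4 = {\<rho>. prob_space \<rho> \<and> sets \<rho> = sets borel \<and> integrable \<rho> (\<lambda>x. norm x ^ 4)}"

definition couplings ::
  "'a::euclidean_space measure \<Rightarrow> 'a measure \<Rightarrow> ('a \<times> 'a) measure set" where
  "couplings \<mu> \<nu> = {\<pi>. prob_space \<pi> \<and> sets \<pi> = sets borel \<and>
     distr \<pi> borel fst = \<mu> \<and> distr \<pi> borel snd = \<nu>}"

text \<open>\<open>enn2real\<close> sends \<open>\<infinity>\<close> to \<open>0\<close>, so \<open>W2\<close> is only meaningful if some coupling has
  finite cost. This is the case whenever both arguments have finite second moments.\<close>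

definition W2 :: "'a::euclidean_space measure \<Rightarrow> 'a measure \<Rightarrow> real" where
  "W2 \<mu> \<nu> =
     sqrt (enn2real (INF \<pi>\<in>couplings \<mu> \<nu>. \<integral>\<^sup>+z. ennreal (dist (fst z) (snd z) ^ 2) \<partial>\<pi>))"

text \<open>The normal distribution with mean \<open>m\<close> and covariance \<open>v\<close> times the identity, for \<open>v > 0\<close>.\<close>

definition isotropic_normal :: "'a::euclidean_space \<Rightarrow> real \<Rightarrow> 'a measure" where
  "isotropic_normal m v = density lborel
     (\<lambda>x. ennreal (exp (- (norm (x - m))\<^sup>2 / (2 * v)) / sqrt (2 * pi * v) ^ DIM('a)))"

definition consensus_point ::
  "('a::euclidean_space \<Rightarrow> real) \<Rightarrow> real \<Rightarrow> 'a measure \<Rightarrow> 'a" where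
  "consensus_point f \<alpha> \<rho> =
     (\<integral>x. exp (- \<alpha> * f x) *\<^sub>R x \<partial>\<rho>) /\<^sub>R (\<integral>x. exp (- \<alpha> * f x) \<partial>\<rho>)"

definition T_map ::
  "('a::euclidean_space \<Rightarrow> real) \<Rightarrow> real \<Rightarrow> real \<Rightarrow> real \<Rightarrow> 'a \<Rightarrow> 'a" where
  "T_map f lam \<delta> \<alpha> \<mu> = consensus_point f \<alpha> (isotropic_normal \<mu> (\<delta>\<^sup>2 / (2 * lam)))"

text \<open>Time is \<open>[0, \<infinity>)\<close>; the values of filtrations and processes at negative times are irrelevant
  (any filtration on \<open>[0, \<infinity>)\<close> can be extended by \<open>F t = F 0\<close> for \<open>t < 0\<close>).\<close>

definition brownian_motion ::
  "'w measure \<Rightarrow> (real \<Rightarrow> 'w measure) \<Rightarrow> (real \<Rightarrow> 'w \<Rightarrow> 'a::euclidean_space) \<Rightarrow> bool" where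
  "brownian_motion P F B \<longleftrightarrow>
     prob_space P \<and> filtration (space P) F \<and> (\<forall>t\<ge>0. subalgebra P (F t)) \<and>
     (\<forall>t\<ge>0. B t \<in> borel_measurable (F t)) \<and>
     (AE \<omega> in P. B 0 \<omega> = 0) \<and>
     (AE \<omega> in P. continuous_on {0..} (\<lambda>t. B t \<omega>)) \<and>
     (\<forall>s t. 0 \<le> s \<and> s < t \<longrightarrow>
        distr P borel (\<lambda>\<omega>. B t \<omega> - B s \<omega>) = isotropic_normal 0 (t - s) \<and>
        prob_space.indep_set P (sets (F s))
          {(\<lambda>\<omega>. B t \<omega> - B s \<omega>) -` A \<inter> space P | A. A \<in> sets borel})"

text \<open>\<open>X\<close> solves \<open>dX = - lam (X - X\<^sup>\<alpha>(\<rho>)) dt + \<delta> dB\<close> with \<open>\<rho> t = Law(X t)\<close> and \<open>X 0\<close> distributed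
  according to \<open>\<rho>0\<close>, driven by the Brownian motion \<open>B\<close> on \<open>(P, F)\<close>. As the noise is additive, the
  SDE in integral form needs no stochastic integral: it is a pathwise identity.\<close>

definition delta_CBO ::
  "('a::euclidean_space \<Rightarrow> real) \<Rightarrow> real \<Rightarrow> real \<Rightarrow> real \<Rightarrow> 'a measure \<Rightarrow>
   'w measure \<Rightarrow> (real \<Rightarrow> 'w measure) \<Rightarrow> (real \<Rightarrow> 'w \<Rightarrow> 'a) \<Rightarrow> (real \<Rightarrow> 'w \<Rightarrow> 'a) \<Rightarrow>
   (real \<Rightarrow> 'a measure) \<Rightarrow> bool" where
  "delta_CBO f lam \<delta> \<alpha> \<rho>0 P F B X \<rho> \<longleftrightarrow>
     brownian_motion P F B \<and>
     (\<forall>t\<ge>0. X t \<in> borel_measurable (F t)) \<and>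
     (AE \<omega> in P. continuous_on {0..} (\<lambda>t. X t \<omega>)) \<and>
     (\<forall>t\<ge>0. distr P borel (X t) = \<rho> t) \<and> \<rho> 0 = \<rho>0 \<and>
     (AE \<omega> in P. \<forall>t\<ge>0.
        ((\<lambda>s. - lam *\<^sub>R (X s \<omega> - consensus_point f \<alpha> (\<rho> s)))
           has_integral (X t \<omega> - X 0 \<omega> - \<delta> *\<^sub>R B t \<omega>)) {0..t})"

end

theory Submission
  imports Defs
begin

text \<open>
  Write \<open>m\<close> for the mean of \<open>\<rho>\<close> and \<open>\<nu>\<close> for the normal distribution with mean \<open>m\<close> and the
  stationary covariance. Subtracting a deterministic path turns the dynamics into an
  Ornstein-Uhlenbeck process, so \<open>\<rho> t\<close> is the law of \<open>exp (- lam * t) x + c t + s t z\<close> with \<open>x\<close>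
  distributed according to \<open>\<rho>0\<close> and \<open>z\<close> an independent Gaussian. Using the same \<open>z\<close> for two initial
  laws contracts \<open>W2\<close> by \<open>exp (- lam * t)\<close>, which bounds the distance of \<open>\<rho> t\<close> to \<open>\<nu> t\<close>; the distance
  of \<open>m t\<close> to the fixed point is controlled by Gronwall's inequality applied to
  \<open>m' = - lam (m - X\<^sup>\<alpha>(\<rho>))\<close>.

  The constant \<open>LX\<close> is not directly applicable to the pair \<open>\<rho> t\<close>, \<open>\<nu> t\<close>, because the fourth moment of
  \<open>\<nu> t\<close> may exceed \<open>S\<close>. However, comparing a Dirac measure with a two-point measure that puts a mass
  \<open>exp (- \<alpha> \<Delta>)\<close> on the minimiser, where \<open>\<Delta> > 0\<close> is the gap of \<open>f\<close> between the two points, shows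
  that \<open>LX\<close> grows exponentially in \<open>\<alpha>\<close>, whereas the Lipschitz constant of the consensus point at a
  Gaussian with bounded mean is at most \<open>G \<alpha> exp (\<alpha> \<epsilon>)\<close> for every \<open>\<epsilon> > 0\<close>, since that Gaussian has
  mass bounded below near the minimiser. So \<open>LX\<close> works for large \<open>\<alpha>\<close>.
\<close>

section \<open>Isotropic normal distributions\<close>

text \<open>The dynamics is given as a pathwise identity, so the Gaussian law of the linear process
  is obtained from its Euler scheme: the law of the scheme is explicit for every number of steps
  because it is built from independent increments, it converges path by path, and equality of laws
  survives almost sure limits on both sides. The two growth rates in \<alpha> are compared as
  follows. Moving a mass \<open>p = exp (- \<alpha> * \<Delta>)\<close> to the minimiser costs a
  multiple of \<open>sqrt p\<close> in \<open>W2\<close> but moves the consensus point by a fixed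
  amount, hence \<open>LX \<alpha> \<ge> exp (\<alpha> * \<Delta> / 2) / 2\<close>. With \<epsilon>
  = \<Delta> / 4 the constant at a Gaussian is of order
  \<open>\<alpha> * exp (\<alpha> * \<Delta> / 4)\<close>, and the remaining factor
  \<open>exp (\<alpha> * \<Delta> / 4)\<close> absorbs \<open>G * \<alpha>\<close>. Instead of
  optimal couplings the proof takes couplings whose cost is at most the square of some
  \<open>K > D\<close> and lets \<open>K\<close> tend to \<open>D\<close> at the very end. This is
  why the intermediate estimates speak of a coupling and a number \<open>K\<close> rather than of
  \<open>W2\<close>.\<close>

definition iso_density :: "'a::euclidean_space \<Rightarrow> real \<Rightarrow> 'a \<Rightarrow> real" where
  "iso_density m v x = exp (- (norm (x - m))\<^sup>2 / (2 * v)) / sqrt (2 * pi * v) ^ DIM('a)"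

abbreviation std_gauss :: "'a::euclidean_space measure" where
  "std_gauss \<equiv> isotropic_normal 0 1"

lemma isotropic_normal_density:
  "isotropic_normal m v = density lborel (\<lambda>x. ennreal (iso_density m v x))"
  by (simp add: isotropic_normal_def iso_density_def)

lemma iso_density_pos: "v > 0 \<Longrightarrow> iso_density m v x > 0"
  by (simp add: iso_density_def)

lemma iso_density_measurable [measurable]: "iso_density m v \<in> borel_measurable borel"
  unfolding iso_density_def by measurable

text \<open>Pythagoras splits the exponent over the orthonormal basis. The total mass thereby
  reduces to that of the one-dimensional normal density.\<close>

lemma iso_density_prod:
  fixes m x :: "'a::euclidean_space"
  assumes "v > 0"
  shows "iso_density m v x = (\<Prod>b\<in>Basis. normal_density (m \<bullet> b) (sqrt v) (x \<bullet> b))"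
proof -
  have n: "(norm (x - m))\<^sup>2 = (\<Sum>b\<in>Basis. (x \<bullet> b - m \<bullet> b)\<^sup>2)"
    by (subst power2_norm_eq_inner, subst euclidean_inner)
      (simp add: inner_diff_left power2_eq_square)
  have "exp (- (norm (x - m))\<^sup>2 / (2 * v)) = (\<Prod>b\<in>Basis. exp (- (x \<bullet> b - m \<bullet> b)\<^sup>2 / (2 * v)))"
    unfolding n by (subst exp_sum [symmetric]) (simp_all add: sum_negf sum_divide_distrib)
  then show ?thesis
    using assms by (simp add: iso_density_def normal_density_def prod_dividef real_sqrt_power)
qed

lemma nn_integral_iso_density:
  fixes m :: "'a::euclidean_space"
  assumes "v > 0"
  shows "(\<integral>\<^sup>+x. ennreal (iso_density m v x) \<partial>lborel) = 1"
proof -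
  have one: "(\<integral>\<^sup>+x. ennreal (normal_density \<mu> (sqrt v) x) \<partial>lborel) = 1" for \<mu>
    using assms by (subst nn_integral_eq_integral) (auto simp: ennreal_1)
  have "(\<integral>\<^sup>+x. ennreal (iso_density m v x) \<partial>lborel)
      = (\<integral>\<^sup>+x. (\<Prod>b\<in>Basis. ennreal (normal_density (m \<bullet> b) (sqrt v) (x \<bullet> b))) \<partial>lborel)"
    by (simp add: iso_density_prod[OF assms] prod_ennreal)
  also have "\<dots> = (\<Prod>b\<in>(Basis::'a set). (\<integral>\<^sup>+x. ennreal (normal_density (m \<bullet> b) (sqrt v) x) \<partial>lborel))"
    by (rule nn_integral_lborel_prod) auto
  finally show ?thesis by (simp add: one)
qed

lemma prob_space_isotropic_normal: "v > 0 \<Longrightarrow> prob_space (isotropic_normal m v)"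
  by (rule prob_spaceI) (simp add: isotropic_normal_density emeasure_density nn_integral_iso_density)

lemma sets_isotropic_normal [simp, measurable_cong]: "sets (isotropic_normal m v) = sets borel"
  by (simp add: isotropic_normal_density)

lemma space_isotropic_normal [simp]: "space (isotropic_normal m v) = UNIV"
  by (simp add: isotropic_normal_density)

lemma nn_integral_isotropic_normal:
  assumes [measurable]: "g \<in> borel_measurable borel"
  shows "(\<integral>\<^sup>+x. g x \<partial>isotropic_normal m v) = (\<integral>\<^sup>+x. ennreal (iso_density m v x) * g x \<partial>lborel)"
  unfolding isotropic_normal_density by (rule nn_integral_density) auto

text \<open>Laws are compared below through integrals of nonnegative functions, since substitution
  and Tonelli act on integrals directly; indicators bring the comparison back to sets.\<close>

lemma measure_eqI_nn_integral:
  fixes M N :: "'a measure"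
  assumes "sets M = sets N"
    and "\<And>g. g \<in> borel_measurable M \<Longrightarrow> (\<integral>\<^sup>+x. g x \<partial>M) = (\<integral>\<^sup>+x. g x \<partial>N)"
  shows "M = N"
proof (rule measure_eqI)
  fix A assume "A \<in> sets M"
  then show "emeasure M A = emeasure N A"
    using assms(2)[of "indicator A"] assms(1) by simp
qed (fact assms(1))

lemma iso_density_affine:
  fixes m z :: "'a::euclidean_space"
  assumes "s > 0" "v > 0"
  shows "s ^ DIM('a) * iso_density (m + s *\<^sub>R n) (s\<^sup>2 * v) (m + s *\<^sub>R z) = iso_density n v z"
proof -
  have "norm (m + s *\<^sub>R z - (m + s *\<^sub>R n)) = s * norm (z - n)"
    using assms by (simp add: scaleR_diff_right[symmetric])
  moreover have "sqrt (2 * pi * (s\<^sup>2 * v)) = s * sqrt (2 * pi * v)"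
    using assms by (simp add: real_sqrt_mult)
  ultimately show ?thesis
    using assms by (simp add: iso_density_def power_mult_distrib)
qed

lemma nn_integral_lborel_affine:
  fixes m :: "'a::euclidean_space"
  assumes [measurable]: "g \<in> borel_measurable borel" and "s > 0"
  shows "(\<integral>\<^sup>+x. g x \<partial>lborel) = ennreal (s ^ DIM('a)) * (\<integral>\<^sup>+x. g (m + s *\<^sub>R x) \<partial>lborel)"
  using assms(2)
  by (subst lborel_affine[of s m])
    (simp_all add: nn_integral_density nn_integral_distr nn_integral_cmult ennreal_power)

lemma distr_isotropic_normal_affine:
  fixes m n :: "'a::euclidean_space"
  assumes "s > 0" "v > 0"
  shows "distr (isotropic_normal n v) borel (\<lambda>z. m + s *\<^sub>R z) = isotropic_normal (m + s *\<^sub>R n) (s\<^sup>2 * v)"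
proof (rule measure_eqI_nn_integral)
  fix g :: "'a \<Rightarrow> ennreal"
  assume "g \<in> borel_measurable (distr (isotropic_normal n v) borel (\<lambda>z. m + s *\<^sub>R z))"
  then have g [measurable]: "g \<in> borel_measurable borel" by simp
  have "(\<integral>\<^sup>+x. g x \<partial>isotropic_normal (m + s *\<^sub>R n) (s\<^sup>2 * v)) =
     ennreal (s ^ DIM('a)) * (\<integral>\<^sup>+x. ennreal (iso_density (m + s *\<^sub>R n) (s\<^sup>2 * v) (m + s *\<^sub>R x)) * g (m + s *\<^sub>R x) \<partial>lborel)"
    by (subst nn_integral_isotropic_normal, measurable)
      (rule nn_integral_lborel_affine, use assms in auto)
  also have "\<dots> = (\<integral>\<^sup>+x. ennreal (iso_density n v x) * g (m + s *\<^sub>R x) \<partial>lborel)"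
    using assms
    by (subst nn_integral_cmult[symmetric])
      (auto intro!: nn_integral_cong simp: iso_density_affine ennreal_mult'[symmetric] mult.assoc[symmetric]
        less_imp_le)
  also have "\<dots> = (\<integral>\<^sup>+x. g x \<partial>distr (isotropic_normal n v) borel (\<lambda>z. m + s *\<^sub>R z))"
    by (simp add: nn_integral_distr nn_integral_isotropic_normal)
  finally show "(\<integral>\<^sup>+x. g x \<partial>distr (isotropic_normal n v) borel (\<lambda>z. m + s *\<^sub>R z)) =
    (\<integral>\<^sup>+x. g x \<partial>isotropic_normal (m + s *\<^sub>R n) (s\<^sup>2 * v))" by simp
qed simp

lemma isotropic_normal_eq_distr:
  fixes m :: "'a::euclidean_space"
  shows "s > 0 \<Longrightarrow> isotropic_normal m (s\<^sup>2) = distr std_gauss borel (\<lambda>z. m + s *\<^sub>R z)"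
  using distr_isotropic_normal_affine[of s 1 0 m] by simp

text \<open>This is Bayes' formula for \<open>u = a z + b y\<close> with independent standard
  Gaussians \<open>z\<close> and \<open>y\<close>: the density of \<open>u\<close> given
  \<open>y\<close> times that of \<open>y\<close> equals the marginal density of \<open>u\<close>
  times the density of \<open>y\<close> given \<open>u\<close>.\<close>

lemma iso_density_complete_square:
  fixes u y :: "'a::euclidean_space"
  assumes "a > 0" "b > 0"
  shows "iso_density (b *\<^sub>R y) (a\<^sup>2) u * iso_density 0 1 y =
     iso_density 0 (a\<^sup>2 + b\<^sup>2) u * iso_density ((b / (a\<^sup>2 + b\<^sup>2)) *\<^sub>R u) (a\<^sup>2 / (a\<^sup>2 + b\<^sup>2)) y"
proof -
  define c where "c = a\<^sup>2 + b\<^sup>2"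
  have c: "c > 0" using assms by (simp add: c_def pos_add_strict)
  have ex: "- (norm (u - b *\<^sub>R y))\<^sup>2 / (2 * a\<^sup>2) + - (norm y)\<^sup>2 / 2 =
     - (norm u)\<^sup>2 / (2 * c) + - (norm (y - (b / c) *\<^sub>R u))\<^sup>2 / (2 * (a\<^sup>2 / c))"
  proof -
    have 1: "(norm (u - b *\<^sub>R y))\<^sup>2 = (norm u)\<^sup>2 - 2 * b * (u \<bullet> y) + b\<^sup>2 * (norm y)\<^sup>2"
      unfolding power2_norm_eq_inner
      by (simp add: inner_diff_left inner_diff_right inner_commute algebra_simps power2_eq_square)
    have 2: "(norm (y - (b / c) *\<^sub>R u))\<^sup>2 = (norm y)\<^sup>2 - 2 * (b / c) * (u \<bullet> y) + (b / c)\<^sup>2 * (norm u)\<^sup>2"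
      unfolding power2_norm_eq_inner
      by (simp add: inner_diff_left inner_diff_right inner_commute algebra_simps power2_eq_square)
    \<comment> \<open>Once \<open>a\<^sup>2\<close> is replaced by \<open>c - b\<^sup>2\<close>, the
      claim is a rational identity in \<open>b\<close>, \<open>c\<close> and the inner
      products.\<close>
    have a2: "a\<^sup>2 = c - b\<^sup>2" "c - b\<^sup>2 \<noteq> 0" using assms by (auto simp: c_def)
    show ?thesis
      unfolding 1 2 a2(1) using c a2(2) by (simp add: field_simps power2_eq_square)
  qed
  have sq: "sqrt (2 * pi * a\<^sup>2) * sqrt (2 * pi * 1) = sqrt (2 * pi * c) * sqrt (2 * pi * (a\<^sup>2 / c))"
    using c assms by (simp add: real_sqrt_mult[symmetric] field_simps)
  show ?thesis
    unfolding iso_density_def c_def[symmetric] times_divide_times_eq exp_add[symmetric]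
      power_mult_distrib[symmetric]
    using ex sq by simp
qed

text \<open>A sum of independent centred Gaussians is Gaussian and the variances add up. After
  exchanging the integrals and completing the square, the conditional density of \<open>y\<close>
  integrates to 1 and the marginal of \<open>u\<close> remains.\<close>

lemma pair_std_gauss_lincomb_pos:
  fixes \<phi> :: "'a::euclidean_space \<Rightarrow> ennreal"
  assumes [measurable]: "\<phi> \<in> borel_measurable borel" and "a > 0" "b > 0"
  shows "(\<integral>\<^sup>+y. \<integral>\<^sup>+z. \<phi> (a *\<^sub>R z + b *\<^sub>R y) \<partial>std_gauss \<partial>std_gauss) =
     (\<integral>\<^sup>+z. \<phi> (sqrt (a\<^sup>2 + b\<^sup>2) *\<^sub>R z) \<partial>std_gauss)"
proof -
  define c where "c = a\<^sup>2 + b\<^sup>2"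
  have c: "c > 0" using assms by (simp add: c_def pos_add_strict)
  have inner: "(\<integral>\<^sup>+z. \<phi> (a *\<^sub>R z + b *\<^sub>R y) \<partial>std_gauss) =
      (\<integral>\<^sup>+u. ennreal (iso_density (b *\<^sub>R y) (a\<^sup>2) u) * \<phi> u \<partial>lborel)" for y
  proof -
    have "(\<integral>\<^sup>+z. \<phi> (a *\<^sub>R z + b *\<^sub>R y) \<partial>std_gauss) = (\<integral>\<^sup>+u. \<phi> u \<partial>isotropic_normal (b *\<^sub>R y) (a\<^sup>2))"
      using assms(2) by (simp add: isotropic_normal_eq_distr nn_integral_distr add.commute)
    then show ?thesis by (simp add: nn_integral_isotropic_normal)
  qed
  have [measurable]: "(\<lambda>(y, u). iso_density (b *\<^sub>R y) (a\<^sup>2) u) \<in> borel_measurable (borel \<Otimes>\<^sub>M (borel :: 'a measure))"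
    unfolding iso_density_def by measurable
  have "(\<integral>\<^sup>+y. \<integral>\<^sup>+z. \<phi> (a *\<^sub>R z + b *\<^sub>R y) \<partial>std_gauss \<partial>std_gauss) =
     (\<integral>\<^sup>+y. ennreal (iso_density 0 1 y) * (\<integral>\<^sup>+u. ennreal (iso_density (b *\<^sub>R y) (a\<^sup>2) u) * \<phi> u \<partial>lborel) \<partial>lborel)"
    unfolding inner by (rule nn_integral_isotropic_normal) measurable
  also have "\<dots> = (\<integral>\<^sup>+y. \<integral>\<^sup>+u. ennreal (iso_density (b *\<^sub>R y) (a\<^sup>2) u * iso_density 0 1 y) * \<phi> u \<partial>lborel \<partial>lborel)"
    using assms
    by (subst nn_integral_cmult[symmetric])
      (auto intro!: nn_integral_cong simp: ennreal_mult less_imp_le iso_density_pos mult_ac)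
  also have "\<dots> = (\<integral>\<^sup>+u. \<integral>\<^sup>+y. ennreal (iso_density (b *\<^sub>R y) (a\<^sup>2) u * iso_density 0 1 y) * \<phi> u \<partial>lborel \<partial>lborel)"
    by (rule lborel_pair.Fubini') measurable
  also have "\<dots> = (\<integral>\<^sup>+u. \<integral>\<^sup>+y. (ennreal (iso_density 0 c u) * \<phi> u) *
       ennreal (iso_density ((b / c) *\<^sub>R u) (a\<^sup>2 / c) y) \<partial>lborel \<partial>lborel)"
  proof (intro nn_integral_cong)
    fix u y :: 'a
    have "ennreal (iso_density (b *\<^sub>R y) (a\<^sup>2) u * iso_density 0 1 y) =
        ennreal (iso_density 0 c u) * ennreal (iso_density ((b / c) *\<^sub>R u) (a\<^sup>2 / c) y)"
      using assms c unfolding c_def iso_density_complete_square[OF assms(2,3)]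
      by (intro ennreal_mult less_imp_le iso_density_pos) auto
    then show "ennreal (iso_density (b *\<^sub>R y) (a\<^sup>2) u * iso_density 0 1 y) * \<phi> u =
        (ennreal (iso_density 0 c u) * \<phi> u) * ennreal (iso_density ((b / c) *\<^sub>R u) (a\<^sup>2 / c) y)"
      by (simp add: mult_ac)
  qed
  also have "\<dots> = (\<integral>\<^sup>+u. ennreal (iso_density 0 c u) * \<phi> u \<partial>lborel)"
    using c assms by (simp add: nn_integral_cmult nn_integral_iso_density)
  also have "\<dots> = (\<integral>\<^sup>+u. \<phi> u \<partial>isotropic_normal 0 ((sqrt c)\<^sup>2))"
    using c by (simp add: nn_integral_isotropic_normal)
  also have "\<dots> = (\<integral>\<^sup>+z. \<phi> (sqrt c *\<^sub>R z) \<partial>std_gauss)"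
    using c by (subst isotropic_normal_eq_distr) (simp_all add: nn_integral_distr)
  finally show ?thesis by (simp add: c_def)
qed

text \<open>The degenerate coefficients matter: the accumulated noise has amplitude 0 at time 0 and
  before the first Euler step.\<close>

lemma pair_std_gauss_lincomb:
  fixes \<phi> :: "'a::euclidean_space \<Rightarrow> ennreal"
  assumes [measurable]: "\<phi> \<in> borel_measurable borel" and "a \<ge> 0" "b \<ge> 0"
  shows "(\<integral>\<^sup>+y. \<integral>\<^sup>+z. \<phi> (a *\<^sub>R z + b *\<^sub>R y) \<partial>std_gauss \<partial>std_gauss) =
     (\<integral>\<^sup>+z. \<phi> (sqrt (a\<^sup>2 + b\<^sup>2) *\<^sub>R z) \<partial>std_gauss)"
proof -
  interpret prob_space "std_gauss :: 'a measure" by (rule prob_space_isotropic_normal) simp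
  have *: "(\<integral>\<^sup>+y. k \<partial>(std_gauss :: 'a measure)) = k" for k
    using emeasure_space_1 by simp
  consider "a > 0 \<and> b > 0" | "a = 0" | "b = 0" using assms by linarith
  then show ?thesis
    by cases (use assms * in \<open>auto intro: pair_std_gauss_lincomb_pos\<close>)
qed

section \<open>First and second moments of the standard Gaussian\<close>

lemma std_gauss_sq_finite: "(\<integral>\<^sup>+z. ennreal ((norm z)\<^sup>2) \<partial>(std_gauss :: 'a::euclidean_space measure)) < \<infinity>"
proof -
  \<comment> \<open>Half of the Gaussian exponent pays for the square of the norm and leaves the
    density of variance 2; the power of \<open>sqrt 2\<close> is the ratio of the two
    normalisations.\<close>
  have b: "iso_density 0 1 z * (norm z)\<^sup>2 \<le> 4 * sqrt 2 ^ DIM('a) * iso_density 0 2 z" for z :: 'a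
  proof -
    have "(norm z)\<^sup>2 / 4 \<le> exp ((norm z)\<^sup>2 / 4)" using exp_ge_add_one_self[of "(norm z)\<^sup>2 / 4"] by linarith
    then have "exp (- (norm z)\<^sup>2 / 2) * (norm z)\<^sup>2 \<le> exp (- (norm z)\<^sup>2 / 2) * (4 * exp ((norm z)\<^sup>2 / 4))"
      by (intro mult_left_mono) auto
    also have "\<dots> = 4 * exp (- (norm z)\<^sup>2 / 4)"
      by (simp add: exp_add[symmetric])
    finally show ?thesis
      using power_mult_distrib[of "sqrt 2" "sqrt 2" "DIM('a)"]
      by (simp add: iso_density_def real_sqrt_mult power_mult_distrib field_simps)
  qed
  have "(\<integral>\<^sup>+z. ennreal ((norm z)\<^sup>2) \<partial>(std_gauss :: 'a measure)) \<le>
     (\<integral>\<^sup>+z. ennreal (4 * sqrt 2 ^ DIM('a)) * ennreal (iso_density 0 2 (z::'a)) \<partial>lborel)"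
    using b by (subst nn_integral_isotropic_normal)
      (auto intro!: nn_integral_mono simp: ennreal_mult'[symmetric] less_imp_le iso_density_pos ennreal_leI)
  also have "\<dots> = ennreal (4 * sqrt 2 ^ DIM('a))"
    by (simp add: nn_integral_cmult nn_integral_iso_density)
  finally show ?thesis by (rule order.strict_trans1) simp
qed

lemma integrable_std_gauss_sq: "integrable std_gauss (\<lambda>z::'a::euclidean_space. (norm z)\<^sup>2)"
  using std_gauss_sq_finite by (intro integrableI_bounded) auto

lemma integrable_std_gauss_id: "integrable std_gauss (\<lambda>z::'a::euclidean_space. z)"
proof -
  interpret prob_space "std_gauss :: 'a measure" by (rule prob_space_isotropic_normal) simp
  have "norm z \<le> 1 + (norm z)\<^sup>2" for z :: 'a
  proof -
    have "0 \<le> (norm z - 1)\<^sup>2" by simp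
    then have "2 * norm z \<le> 1 + (norm z)\<^sup>2" by (simp add: power2_diff)
    then show ?thesis using norm_ge_zero[of z] by linarith
  qed
  then show ?thesis
    by (intro Bochner_Integration.integrable_bound[OF Bochner_Integration.integrable_add[OF integrable_const integrable_std_gauss_sq, of 1]]) auto
qed

text \<open>The Gaussian is symmetric under reflection, so its mean equals its own negative.\<close>

lemma integral_std_gauss_id: "(\<integral>z. z \<partial>(std_gauss :: 'a::euclidean_space measure)) = 0"
proof -
  have d: "distr std_gauss borel uminus = (std_gauss :: 'a measure)"
  proof (rule measure_eqI_nn_integral)
    fix g :: "'a \<Rightarrow> ennreal" assume "g \<in> borel_measurable (distr std_gauss borel uminus)"
    then have [measurable]: "g \<in> borel_measurable borel" by simp
    have "(\<integral>\<^sup>+x. g x \<partial>distr std_gauss borel uminus) = (\<integral>\<^sup>+x. ennreal (iso_density 0 1 x) * g (- x) \<partial>lborel)"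
      by (simp add: nn_integral_distr nn_integral_isotropic_normal)
    also have "\<dots> = (\<integral>\<^sup>+x. ennreal (iso_density 0 1 (- x)) * g x \<partial>lborel)"
      by (subst lborel_affine[of "-1" 0]) (simp_all add: nn_integral_density nn_integral_distr)
    finally show "(\<integral>\<^sup>+x. g x \<partial>distr std_gauss borel uminus) = (\<integral>\<^sup>+x. g x \<partial>std_gauss)"
      by (simp add: nn_integral_isotropic_normal iso_density_def)
  qed simp
  have "(\<integral>z. z \<partial>(std_gauss :: 'a measure)) = (\<integral>z. - z \<partial>(std_gauss :: 'a measure))"
    by (subst (1) d[symmetric], subst integral_distr) auto
  then have "(\<integral>z. z \<partial>(std_gauss :: 'a measure)) = - (\<integral>z. z \<partial>(std_gauss :: 'a measure))"
    by simp
  then have "2 *\<^sub>R (\<integral>z. z \<partial>(std_gauss :: 'a measure)) = 0"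
    unfolding scaleR_2 by (metis add.right_inverse)
  then show ?thesis by simp
qed

section \<open>Limits of laws and the Euler scheme\<close>

text \<open>The indicator of a closed set is the pointwise limit of the bounded continuous functions
  \<open>max 0 (1 - n * infdist x C)\<close>, and the closed sets form an intersection-stable
  generator of the Borel sets.\<close>

lemma borel_measure_eqI_continuous:
  fixes M N :: "'a::metric_space measure"
  assumes "finite_measure M" "finite_measure N" and sM: "sets M = sets borel" and sN: "sets N = sets borel"
    and eq: "\<And>\<phi> :: 'a \<Rightarrow> real. continuous_on UNIV \<phi> \<Longrightarrow> (\<And>x. \<bar>\<phi> x\<bar> \<le> 1) \<Longrightarrow> (\<integral>x. \<phi> x \<partial>M) = (\<integral>x. \<phi> x \<partial>N)"
  shows "M = N"
proof -
  interpret M: finite_measure M by fact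
  interpret N: finite_measure N by fact
  note [measurable_cong] = sM sN
  have spM: "space M = UNIV" and spN: "space N = UNIV"
    using sets_eq_imp_space_eq[OF sM] sets_eq_imp_space_eq[OF sN] by auto
  have closed_eq: "emeasure M C = emeasure N C" if C: "closed C" for C :: "'a set"
  proof (cases "C = {}")
    \<comment> \<open>The distance to the empty set is 0 by convention, which would make the
      approximating functions constantly 1.\<close>
    case False
    define \<phi> where "\<phi> n x = max 0 (1 - real n * infdist x C)" for n x
    have cont: "continuous_on UNIV (\<phi> n)" for n
      unfolding \<phi>_def by (intro continuous_intros)
    have [measurable]: "\<phi> n \<in> borel_measurable borel" for n
      by (rule borel_measurable_continuous_onI[OF cont])
    have [measurable]: "C \<in> sets borel" using C by simp
    have bd: "\<bar>\<phi> n x\<bar> \<le> 1" for n x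
      by (auto simp: \<phi>_def infdist_nonneg)
    have lim: "(\<lambda>n. \<phi> n x) \<longlonglongrightarrow> indicator C x" for x
    proof (cases "x \<in> C")
      case True then show ?thesis by (simp add: \<phi>_def)
    next
      case nx: False
      then have pos: "infdist x C > 0"
        using C False by (metis in_closed_iff_infdist_zero infdist_nonneg less_eq_real_def)
      have "eventually (\<lambda>n. \<phi> n x = 0) sequentially"
        using eventually_ge_at_top[of "nat \<lceil>1 / infdist x C\<rceil>"]
      proof eventually_elim
        case (elim n)
        then have "1 / infdist x C \<le> real n" by linarith
        then show ?case using pos by (simp add: \<phi>_def field_simps)
      qed
      then show ?thesis using nx by (simp add: tendsto_eventually)
    qed
    have LM: "(\<lambda>n. \<integral>x. \<phi> n x \<partial>M) \<longlonglongrightarrow> (\<integral>x. indicator C x \<partial>M)"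
      by (rule integral_dominated_convergence[where w="\<lambda>_. 1"])
        (use bd lim in \<open>auto simp: M.integrable_const\<close>)
    have LN: "(\<lambda>n. \<integral>x. \<phi> n x \<partial>N) \<longlonglongrightarrow> (\<integral>x. indicator C x \<partial>N)"
      by (rule integral_dominated_convergence[where w="\<lambda>_. 1"])
        (use bd lim in \<open>auto simp: N.integrable_const\<close>)
    have "(\<integral>x. indicator C x \<partial>M) = (\<integral>x. indicator C x \<partial>N :: real)"
      using LIMSEQ_unique[OF LM] LN eq[OF cont bd] by simp
    then show ?thesis
      using spM spN by (simp add: M.emeasure_eq_measure N.emeasure_eq_measure)
  qed simp
  show ?thesis
  proof (rule measure_eqI_generator_eq[where E="Collect closed" and \<Omega>=UNIV and A="\<lambda>_. UNIV"])
    show "Int_stable (Collect closed :: 'a set set)" by (auto simp: Int_stable_def)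
    show "sets M = sigma_sets UNIV (Collect closed)" "sets N = sigma_sets UNIV (Collect closed)"
      by (simp_all add: sM sN borel_eq_closed)
  qed (auto simp: closed_eq)
qed

text \<open>The two sequences may live on different probability spaces: one will be the Euler scheme
  on the space of the Brownian motion, the other an explicit function of the initial value and a
  single Gaussian. Dominated convergence for bounded continuous test functions identifies the
  limits.\<close>

lemma distr_eqI_limit:
  fixes U :: "nat \<Rightarrow> 'w \<Rightarrow> 'a::metric_space" and W :: "nat \<Rightarrow> 'v \<Rightarrow> 'a"
  assumes "prob_space P" "prob_space Q"
    and [measurable]: "\<And>n. U n \<in> borel_measurable P" "V \<in> borel_measurable P"
      "\<And>n. W n \<in> borel_measurable Q" "Z \<in> borel_measurable Q"
    and U: "AE \<omega> in P. (\<lambda>n. U n \<omega>) \<longlonglongrightarrow> V \<omega>"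
    and W: "AE \<omega> in Q. (\<lambda>n. W n \<omega>) \<longlonglongrightarrow> Z \<omega>"
    and eq: "eventually (\<lambda>n. distr P borel (U n) = distr Q borel (W n)) sequentially"
  shows "distr P borel V = distr Q borel Z"
proof -
  interpret P: prob_space P by fact
  interpret Q: prob_space Q by fact
  interpret PV: prob_space "distr P borel V" by (rule P.prob_space_distr) measurable
  interpret QZ: prob_space "distr Q borel Z" by (rule Q.prob_space_distr) measurable
  show ?thesis
  proof (rule borel_measure_eqI_continuous)
    fix \<phi> :: "'a \<Rightarrow> real" assume c: "continuous_on UNIV \<phi>" and b: "\<And>x. \<bar>\<phi> x\<bar> \<le> 1"
    have [measurable]: "\<phi> \<in> borel_measurable borel"
      by (rule borel_measurable_continuous_onI[OF c])
    have ic: "isCont \<phi> x" for x using c by (simp add: continuous_on_eq_continuous_at)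
    have LU: "(\<lambda>n. \<integral>\<omega>. \<phi> (U n \<omega>) \<partial>P) \<longlonglongrightarrow> (\<integral>\<omega>. \<phi> (V \<omega>) \<partial>P)"
    proof (rule integral_dominated_convergence[where w="\<lambda>_. 1"])
      show "AE \<omega> in P. (\<lambda>n. \<phi> (U n \<omega>)) \<longlonglongrightarrow> \<phi> (V \<omega>)"
        using U by eventually_elim (rule isCont_tendsto_compose[OF ic])
    qed (use b in auto)
    have LW: "(\<lambda>n. \<integral>\<omega>. \<phi> (W n \<omega>) \<partial>Q) \<longlonglongrightarrow> (\<integral>\<omega>. \<phi> (Z \<omega>) \<partial>Q)"
    proof (rule integral_dominated_convergence[where w="\<lambda>_. 1"])
      show "AE \<omega> in Q. (\<lambda>n. \<phi> (W n \<omega>)) \<longlonglongrightarrow> \<phi> (Z \<omega>)"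
        using W by eventually_elim (rule isCont_tendsto_compose[OF ic])
    qed (use b in auto)
    have ev: "eventually (\<lambda>n. (\<integral>\<omega>. \<phi> (W n \<omega>) \<partial>Q) = (\<integral>\<omega>. \<phi> (U n \<omega>) \<partial>P)) sequentially"
      using eq
    proof eventually_elim
      case (elim n)
      have "(\<integral>\<omega>. \<phi> (U n \<omega>) \<partial>P) = (\<integral>x. \<phi> x \<partial>distr P borel (U n))" by (simp add: integral_distr)
      also have "\<dots> = (\<integral>\<omega>. \<phi> (W n \<omega>) \<partial>Q)" unfolding elim by (simp add: integral_distr)
      finally show ?case by simp
    qed
    have "(\<integral>\<omega>. \<phi> (V \<omega>) \<partial>P) = (\<integral>\<omega>. \<phi> (Z \<omega>) \<partial>Q)"
      using LIMSEQ_unique[OF LU Lim_transform_eventually[OF LW ev]] .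
    then show "(\<integral>x. \<phi> x \<partial>distr P borel V) = (\<integral>x. \<phi> x \<partial>distr Q borel Z)"
      by (simp add: integral_distr)
  qed (auto intro: PV.finite_measure_axioms QZ.finite_measure_axioms)
qed

text \<open>With \<open>q = 1 - lam * h\<close> and \<open>d\<close> the increments of a driving
  path over steps of width \<open>h\<close>, this is the explicit Euler scheme for
  \<open>dV = - lam V dt + db\<close> started at \<open>x\<close>.\<close>

primrec linear_recursion :: "real \<Rightarrow> 'a::real_vector \<Rightarrow> (nat \<Rightarrow> 'a) \<Rightarrow> nat \<Rightarrow> 'a" where
  "linear_recursion q x d 0 = x"
| "linear_recursion q x d (Suc k) = q *\<^sub>R linear_recursion q x d k + d k"

text \<open>A factor \<open>q\<close> between 0 and 1 does not amplify earlier errors, so the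
  defects of the single steps merely add up.\<close>

lemma linear_recursion_error:
  fixes V d :: "nat \<Rightarrow> 'a::real_normed_vector"
  assumes "0 \<le> q" "q \<le> 1" "e \<ge> 0"
    and "\<And>k. k < n \<Longrightarrow> norm (V (Suc k) - (q *\<^sub>R V k + d k)) \<le> e"
  shows "norm (V n - linear_recursion q (V 0) d n) \<le> real n * e"
  using assms(4)
proof (induction n)
  case (Suc n)
  let ?L = "linear_recursion q (V 0) d"
  have "V (Suc n) - ?L (Suc n) = (V (Suc n) - (q *\<^sub>R V n + d n)) + q *\<^sub>R (V n - ?L n)"
    by (simp add: algebra_simps)
  also have "norm \<dots> \<le> norm (V (Suc n) - (q *\<^sub>R V n + d n)) + norm (q *\<^sub>R (V n - ?L n))"
    by (rule norm_triangle_ineq)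
  also have "\<dots> \<le> e + 1 * norm (V n - ?L n)"
    using assms(1,2) Suc.prems[of n] by (intro add_mono) (auto intro: mult_left_le_one_le)
  also have "\<dots> \<le> e + real n * e" using Suc by auto
  finally show ?case by (simp add: algebra_simps)
qed simp

text \<open>A deterministic statement about one path. The increments of \<open>b\<close> enter the
  scheme exactly, so the defect of a step comes only from freezing \<open>v\<close> in the drift,
  and uniform continuity of \<open>v\<close> on \<open>{0..t}\<close> makes it small compared with
  the step width.\<close>

lemma euler_scheme_converges:
  fixes v b :: "real \<Rightarrow> 'a::euclidean_space"
  assumes lam: "lam > 0" and t: "t > 0" and cont: "continuous_on {0..} v"
    and eq: "\<And>t. t \<ge> 0 \<Longrightarrow> ((\<lambda>s. - lam *\<^sub>R v s) has_integral (v t - v 0 - b t)) {0..t}"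
  shows "(\<lambda>n. linear_recursion (1 - lam * (t / n)) (v 0)
     (\<lambda>k. b (real (Suc k) * (t / n)) - b (real k * (t / n))) n) \<longlonglongrightarrow> v t"
proof (rule LIMSEQ_I)
  fix e :: real assume e: "e > 0"
  \<comment> \<open>Each of the \<open>n\<close> steps of width \<open>h\<close> will have defect at
    most \<open>lam * e' * h\<close>; their sum is \<open>lam * e' * t\<close>, that is
    \<open>e / 2\<close>.\<close>
  define e' where "e' = e / (2 * lam * t)"
  have e': "e' > 0" using e lam t by (simp add: e'_def)
  have "uniformly_continuous_on {0..t} v"
    by (rule compact_uniformly_continuous) (auto intro: continuous_on_subset[OF cont])
  then obtain d where d: "d > 0" and dv: "\<And>x y. x \<in> {0..t} \<Longrightarrow> y \<in> {0..t} \<Longrightarrow> dist x y < d \<Longrightarrow> dist (v x) (v y) < e'"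
    unfolding uniformly_continuous_on_def using e' by metis
  \<comment> \<open>The first bound makes the factor \<open>1 - lam * h\<close> nonnegative, the
    second makes the step width smaller than \<open>d\<close>; adding 1 turns both into strict
    inequalities.\<close>
  define N where "N = nat \<lceil>max (lam * t) (t / d)\<rceil> + 1"
  show "\<exists>no. \<forall>n\<ge>no. norm (linear_recursion (1 - lam * (t / n)) (v 0)
     (\<lambda>k. b (real (Suc k) * (t / n)) - b (real k * (t / n))) n - v t) < e"
  proof (intro exI[of _ N] allI impI)
    fix n assume "n \<ge> N"
    then have n1: "real n > lam * t" "real n > t / d" unfolding N_def by linarith+
    have n0: "real n > 0" using n1(1) lam t by (meson less_trans mult_pos_pos)
    define h where "h = t / n"
    have h: "h > 0" "lam * h \<le> 1" "h < d" "real n * h = t"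
      using n1 n0 t d lam by (auto simp: h_def field_simps)
    have step: "norm (v (real (Suc k) * h) - ((1 - lam * h) *\<^sub>R v (real k * h) + (b (real (Suc k) * h) - b (real k * h)))) \<le> lam * e' * h"
      if k: "k < n" for k
    proof -
      define s u where "s = real k * h" and "u = real (Suc k) * h"
      have su: "0 \<le> s" "s \<le> u" "u - s = h" using h(1) by (auto simp: s_def u_def algebra_simps)
      have "real (Suc k) * h \<le> real n * h" using k h by (intro mult_right_mono) auto
      then have ut: "u \<le> t" using h(4) by (simp add: u_def)
      have "((\<lambda>s. - lam *\<^sub>R v s) has_integral (v u - v 0 - b u) - (v s - v 0 - b s)) {s..u}"
      proof -
        have "(\<lambda>r. - lam *\<^sub>R v r) integrable_on {s..u}"
          by (intro integrable_continuous_real continuous_intros continuous_on_subset[OF cont]) (use su in auto)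
        then obtain I where I: "((\<lambda>r. - lam *\<^sub>R v r) has_integral I) {s..u}" by blast
        have "((\<lambda>r. - lam *\<^sub>R v r) has_integral ((v s - v 0 - b s) + I)) {0..u}"
          by (rule has_integral_combine[OF su(1,2) eq[OF su(1)] I])
        then have "(v s - v 0 - b s) + I = v u - v 0 - b u"
          using eq[of u] su has_integral_unique by (meson order_trans)
        then have "I = (v u - v 0 - b u) - (v s - v 0 - b s)" by (simp add: algebra_simps)
        then show ?thesis using I by simp
      qed
      moreover have "((\<lambda>r. lam *\<^sub>R v s) has_integral (u - s) *\<^sub>R (lam *\<^sub>R v s)) {s..u}"
        using su has_integral_const_real[of "lam *\<^sub>R v s" s u] by simp
      ultimately have I: "((\<lambda>r. - lam *\<^sub>R v r + lam *\<^sub>R v s) has_integral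
          ((v u - v 0 - b u) - (v s - v 0 - b s)) + (u - s) *\<^sub>R (lam *\<^sub>R v s)) {s..u}"
        by (rule has_integral_add)
      have bd: "norm (- lam *\<^sub>R v r + lam *\<^sub>R v s) \<le> lam * e'" if "r \<in> {s..u}" for r
      proof -
        have "dist (v s) (v r) < e'"
          using that su ut h(3) by (intro dv) (auto simp: dist_real_def)
        moreover have "- lam *\<^sub>R v r + lam *\<^sub>R v s = lam *\<^sub>R (v s - v r)" by (simp add: algebra_simps)
        ultimately show ?thesis using lam by (simp add: dist_norm)
      qed
      have "norm (((v u - v 0 - b u) - (v s - v 0 - b s)) + (u - s) *\<^sub>R (lam *\<^sub>R v s)) \<le> lam * e' * measure lborel {s..u}"
        by (rule has_integral_bound_real[OF _ _ I, of _ "{}"]) (use lam e' bd in auto)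
      then have "norm (((v u - v 0 - b u) - (v s - v 0 - b s)) + (u - s) *\<^sub>R (lam *\<^sub>R v s)) \<le> lam * e' * (u - s)"
        using su by simp
      moreover have "((v u - v 0 - b u) - (v s - v 0 - b s)) + (u - s) *\<^sub>R (lam *\<^sub>R v s) =
          v u - ((1 - lam * h) *\<^sub>R v s + (b u - b s))"
        unfolding su(3) by (simp add: algebra_simps)
      ultimately have "norm (v u - ((1 - lam * h) *\<^sub>R v s + (b u - b s))) \<le> lam * e' * h"
        unfolding su(3) by metis
      then show ?thesis unfolding s_def u_def .
    qed
    have "norm (v (real n * h) - linear_recursion (1 - lam * h) (v (real 0 * h)) (\<lambda>k. b (real (Suc k) * h) - b (real k * h)) n)
        \<le> real n * (lam * e' * h)"
      by (rule linear_recursion_error[where V="\<lambda>k. v (real k * h)"])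
        (use step h lam e' in auto)
    also have "\<dots> = lam * e' * (real n * h)" by simp
    also have "\<dots> = e / 2" using lam t by (simp add: h(4) e'_def)
    also have "\<dots> < e" using e by simp
    finally show "norm (linear_recursion (1 - lam * (t / n)) (v 0)
     (\<lambda>k. b (real (Suc k) * (t / n)) - b (real k * (t / n))) n - v t) < e"
      unfolding h(4) by (simp add: norm_minus_commute h_def)
  qed
qed

section \<open>The law of the Ornstein-Uhlenbeck process\<close>

text \<open>One Euler step on the level of laws. Laws of the form "multiple of the initial value
  plus independent Gaussian" are stable: for a fixed initial value \<open>x\<close>, the old and the
  new noise are independent Gaussians and merge into one.\<close>

lemma distr_add_indep_gauss:
  fixes X Y :: "'w \<Rightarrow> 'a::euclidean_space" and R :: "'a measure"
  assumes P: "prob_space P" and R: "prob_space R" and [measurable_cong]: "sets R = sets borel"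
    and ind: "prob_space.indep_var P borel X borel Y"
    and Y: "distr P borel Y = isotropic_normal 0 c" and c: "c > 0"
    and X: "distr P borel X = distr (R \<Otimes>\<^sub>M std_gauss) borel (\<lambda>(x, z). p *\<^sub>R x + s *\<^sub>R z)"
    and s: "s \<ge> 0" and q: "q \<ge> 0" and \<delta>: "\<delta> \<ge> 0"
  shows "distr P borel (\<lambda>\<omega>. q *\<^sub>R X \<omega> + \<delta> *\<^sub>R Y \<omega>) =
    distr (R \<Otimes>\<^sub>M std_gauss) borel (\<lambda>(x, z). (q * p) *\<^sub>R x + sqrt ((q * s)\<^sup>2 + \<delta>\<^sup>2 * c) *\<^sub>R z)"
proof (rule measure_eqI_nn_integral)
  fix g :: "'a \<Rightarrow> ennreal"
  assume "g \<in> borel_measurable (distr P borel (\<lambda>\<omega>. q *\<^sub>R X \<omega> + \<delta> *\<^sub>R Y \<omega>))"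
  then have [measurable]: "g \<in> borel_measurable borel" by simp
  interpret P: prob_space P by fact
  interpret R: prob_space R by fact
  interpret N: prob_space "std_gauss :: 'a measure" by (rule prob_space_isotropic_normal) simp
  interpret RN: pair_sigma_finite R "std_gauss :: 'a measure" ..
  have [measurable]: "X \<in> borel_measurable P" "Y \<in> borel_measurable P"
    and XY: "distr P (borel \<Otimes>\<^sub>M borel) (\<lambda>\<omega>. (X \<omega>, Y \<omega>)) = distr P borel X \<Otimes>\<^sub>M distr P borel Y"
    using ind unfolding P.indep_var_distribution_eq by auto
  interpret LX: prob_space "distr P borel X" by (rule P.prob_space_distr) measurable
  interpret LY: prob_space "distr P borel Y" by (rule P.prob_space_distr) measurable
  interpret L: pair_sigma_finite "distr P borel X" "distr P borel Y" ..
  have Y': "distr P borel Y = distr std_gauss borel (\<lambda>z. sqrt c *\<^sub>R z)"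
    using isotropic_normal_eq_distr[of "sqrt c" 0] c by (simp add: Y)
  have inner: "(\<integral>\<^sup>+u. g (q *\<^sub>R u + \<delta> *\<^sub>R y) \<partial>distr P borel X) =
      (\<integral>\<^sup>+x. \<integral>\<^sup>+z. g ((q * p) *\<^sub>R x + ((q * s) *\<^sub>R z + \<delta> *\<^sub>R y)) \<partial>std_gauss \<partial>R)" for y
  proof -
    have "(\<integral>\<^sup>+u. g (q *\<^sub>R u + \<delta> *\<^sub>R y) \<partial>distr P borel X) =
        (\<integral>\<^sup>+w. (\<lambda>(x, z). g ((q * p) *\<^sub>R x + ((q * s) *\<^sub>R z + \<delta> *\<^sub>R y))) w \<partial>(R \<Otimes>\<^sub>M std_gauss))"
      unfolding X by (subst nn_integral_distr) (auto intro!: nn_integral_cong simp: scaleR_add_right add.assoc)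
    also have "\<dots> = (\<integral>\<^sup>+x. \<integral>\<^sup>+z. g ((q * p) *\<^sub>R x + ((q * s) *\<^sub>R z + \<delta> *\<^sub>R y)) \<partial>std_gauss \<partial>R)"
      by (subst N.nn_integral_fst[symmetric]) auto
    finally show ?thesis .
  qed
  have "(\<integral>\<^sup>+x. g x \<partial>distr P borel (\<lambda>\<omega>. q *\<^sub>R X \<omega> + \<delta> *\<^sub>R Y \<omega>)) =
      (\<integral>\<^sup>+w. (\<lambda>(u, y). g (q *\<^sub>R u + \<delta> *\<^sub>R y)) w \<partial>distr P (borel \<Otimes>\<^sub>M borel) (\<lambda>\<omega>. (X \<omega>, Y \<omega>)))"
    by (simp add: nn_integral_distr)
  also have "\<dots> = (\<integral>\<^sup>+y. \<integral>\<^sup>+u. g (q *\<^sub>R u + \<delta> *\<^sub>R y) \<partial>distr P borel X \<partial>distr P borel Y)"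
    unfolding XY by (subst L.nn_integral_snd[symmetric]) auto
  also have "\<dots> = (\<integral>\<^sup>+y. \<integral>\<^sup>+x. \<integral>\<^sup>+z. g ((q * p) *\<^sub>R x + ((q * s) *\<^sub>R z + (\<delta> * sqrt c) *\<^sub>R y)) \<partial>std_gauss \<partial>R \<partial>std_gauss)"
    unfolding inner unfolding Y' by (subst nn_integral_distr) auto
  also have "\<dots> = (\<integral>\<^sup>+x. \<integral>\<^sup>+y. \<integral>\<^sup>+z. g ((q * p) *\<^sub>R x + ((q * s) *\<^sub>R z + (\<delta> * sqrt c) *\<^sub>R y)) \<partial>std_gauss \<partial>std_gauss \<partial>R)"
    by (rule RN.Fubini') measurable
  also have "\<dots> = (\<integral>\<^sup>+x. \<integral>\<^sup>+z. g ((q * p) *\<^sub>R x + sqrt ((q * s)\<^sup>2 + (\<delta> * sqrt c)\<^sup>2) *\<^sub>R z) \<partial>std_gauss \<partial>R)"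
    using s q \<delta> c
    by (intro nn_integral_cong pair_std_gauss_lincomb[of "\<lambda>u. g (_ + u)"]) auto
  also have "\<dots> = (\<integral>\<^sup>+w. (\<lambda>(x, z). g ((q * p) *\<^sub>R x + sqrt ((q * s)\<^sup>2 + (\<delta> * sqrt c)\<^sup>2) *\<^sub>R z)) w \<partial>(R \<Otimes>\<^sub>M std_gauss))"
    by (subst N.nn_integral_fst[symmetric]) auto
  also have "\<dots> = (\<integral>\<^sup>+x. g x \<partial>distr (R \<Otimes>\<^sub>M std_gauss) borel (\<lambda>(x, z). (q * p) *\<^sub>R x + sqrt ((q * s)\<^sup>2 + \<delta>\<^sup>2 * c) *\<^sub>R z))"
    using c by (subst nn_integral_distr) (auto intro!: nn_integral_cong simp: power_mult_distrib)
  finally show "(\<integral>\<^sup>+x. g x \<partial>distr P borel (\<lambda>\<omega>. q *\<^sub>R X \<omega> + \<delta> *\<^sub>R Y \<omega>)) =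
    (\<integral>\<^sup>+x. g x \<partial>distr (R \<Otimes>\<^sub>M std_gauss) borel (\<lambda>(x, z). (q * p) *\<^sub>R x + sqrt ((q * s)\<^sup>2 + \<delta>\<^sup>2 * c) *\<^sub>R z))" .
qed simp

section \<open>Independence of Brownian increments and the exact law of the Euler scheme\<close>

lemma brownian_motion_measurable:
  assumes "brownian_motion P F B" "t \<ge> 0" "X \<in> borel_measurable (F t)"
  shows "X \<in> borel_measurable P"
  using assms measurable_from_subalg unfolding brownian_motion_def by blast

text \<open>Independence of random variables is the form that yields a product law. It concerns
  generated sigma-algebras, whereas \<open>brownian_motion\<close> speaks of preimages of Borel
  sets; these are closed under intersection, so independence extends.\<close>

lemma brownian_motion_indep_var:
  fixes B :: "real \<Rightarrow> 'w \<Rightarrow> 'a::euclidean_space" and X :: "'w \<Rightarrow> 'a"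
  assumes bm: "brownian_motion P F B" and st: "0 \<le> s" "s < t" and X: "X \<in> borel_measurable (F s)"
  shows "prob_space.indep_var P borel X borel (\<lambda>\<omega>. B t \<omega> - B s \<omega>)"
proof -
  interpret prob_space P using bm by (simp add: brownian_motion_def)
  have "B r \<in> borel_measurable P" if "r \<ge> 0" for r
    by (rule brownian_motion_measurable[OF bm that]) (use bm that in \<open>simp add: brownian_motion_def\<close>)
  then have "B s \<in> borel_measurable P" "B t \<in> borel_measurable P"
    using st by auto
  then have Bm: "(\<lambda>\<omega>. B t \<omega> - B s \<omega>) \<in> borel_measurable P" by measurable
  have Xm: "X \<in> borel_measurable P"
    using brownian_motion_measurable[OF bm st(1) X] .
  have sp: "space (F s) = space P"
    using bm st by (auto simp: brownian_motion_def subalgebra_def)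
  let ?B = "{(\<lambda>\<omega>. B t \<omega> - B s \<omega>) -` A \<inter> space P | A. A \<in> sets borel}"
  let ?A = "{X -` A \<inter> space P | A. A \<in> sets borel}"
  have stable: "Int_stable {Y -` A \<inter> space P | A. A \<in> sets borel}" for Y :: "'w \<Rightarrow> 'a"
  proof (rule Int_stableI)
    fix C D assume "C \<in> {Y -` A \<inter> space P | A. A \<in> sets borel}" "D \<in> {Y -` A \<inter> space P | A. A \<in> sets borel}"
    then obtain c d where "C = Y -` c \<inter> space P" "D = Y -` d \<inter> space P" "c \<in> sets borel" "d \<in> sets borel"
      by blast
    then have "C \<inter> D = Y -` (c \<inter> d) \<inter> space P" "c \<inter> d \<in> sets borel" by auto
    then show "C \<inter> D \<in> {Y -` A \<inter> space P | A. A \<in> sets borel}" by blast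
  qed
  have ind: "indep_set (sets (F s)) ?B"
    using bm st unfolding brownian_motion_def by blast
  have sub: "?A \<subseteq> sets (F s)"
    using measurable_sets[OF X] by (auto simp: sp)
  have "indep_set ?A ?B"
    unfolding indep_set_def
  proof (rule indep_sets_mono_sets[OF ind[unfolded indep_set_def]])
    show "case_bool ?A ?B i \<subseteq> case_bool (sets (F s)) ?B i" for i
      using sub by (cases i) simp_all
  qed
  then have "indep_set (sigma_sets (space P) ?A) (sigma_sets (space P) ?B)"
    by (intro indep_set_sigma_sets stable)
  then show ?thesis
    using Xm Bm by (simp add: indep_var_eq)
qed

text \<open>The measurability claim belongs to the induction because it makes \<open>U k\<close>
  independent of the next increment. Each step multiplies the accumulated variance by
  \<open>q\<^sup>2\<close> and adds \<open>\<delta>\<^sup>2 * h\<close>, which produces the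
  geometric sum.\<close>

lemma linear_recursion_law:
  fixes B :: "real \<Rightarrow> 'w \<Rightarrow> 'a::euclidean_space" and x0 :: "'w \<Rightarrow> 'a"
  assumes bm: "brownian_motion P F B" and x0: "x0 \<in> borel_measurable (F 0)"
    and h: "h > 0" and q: "q \<ge> 0" and \<delta>: "\<delta> \<ge> 0"
  defines "U \<equiv> \<lambda>k \<omega>. linear_recursion q (x0 \<omega>) (\<lambda>j. \<delta> *\<^sub>R B (real (Suc j) * h) \<omega> - \<delta> *\<^sub>R B (real j * h) \<omega>) k"
  shows "U k \<in> borel_measurable (F (real k * h)) \<and>
    distr P borel (U k) = distr (distr P borel x0 \<Otimes>\<^sub>M std_gauss) borel
      (\<lambda>(x, z). q ^ k *\<^sub>R x + sqrt (\<delta>\<^sup>2 * h * (\<Sum>j<k. (q\<^sup>2) ^ j)) *\<^sub>R z)"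
proof (induction k)
  case 0
  interpret P: prob_space P using bm by (simp add: brownian_motion_def)
  have [measurable]: "x0 \<in> borel_measurable P"
    using brownian_motion_measurable[OF bm _ x0] by simp
  interpret R: prob_space "distr P borel x0" by (rule P.prob_space_distr) measurable
  interpret N: prob_space "std_gauss :: 'a measure" by (rule prob_space_isotropic_normal) simp
  have "distr P borel x0 = distr (distr P borel x0 \<Otimes>\<^sub>M (std_gauss :: 'a measure)) (distr P borel x0) fst"
    by (rule N.distr_pair_fst[symmetric])
  also have "\<dots> = distr (distr P borel x0 \<Otimes>\<^sub>M (std_gauss :: 'a measure)) borel fst"
    by (rule distr_cong) auto
  finally show ?case using x0 by (simp add: U_def case_prod_unfold)
next
  case (Suc k)
  interpret P: prob_space P using bm by (simp add: brownian_motion_def)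
  have [measurable]: "x0 \<in> borel_measurable P"
    using brownian_motion_measurable[OF bm _ x0] by simp
  have filt: "filtration (space P) F" using bm by (simp add: brownian_motion_def)
  have sub: "subalgebra (F (real (Suc k) * h)) (F (real k * h))"
    using filtration.sets_F_mono[OF filt, of "real k * h" "real (Suc k) * h"] filtration.space_F[OF filt] h
    by (auto simp: subalgebra_def)
  have Uk: "U k \<in> borel_measurable (F (real k * h))" using Suc by simp
  have [measurable]: "U k \<in> borel_measurable (F (real (Suc k) * h))"
    "B (real (Suc k) * h) \<in> borel_measurable (F (real (Suc k) * h))"
    "B (real k * h) \<in> borel_measurable (F (real (Suc k) * h))"
    using bm h measurable_from_subalg[OF sub Uk] measurable_from_subalg[OF sub, of "B (real k * h)"]
    by (simp_all add: brownian_motion_def)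
  have step: "U (Suc k) = (\<lambda>\<omega>. q *\<^sub>R U k \<omega> + \<delta> *\<^sub>R (B (real (Suc k) * h) \<omega> - B (real k * h) \<omega>))"
    by (auto simp: U_def fun_eq_iff scaleR_diff_right)
  have meas: "U (Suc k) \<in> borel_measurable (F (real (Suc k) * h))"
    unfolding step by measurable
  have ord: "0 \<le> real k * h" "real k * h < real (Suc k) * h" using h by auto
  have "real (Suc k) * h - real k * h = h" by (simp add: algebra_simps)
  then have inc: "distr P borel (\<lambda>\<omega>. B (real (Suc k) * h) \<omega> - B (real k * h) \<omega>) = isotropic_normal 0 h"
    using bm ord unfolding brownian_motion_def by metis
  let ?w = "\<lambda>k. \<delta>\<^sup>2 * h * (\<Sum>j<k. (q\<^sup>2) ^ j)"
  have w0: "?w k \<ge> 0" using h by (simp add: sum_nonneg)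
  have "distr P borel (U (Suc k)) = distr (distr P borel x0 \<Otimes>\<^sub>M std_gauss) borel
      (\<lambda>(x, z). (q * q ^ k) *\<^sub>R x + sqrt ((q * sqrt (?w k))\<^sup>2 + \<delta>\<^sup>2 * h) *\<^sub>R z)"
    unfolding step
    by (rule distr_add_indep_gauss[OF P.prob_space_axioms P.prob_space_distr _
          brownian_motion_indep_var[OF bm ord Uk] inc h])
      (use Suc w0 q \<delta> in auto)
  \<comment> \<open>The new increment contributes the term with index 0, while the factor
    \<open>q\<^sup>2\<close> shifts the old terms by one.\<close>
  also have "(q * sqrt (?w k))\<^sup>2 + \<delta>\<^sup>2 * h = ?w (Suc k)"
    using w0 unfolding sum.lessThan_Suc_shift
    by (simp add: power_mult_distrib sum_distrib_left algebra_simps)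
  finally show ?case using meas by simp
qed

text \<open>By the geometric sum formula the step width cancels against
  \<open>1 - (1 - lam * h)\<^sup>2 = h * (2 * lam - lam\<^sup>2 * h)\<close>, and
  \<open>(1 - lam * t / n) ^ n\<close> tends to \<open>exp (- lam * t)\<close>.\<close>

lemma ou_variance_limit:
  fixes lam t :: real
  assumes "lam > 0" "t > 0"
  shows "(\<lambda>n. (t / n) * (\<Sum>j<n. ((1 - lam * (t / n))\<^sup>2) ^ j)) \<longlonglongrightarrow> (1 - exp (- 2 * lam * t)) / (2 * lam)"
proof -
  have "(\<lambda>n. ((1 - lam * (t / real n)) ^ n)\<^sup>2) \<longlonglongrightarrow> (exp (- (lam * t)))\<^sup>2"
    using tendsto_exp_limit_sequentially[of "- (lam * t)"] by (intro tendsto_power) simp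
  note 1 = this
  have 2: "(\<lambda>n. 2 * lam - lam\<^sup>2 * (t / real n)) \<longlonglongrightarrow> 2 * lam - lam\<^sup>2 * 0"
    by (intro tendsto_intros lim_const_over_n)
  have "(\<lambda>n. (1 - ((1 - lam * (t / real n)) ^ n)\<^sup>2) / (2 * lam - lam\<^sup>2 * (t / real n))) \<longlonglongrightarrow>
      (1 - (exp (- (lam * t)))\<^sup>2) / (2 * lam - lam\<^sup>2 * 0)"
    by (rule tendsto_divide[OF tendsto_diff[OF tendsto_const 1] 2]) (use assms in simp)
  moreover have "eventually (\<lambda>n. (1 - ((1 - lam * (t / real n)) ^ n)\<^sup>2) / (2 * lam - lam\<^sup>2 * (t / real n)) =
     (t / n) * (\<Sum>j<n. ((1 - lam * (t / n))\<^sup>2) ^ j)) sequentially"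
    using eventually_gt_at_top[of "nat \<lceil>lam * t\<rceil>"]
  proof eventually_elim
    case (elim n)
    define h where "h = t / real n"
    \<comment> \<open>This gives \<open>0 < lam * h < 1\<close>, so the ratio of the geometric sum
      differs from 1.\<close>
    have n: "real n > lam * t" using elim by linarith
    then have n0: "real n > 0" using assms by (meson less_trans mult_pos_pos)
    have h: "h > 0" "lam * h < 1" using n n0 assms by (auto simp: h_def field_simps)
    have pos: "2 * lam - lam\<^sup>2 * h > 0"
    proof -
      have "lam * (2 - lam * h) > 0" using h assms by (intro mult_pos_pos) auto
      then show ?thesis by (simp add: algebra_simps power2_eq_square)
    qed
    have one: "1 - (1 - lam * h)\<^sup>2 = h * (2 * lam - lam\<^sup>2 * h)"
      by (simp add: power2_eq_square algebra_simps)
    have "(1 - lam * h)\<^sup>2 \<noteq> 1" using one pos h by auto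
    then have "(\<Sum>j<n. ((1 - lam * h)\<^sup>2) ^ j) = (1 - ((1 - lam * h)\<^sup>2) ^ n) / (1 - (1 - lam * h)\<^sup>2)"
      by (subst geometric_sum) (auto simp: field_simps)
    also have "\<dots> = (1 - ((1 - lam * h) ^ n)\<^sup>2) / (h * (2 * lam - lam\<^sup>2 * h))"
      unfolding one by (simp add: power_mult[symmetric] mult.commute)
    finally show ?case using h unfolding h_def[symmetric] by simp
  qed
  moreover have "(exp (- (lam * t)))\<^sup>2 = exp (- 2 * lam * t)" by (simp add: exp_double[symmetric])
  ultimately show ?thesis by (simp add: Lim_transform_eventually)
qed

text \<open>The Euler schemes \<open>U n\<close> converge almost surely to \<open>V t\<close>, and
  the functions \<open>W n\<close> with the same laws converge because both coefficients do.\<close>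

lemma ornstein_uhlenbeck_law:
  fixes V B :: "real \<Rightarrow> 'w \<Rightarrow> 'a::euclidean_space"
  assumes bm: "brownian_motion P F B" and lam: "lam > 0" and \<delta>: "\<delta> > 0"
    and ad: "\<And>t. t \<ge> 0 \<Longrightarrow> V t \<in> borel_measurable (F t)"
    and cont: "AE \<omega> in P. continuous_on {0..} (\<lambda>t. V t \<omega>)"
    and eq: "AE \<omega> in P. \<forall>t\<ge>0. ((\<lambda>s. - lam *\<^sub>R V s \<omega>) has_integral (V t \<omega> - V 0 \<omega> - \<delta> *\<^sub>R B t \<omega>)) {0..t}"
    and t: "t \<ge> 0"
  shows "distr P borel (V t) = distr (distr P borel (V 0) \<Otimes>\<^sub>M std_gauss) borel
     (\<lambda>(x, z). exp (- lam * t) *\<^sub>R x + sqrt (\<delta>\<^sup>2 / (2 * lam) * (1 - exp (- 2 * lam * t))) *\<^sub>R z)"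
proof -
  interpret P: prob_space P using bm by (simp add: brownian_motion_def)
  have Vm [measurable]: "V t \<in> borel_measurable P" if "t \<ge> 0" for t
    using brownian_motion_measurable[OF bm that ad[OF that]] .
  have [measurable]: "V 0 \<in> borel_measurable P" by (rule Vm) simp
  have Bm [measurable]: "B t \<in> borel_measurable P" if "t \<ge> 0" for t
    by (rule brownian_motion_measurable[OF bm that]) (use bm that in \<open>simp add: brownian_motion_def\<close>)
  interpret R: prob_space "distr P borel (V 0)" by (rule P.prob_space_distr) measurable
  interpret N: prob_space "std_gauss :: 'a measure" by (rule prob_space_isotropic_normal) simp
  interpret RN: pair_prob_space "distr P borel (V 0)" "std_gauss :: 'a measure" ..
  show ?thesis
  proof (cases "t = 0")
    \<comment> \<open>At time 0 the step width \<open>t / n\<close> would vanish; here the noise has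
      amplitude 0 and the law is that of the first component.\<close>
    case True
    have "distr P borel (V 0) = distr (distr P borel (V 0) \<Otimes>\<^sub>M (std_gauss :: 'a measure)) (distr P borel (V 0)) fst"
      by (rule N.distr_pair_fst[symmetric])
    also have "\<dots> = distr (distr P borel (V 0) \<Otimes>\<^sub>M (std_gauss :: 'a measure)) borel fst"
      by (rule distr_cong) auto
    finally show ?thesis using True by (simp add: case_prod_unfold)
  next
    case False
    with t have t: "t > 0" by simp
    \<comment> \<open>For fewer than \<open>lam * t\<close> steps the factor
      \<open>1 - lam * t / n\<close> may be negative, outside the scope of
      \<open>linear_recursion_law\<close>. The value \<open>V 0\<close> is a measurable placeholder
      for these finitely many \<open>n\<close>.\<close>
    define U where "U n \<omega> = (if lam * t \<le> real n then linear_recursion (1 - lam * (t / real n)) (V 0 \<omega>)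
       (\<lambda>k. \<delta> *\<^sub>R B (real (Suc k) * (t / real n)) \<omega> - \<delta> *\<^sub>R B (real k * (t / real n)) \<omega>) n else V 0 \<omega>)" for n \<omega>
    define W where "W n = (\<lambda>(x::'a, z::'a). (1 - lam * (t / real n)) ^ n *\<^sub>R x +
      sqrt (\<delta>\<^sup>2 * ((t / n) * (\<Sum>j<n. ((1 - lam * (t / n))\<^sup>2) ^ j))) *\<^sub>R z)" for n
    note law = linear_recursion_law[OF bm ad[of 0], of "t / real n" "1 - lam * (t / real n)" \<delta> n for n]
    have pr: "real n > 0" "1 - lam * (t / real n) \<ge> 0" if "lam * t \<le> real n" for n
    proof -
      show "real n > 0" using that lam t by (meson less_le_trans mult_pos_pos)
      then show "1 - lam * (t / real n) \<ge> 0" using that by (simp add: field_simps)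
    qed
    show ?thesis
    proof (rule distr_eqI_limit[of P "distr P borel (V 0) \<Otimes>\<^sub>M std_gauss" U "V t" W])
      show "U n \<in> borel_measurable P" for n
      proof (cases "lam * t \<le> real n")
        case True
        have m: "(\<lambda>\<omega>. linear_recursion (1 - lam * (t / real n)) (V 0 \<omega>)
           (\<lambda>k. \<delta> *\<^sub>R B (real (Suc k) * (t / real n)) \<omega> - \<delta> *\<^sub>R B (real k * (t / real n)) \<omega>) n) \<in> borel_measurable (F (real n * (t / real n)))"
          using law[of n] pr[OF True] t \<delta> by auto
        have "0 \<le> real n * (t / real n)" using t by simp
        from brownian_motion_measurable[OF bm this m] show ?thesis
          using True unfolding U_def[abs_def] by (simp only: if_True)
      qed (simp add: U_def[abs_def])
      show "AE \<omega> in P. (\<lambda>n. U n \<omega>) \<longlonglongrightarrow> V t \<omega>"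
        using cont eq
      proof eventually_elim
        case (elim \<omega>)
        have "(\<lambda>n. linear_recursion (1 - lam * (t / n)) (V 0 \<omega>)
           (\<lambda>k. \<delta> *\<^sub>R B (real (Suc k) * (t / n)) \<omega> - \<delta> *\<^sub>R B (real k * (t / n)) \<omega>) n) \<longlonglongrightarrow> V t \<omega>"
          by (rule euler_scheme_converges[of lam t "\<lambda>t. V t \<omega>" "\<lambda>t. \<delta> *\<^sub>R B t \<omega>"]) (use lam t elim in auto)
        then show ?case
          by (rule Lim_transform_eventually)
            (use eventually_ge_at_top[of "nat \<lceil>lam * t\<rceil>"] in eventually_elim, auto simp: U_def nat_le_iff ceiling_le_iff)
      qed
      have lim1: "(\<lambda>n. (1 - lam * (t / real n)) ^ n) \<longlonglongrightarrow> exp (- lam * t)"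
        using tendsto_exp_limit_sequentially[of "- (lam * t)"] by simp
      have "(\<lambda>n. sqrt (\<delta>\<^sup>2 * ((t / n) * (\<Sum>j<n. ((1 - lam * (t / n))\<^sup>2) ^ j)))) \<longlonglongrightarrow> sqrt (\<delta>\<^sup>2 * ((1 - exp (- 2 * lam * t)) / (2 * lam)))"
        by (intro tendsto_real_sqrt tendsto_mult tendsto_const ou_variance_limit lam t)
      then have lim2: "(\<lambda>n. sqrt (\<delta>\<^sup>2 * ((t / n) * (\<Sum>j<n. ((1 - lam * (t / n))\<^sup>2) ^ j)))) \<longlonglongrightarrow> sqrt (\<delta>\<^sup>2 / (2 * lam) * (1 - exp (- 2 * lam * t)))"
        by simp
      show "AE \<omega> in distr P borel (V 0) \<Otimes>\<^sub>M std_gauss. (\<lambda>n. W n \<omega>) \<longlonglongrightarrow>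
         (case \<omega> of (x, z) \<Rightarrow> exp (- lam * t) *\<^sub>R x + sqrt (\<delta>\<^sup>2 / (2 * lam) * (1 - exp (- 2 * lam * t))) *\<^sub>R z)"
        unfolding W_def case_prod_unfold
        by (intro AE_I2 tendsto_add tendsto_scaleR lim1 lim2 tendsto_const)
      show "eventually (\<lambda>n. distr P borel (U n) = distr (distr P borel (V 0) \<Otimes>\<^sub>M std_gauss) borel (W n)) sequentially"
        using eventually_ge_at_top[of "nat \<lceil>lam * t\<rceil>"]
      proof eventually_elim
        case (elim n)
        then have le: "lam * t \<le> real n" by linarith
        show ?case
          using law[of n] pr[OF le] t \<delta> le by (auto simp: U_def[abs_def] W_def mult.assoc)
      qed
    qed (use Vm t in \<open>auto simp: W_def P.prob_space_axioms RN.prob_space_axioms\<close>)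
  qed
qed

section \<open>Wasserstein distance and couplings\<close>

abbreviation transport_cost :: "('a::euclidean_space \<times> 'a) measure \<Rightarrow> ennreal" where
  "transport_cost \<pi> \<equiv> \<integral>\<^sup>+z. ennreal ((dist (fst z) (snd z))\<^sup>2) \<partial>\<pi>"

lemma W2_nonneg [simp]: "W2 \<mu> \<nu> \<ge> 0"
  by (simp add: W2_def)

lemma W2_le:
  assumes "\<pi> \<in> couplings \<mu> \<nu>" "transport_cost \<pi> \<le> ennreal (k\<^sup>2)" "k \<ge> 0"
  shows "W2 \<mu> \<nu> \<le> k"
proof -
  have "(INF \<pi>\<in>couplings \<mu> \<nu>. transport_cost \<pi>) \<le> ennreal (k\<^sup>2)"
    using assms by (auto intro: INF_lower2)
  then have "enn2real (INF \<pi>\<in>couplings \<mu> \<nu>. transport_cost \<pi>) \<le> k\<^sup>2"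
    by (intro enn2real_leI) auto
  then show ?thesis
    unfolding W2_def using assms(3) by (intro real_le_lsqrt) auto
qed

text \<open>The coupling of finite cost rules out that \<open>enn2real\<close> sends an infinite
  infimum to 0. The square of \<open>W2\<close> is then the true infimum, and any larger number is
  undercut by some coupling.\<close>

lemma near_optimal_coupling:
  assumes "\<pi>0 \<in> couplings \<mu> \<nu>" "transport_cost \<pi>0 < \<infinity>" "e > 0"
  obtains \<pi> where "\<pi> \<in> couplings \<mu> \<nu>" "transport_cost \<pi> \<le> ennreal ((W2 \<mu> \<nu> + e)\<^sup>2)"
proof -
  let ?I = "INF \<pi>\<in>couplings \<mu> \<nu>. transport_cost \<pi>"
  have fin: "?I < \<infinity>" using INF_lower[OF assms(1), of transport_cost] assms(2) by (rule order.strict_trans1)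
  have "(W2 \<mu> \<nu>)\<^sup>2 = enn2real ?I" by (simp add: W2_def)
  then have "?I = ennreal ((W2 \<mu> \<nu>)\<^sup>2)" using fin by simp
  also have "\<dots> < ennreal ((W2 \<mu> \<nu> + e)\<^sup>2)"
    using assms(3) by (intro ennreal_lessI power_strict_mono zero_less_power add_nonneg_pos) auto
  finally obtain \<pi> where "\<pi> \<in> couplings \<mu> \<nu>" "transport_cost \<pi> < ennreal ((W2 \<mu> \<nu> + e)\<^sup>2)"
    by (auto simp: INF_less_iff)
  then show ?thesis using that less_imp_le by blast
qed

lemma couplingsD:
  assumes "\<pi> \<in> couplings \<mu> \<nu>"
  shows "prob_space \<pi>" "sets \<pi> = sets borel" "distr \<pi> borel fst = \<mu>" "distr \<pi> borel snd = \<nu>"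
  using assms by (auto simp: couplings_def)

lemma pair_measure_coupling:
  fixes \<mu> \<nu> :: "'a::euclidean_space measure"
  assumes "prob_space \<mu>" "prob_space \<nu>" and [measurable_cong]: "sets \<mu> = sets borel" "sets \<nu> = sets borel"
  shows "\<mu> \<Otimes>\<^sub>M \<nu> \<in> couplings \<mu> \<nu>"
proof -
  interpret \<mu>: prob_space \<mu> by fact
  interpret \<nu>: prob_space \<nu> by fact
  interpret pair_prob_space \<mu> \<nu> ..
  have sb: "sets (\<mu> \<Otimes>\<^sub>M \<nu>) = sets (borel :: ('a \<times> 'a) measure)"
    unfolding borel_prod[symmetric] by (intro sets_pair_measure_cong assms)
  have 1: "distr (\<mu> \<Otimes>\<^sub>M \<nu>) borel fst = \<mu>"
    using \<nu>.distr_pair_fst[of \<mu>] distr_cong[OF refl assms(3) refl, of "\<mu> \<Otimes>\<^sub>M \<nu>" fst] by simp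
  have "\<nu> = distr (\<nu> \<Otimes>\<^sub>M \<mu>) \<nu> fst" by (rule \<mu>.distr_pair_fst[symmetric])
  also have "\<dots> = distr (\<mu> \<Otimes>\<^sub>M \<nu>) borel snd"
    by (subst distr_pair_swap, subst distr_distr)
      (auto intro!: distr_cong assms simp: comp_def case_prod_unfold)
  finally have "distr (\<mu> \<Otimes>\<^sub>M \<nu>) borel snd = \<nu>" by simp
  with 1 sb prob_space_axioms show ?thesis by (simp add: couplings_def)
qed

text \<open>The independent coupling does it, since the squared distance is at most twice the sum of
  the squared norms.\<close>

lemma finite_cost_coupling:
  fixes \<mu> \<nu> :: "'a::euclidean_space measure"
  assumes "prob_space \<mu>" "prob_space \<nu>" and [measurable_cong]: "sets \<mu> = sets borel" "sets \<nu> = sets borel"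
    and \<mu>: "(\<integral>\<^sup>+x. ennreal ((norm x)\<^sup>2) \<partial>\<mu>) < \<infinity>" and \<nu>: "(\<integral>\<^sup>+x. ennreal ((norm x)\<^sup>2) \<partial>\<nu>) < \<infinity>"
  obtains \<pi> where "\<pi> \<in> couplings \<mu> \<nu>" "transport_cost \<pi> < \<infinity>"
proof -
  interpret \<mu>: prob_space \<mu> by fact
  interpret \<nu>: prob_space \<nu> by fact
  have pt: "(dist x y)\<^sup>2 \<le> 2 * (norm x)\<^sup>2 + 2 * (norm y)\<^sup>2" for x y :: 'a
  proof -
    have "(dist x y)\<^sup>2 \<le> (norm x + norm y)\<^sup>2"
      by (intro power_mono) (auto simp: dist_norm norm_triangle_ineq4)
    moreover have "0 \<le> (norm x - norm y)\<^sup>2" by simp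
    ultimately show ?thesis by (simp add: power2_sum power2_diff)
  qed
  have "transport_cost (\<mu> \<Otimes>\<^sub>M \<nu>) = (\<integral>\<^sup>+x. \<integral>\<^sup>+y. ennreal ((dist x y)\<^sup>2) \<partial>\<nu> \<partial>\<mu>)"
    by (subst \<nu>.nn_integral_fst[symmetric]) auto
  also have "\<dots> \<le> (\<integral>\<^sup>+x. \<integral>\<^sup>+y. (ennreal 2 * ennreal ((norm x)\<^sup>2) + ennreal 2 * ennreal ((norm y)\<^sup>2)) \<partial>\<nu> \<partial>\<mu>)"
  proof (intro nn_integral_mono)
    fix x y :: 'a
    have "ennreal ((dist x y)\<^sup>2) \<le> ennreal (2 * (norm x)\<^sup>2 + 2 * (norm y)\<^sup>2)"
      by (rule ennreal_leI[OF pt])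
    also have "\<dots> = ennreal 2 * ennreal ((norm x)\<^sup>2) + ennreal 2 * ennreal ((norm y)\<^sup>2)"
      by (subst ennreal_plus) (simp_all add: ennreal_mult)
    finally show "ennreal ((dist x y)\<^sup>2) \<le> ennreal 2 * ennreal ((norm x)\<^sup>2) + ennreal 2 * ennreal ((norm y)\<^sup>2)" .
  qed
  also have "\<dots> = ennreal 2 * (\<integral>\<^sup>+x. ennreal ((norm x)\<^sup>2) \<partial>\<mu>) + ennreal 2 * (\<integral>\<^sup>+x. ennreal ((norm x)\<^sup>2) \<partial>\<nu>)"
    by (simp add: nn_integral_add nn_integral_cmult \<nu>.emeasure_space_1 \<mu>.emeasure_space_1 del: ennreal_numeral)
  also have "\<dots> < \<infinity>" using \<mu> \<nu> by (simp add: ennreal_mult_less_top)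
  finally have "transport_cost (\<mu> \<Otimes>\<^sub>M \<nu>) < \<infinity>" .
  then show ?thesis using that pair_measure_coupling[OF assms(1-4)] by blast
qed

text \<open>Used with \<open>fst\<close> and \<open>snd\<close> for \<open>p\<close>: adding
  independent noise to a coupled pair and keeping one component gives the same law as adding the
  noise to the corresponding marginal.\<close>

lemma distr_coupling_noise:
  fixes \<rho> :: "'a::euclidean_space measure" and p :: "'a \<times> 'a \<Rightarrow> 'a"
  assumes "prob_space \<pi>" and [measurable_cong]: "sets \<pi> = sets borel"
    and \<rho>: "distr \<pi> borel p = \<rho>" and [measurable]: "p \<in> borel_measurable borel"
    and [measurable]: "(\<lambda>(x, z). k x z) \<in> borel_measurable (borel \<Otimes>\<^sub>M borel)"
  shows "distr (\<pi> \<Otimes>\<^sub>M std_gauss) borel (\<lambda>(u, z). k (p u) z) =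
    distr (\<rho> \<Otimes>\<^sub>M std_gauss) borel (\<lambda>(x, z). k x (z::'a))"
proof -
  interpret N: prob_space "std_gauss :: 'a measure" by (rule prob_space_isotropic_normal) simp
  have id: "distr std_gauss borel (\<lambda>z. z) = (std_gauss :: 'a measure)"
    by (rule distr_id2) simp
  have "\<rho> \<Otimes>\<^sub>M (std_gauss :: 'a measure) = distr \<pi> borel p \<Otimes>\<^sub>M distr std_gauss borel (\<lambda>z::'a. z)"
    by (simp add: \<rho> id)
  also have "\<dots> = distr (\<pi> \<Otimes>\<^sub>M std_gauss) (borel \<Otimes>\<^sub>M borel) (\<lambda>(u, z). (p u, z))"
    by (rule pair_measure_distr) (auto simp: id N.sigma_finite_measure_axioms)
  finally have eq: "\<rho> \<Otimes>\<^sub>M (std_gauss :: 'a measure) = distr (\<pi> \<Otimes>\<^sub>M std_gauss) (borel \<Otimes>\<^sub>M borel) (\<lambda>(u, z). (p u, z))" .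
  show ?thesis unfolding eq
    by (subst distr_distr) (auto simp: comp_def case_prod_unfold)
qed

text \<open>A synchronous coupling: both components receive the same noise \<open>s z\<close>, which
  cancels in the difference. What remains is \<open>e (x - y) + (c - c')\<close>, whose root mean
  square is at most \<open>e * K + norm (c - c')\<close> by Minkowski's inequality.\<close>

lemma coupling_push:
  fixes \<rho> \<nu> :: "'a::euclidean_space measure" and c c' :: 'a and s e :: real
  assumes \<pi>: "\<pi> \<in> couplings \<rho> \<nu>" and cost: "transport_cost \<pi> \<le> ennreal (K\<^sup>2)" and K: "K > 0" and e: "e \<ge> 0"
  defines "\<pi>' \<equiv> distr (\<pi> \<Otimes>\<^sub>M std_gauss) borel (\<lambda>(u, z). (e *\<^sub>R fst u + (c + s *\<^sub>R z), e *\<^sub>R snd u + (c' + s *\<^sub>R z)))"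
  shows "\<pi>' \<in> couplings (distr (\<rho> \<Otimes>\<^sub>M std_gauss) borel (\<lambda>(x, z). e *\<^sub>R x + (c + s *\<^sub>R z)))
      (distr (\<nu> \<Otimes>\<^sub>M std_gauss) borel (\<lambda>(x, z). e *\<^sub>R x + (c' + s *\<^sub>R z)))"
    and "transport_cost \<pi>' \<le> ennreal ((e * K + norm (c - c'))\<^sup>2)"
proof -
  note c = couplingsD[OF \<pi>]
  have [measurable_cong]: "sets \<pi> = sets ((borel :: 'a measure) \<Otimes>\<^sub>M (borel :: 'a measure))"
    unfolding borel_prod by (rule c(2))
  interpret \<pi>: prob_space \<pi> by (rule c)
  interpret N: prob_space "std_gauss :: 'a measure" by (rule prob_space_isotropic_normal) simp
  interpret M: pair_prob_space \<pi> "std_gauss :: 'a measure" ..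
  have m [measurable]: "(\<lambda>(u, z). (e *\<^sub>R fst u + (c + s *\<^sub>R z), e *\<^sub>R snd u + (c' + s *\<^sub>R z)))
      \<in> borel_measurable (\<pi> \<Otimes>\<^sub>M std_gauss)"
    unfolding borel_prod[symmetric] by measurable
  have [measurable]: "fst \<in> borel_measurable (borel :: ('a \<times> 'a) measure)" "snd \<in> borel_measurable (borel :: ('a \<times> 'a) measure)"
    by (intro borel_measurable_continuous_onI continuous_intros)+
  have 1: "distr \<pi>' borel fst = distr (\<pi> \<Otimes>\<^sub>M std_gauss) borel (\<lambda>(u, z). e *\<^sub>R fst u + (c + s *\<^sub>R z))"
    unfolding \<pi>'_def by (subst distr_distr[OF _ m]) (auto simp: comp_def case_prod_unfold)
  have 2: "distr \<pi>' borel snd = distr (\<pi> \<Otimes>\<^sub>M std_gauss) borel (\<lambda>(u, z). e *\<^sub>R snd u + (c' + s *\<^sub>R z))"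
    unfolding \<pi>'_def by (subst distr_distr[OF _ m]) (auto simp: comp_def case_prod_unfold)
  have "prob_space \<pi>'" unfolding \<pi>'_def by (rule M.prob_space_distr[OF m])
  then show "\<pi>' \<in> couplings (distr (\<rho> \<Otimes>\<^sub>M std_gauss) borel (\<lambda>(x, z). e *\<^sub>R x + (c + s *\<^sub>R z)))
      (distr (\<nu> \<Otimes>\<^sub>M std_gauss) borel (\<lambda>(x, z). e *\<^sub>R x + (c' + s *\<^sub>R z)))"
    unfolding couplings_def mem_Collect_eq 1 2
    using distr_coupling_noise[OF c(1,2,3), of "\<lambda>x z. e *\<^sub>R x + (c + s *\<^sub>R z)"]
      distr_coupling_noise[OF c(1,2,4), of "\<lambda>x z. e *\<^sub>R x + (c' + s *\<^sub>R z)"]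
    by (auto simp: \<pi>'_def)
  define w where "w = norm (c - c')"
  have w: "w \<ge> 0" by (simp add: w_def)
  have pt: "(dist (e *\<^sub>R x + (c + s *\<^sub>R z)) (e *\<^sub>R y + (c' + s *\<^sub>R z)))\<^sup>2 \<le>
      (e\<^sup>2 + e * w / K) * (dist x y)\<^sup>2 + (e * w * K + w\<^sup>2)" for x y z
  proof -
    have "dist (e *\<^sub>R x + (c + s *\<^sub>R z)) (e *\<^sub>R y + (c' + s *\<^sub>R z)) = norm (e *\<^sub>R (x - y) + (c - c'))"
      by (simp add: dist_norm algebra_simps)
    also have "\<dots> \<le> e * dist x y + w"
      using norm_triangle_ineq[of "e *\<^sub>R (x - y)" "c - c'"] e by (simp add: dist_norm w_def)
    finally have "(dist (e *\<^sub>R x + (c + s *\<^sub>R z)) (e *\<^sub>R y + (c' + s *\<^sub>R z)))\<^sup>2 \<le> (e * dist x y + w)\<^sup>2"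
      by (intro power_mono) auto
    also have "\<dots> = e\<^sup>2 * (dist x y)\<^sup>2 + (e * w) * (2 * dist x y) + w\<^sup>2"
      by (simp add: power2_sum power_mult_distrib algebra_simps)
    \<comment> \<open>The cross term is linear in the distance. The arithmetic-geometric mean
      inequality with weight \<open>K\<close> trades it for a quadratic term and loses nothing when
      the distance is \<open>K\<close>, so the final bound is exactly the square of
      \<open>e * K + w\<close>.\<close>
    also have "(e * w) * (2 * dist x y) \<le> (e * w) * ((dist x y)\<^sup>2 / K + K)"
    proof (intro mult_left_mono)
      have "0 \<le> (dist x y - K)\<^sup>2" by simp
      then show "2 * dist x y \<le> (dist x y)\<^sup>2 / K + K"
        using K by (simp add: field_simps power2_eq_square)
    qed (use e w in auto)
    finally show ?thesis using K by (simp add: field_simps)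
  qed
  have "transport_cost \<pi>' = (\<integral>\<^sup>+q. (case q of (u, z) \<Rightarrow>
      ennreal ((dist (e *\<^sub>R fst u + (c + s *\<^sub>R z)) (e *\<^sub>R snd u + (c' + s *\<^sub>R z)))\<^sup>2)) \<partial>(\<pi> \<Otimes>\<^sub>M std_gauss))"
    unfolding \<pi>'_def by (subst nn_integral_distr[OF m]) (auto intro!: nn_integral_cong)
  also have "\<dots> \<le> (\<integral>\<^sup>+q. (case q of (u, z) \<Rightarrow>
      ennreal (e\<^sup>2 + e * w / K) * ennreal ((dist (fst u) (snd u))\<^sup>2) + ennreal (e * w * K + w\<^sup>2)) \<partial>(\<pi> \<Otimes>\<^sub>M (std_gauss :: 'a measure)))"
  proof (intro nn_integral_mono)
    fix q :: "('a \<times> 'a) \<times> 'a"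
    obtain x y z where q: "q = ((x, y), z)" by (metis surj_pair)
    have "ennreal ((dist (e *\<^sub>R x + (c + s *\<^sub>R z)) (e *\<^sub>R y + (c' + s *\<^sub>R z)))\<^sup>2) \<le>
        ennreal ((e\<^sup>2 + e * w / K) * (dist x y)\<^sup>2 + (e * w * K + w\<^sup>2))"
      by (rule ennreal_leI[OF pt])
    also have "\<dots> = ennreal (e\<^sup>2 + e * w / K) * ennreal ((dist x y)\<^sup>2) + ennreal (e * w * K + w\<^sup>2)"
      using e w K by (subst ennreal_plus) (simp_all add: ennreal_mult del: ennreal_plus)
    finally show "(case q of (u, z) \<Rightarrow> ennreal ((dist (e *\<^sub>R fst u + (c + s *\<^sub>R z)) (e *\<^sub>R snd u + (c' + s *\<^sub>R z)))\<^sup>2)) \<le>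
       (case q of (u, z) \<Rightarrow> ennreal (e\<^sup>2 + e * w / K) * ennreal ((dist (fst u) (snd u))\<^sup>2) + ennreal (e * w * K + w\<^sup>2))"
      unfolding q prod.case fst_conv snd_conv .
  qed
  also have "\<dots> = (\<integral>\<^sup>+u. (ennreal (e\<^sup>2 + e * w / K) * ennreal ((dist (fst u) (snd u))\<^sup>2) + ennreal (e * w * K + w\<^sup>2)) \<partial>\<pi>)"
    using N.emeasure_space_1 by (subst N.nn_integral_fst[symmetric]) auto
  also have "\<dots> = ennreal (e\<^sup>2 + e * w / K) * transport_cost \<pi> + ennreal (e * w * K + w\<^sup>2)"
    by (simp add: nn_integral_add nn_integral_cmult \<pi>.emeasure_space_1)
  also have "\<dots> \<le> ennreal (e\<^sup>2 + e * w / K) * ennreal (K\<^sup>2) + ennreal (e * w * K + w\<^sup>2)"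
    by (intro add_right_mono mult_left_mono cost) auto
  also have "\<dots> = ennreal ((e\<^sup>2 + e * w / K) * K\<^sup>2 + (e * w * K + w\<^sup>2))"
    using e w K by (subst (3) ennreal_plus) (simp_all add: ennreal_mult del: ennreal_plus)
  also have "(e\<^sup>2 + e * w / K) * K\<^sup>2 + (e * w * K + w\<^sup>2) = (e * K + w)\<^sup>2"
    using K by (simp add: power2_eq_square field_simps)
  finally show "transport_cost \<pi>' \<le> ennreal ((e * K + norm (c - c'))\<^sup>2)" by (simp add: w_def)
qed

text \<open>The mean distance under the coupling is at most \<open>K\<close>. In place of the
  Cauchy-Schwarz inequality, a distance \<open>d\<close> is bounded pointwise by
  \<open>(d\<^sup>2 / K + K) / 2\<close>, which integrates to at most \<open>K\<close>.\<close>

lemma coupling_lipschitz: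
  fixes g :: "'a::euclidean_space \<Rightarrow> 'a" and \<rho> \<nu> :: "'a measure"
  assumes \<pi>: "\<pi> \<in> couplings \<rho> \<nu>" and cost: "transport_cost \<pi> \<le> ennreal (K\<^sup>2)" and K: "K > 0"
    and [measurable]: "g \<in> borel_measurable borel" and bd: "\<And>x. norm (g x) \<le> b"
    and lip: "\<And>x y. norm (g x - g y) \<le> l * norm (x - y)" and l: "l \<ge> 0"
  shows "norm ((\<integral>x. g x \<partial>\<rho>) - (\<integral>x. g x \<partial>\<nu>)) \<le> l * K"
proof -
  note c = couplingsD[OF \<pi>]
  have [measurable_cong]: "sets \<pi> = sets ((borel :: 'a measure) \<Otimes>\<^sub>M (borel :: 'a measure))"
    unfolding borel_prod by (rule c(2))
  interpret \<pi>: prob_space \<pi> by (rule c)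
  have i: "integrable \<pi> (\<lambda>z. (dist (fst z) (snd z))\<^sup>2)"
    using order.strict_trans1[OF cost ennreal_less_top] by (intro integrableI_bounded) auto
  have "ennreal (\<integral>z. (dist (fst z) (snd z))\<^sup>2 \<partial>\<pi>) = transport_cost \<pi>"
    by (rule nn_integral_eq_integral[OF i, symmetric]) simp
  then have le: "(\<integral>z. (dist (fst z) (snd z))\<^sup>2 \<partial>\<pi>) \<le> K\<^sup>2"
    using cost by (metis ennreal_le_iff zero_le_power2)
  have ig: "integrable \<pi> (\<lambda>z. g (fst z))" "integrable \<pi> (\<lambda>z. g (snd z))"
    using bd by (auto intro!: \<pi>.integrable_const_bound[where B=b])
  have "(\<integral>x. g x \<partial>\<rho>) = (\<integral>z. g (fst z) \<partial>\<pi>)" unfolding c(3)[symmetric] by (rule integral_distr) auto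
  moreover have "(\<integral>x. g x \<partial>\<nu>) = (\<integral>z. g (snd z) \<partial>\<pi>)" unfolding c(4)[symmetric] by (rule integral_distr) auto
  ultimately have "(\<integral>x. g x \<partial>\<rho>) - (\<integral>x. g x \<partial>\<nu>) = (\<integral>z. g (fst z) - g (snd z) \<partial>\<pi>)"
    using ig by simp
  also have "norm \<dots> \<le> (\<integral>z. l * (((dist (fst z) (snd z))\<^sup>2 / K + K) / 2) \<partial>\<pi>)"
  proof (rule Bochner_Integration.integral_norm_bound_integral)
    show "integrable \<pi> (\<lambda>z. l * (((dist (fst z) (snd z))\<^sup>2 / K + K) / 2))" using i by auto
    fix z :: "'a \<times> 'a"
    have "0 \<le> (norm (fst z - snd z) - K)\<^sup>2" by simp
    then have "norm (fst z - snd z) \<le> ((dist (fst z) (snd z))\<^sup>2 / K + K) / 2"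
      using K by (simp add: field_simps power2_eq_square dist_norm)
    then show "norm (g (fst z) - g (snd z)) \<le> l * (((dist (fst z) (snd z))\<^sup>2 / K + K) / 2)"
      using lip[of "fst z" "snd z"] l mult_left_mono order_trans by blast
  qed (use ig in auto)
  also have "\<dots> = l * (((\<integral>z. (dist (fst z) (snd z))\<^sup>2 \<partial>\<pi>) / K + K) / 2)"
    using i by (simp add: \<pi>.prob_space)
  also have "\<dots> \<le> l * ((K\<^sup>2 / K + K) / 2)"
    using K l le by (intro mult_left_mono divide_right_mono add_right_mono) auto
  also have "\<dots> = l * K" using K by (simp add: power2_eq_square)
  finally show ?thesis .
qed

section \<open>Gibbs weights and the consensus point\<close>

text \<open>Inside the ball of radius \<open>M\<close> the weight is at most 1; outside, quadratic
  growth of \<open>h\<close> and \<open>u * exp (- u) \<le> 1\<close> control the polynomial. The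
  constant adds up the bounds of the two cases.\<close>

lemma gibbs_weight_growth:
  fixes h :: "'a::euclidean_space \<Rightarrow> real"
  assumes nn: "\<And>x. h x \<ge> 0" and cl: "cl > 0" and M: "M > 0"
    and lower: "\<And>x. norm x \<ge> M \<Longrightarrow> cl * (norm x)\<^sup>2 \<le> h x"
  shows "exp (- h x) * (1 + norm x)\<^sup>2 \<le> (1 + M)\<^sup>2 + 2 + 2 / cl"
proof (cases "norm x \<ge> M")
  case False
  have "exp (- h x) * (1 + norm x)\<^sup>2 \<le> 1 * (1 + M)\<^sup>2"
    using False nn[of x] by (intro mult_mono power_mono) auto
  also have "\<dots> \<le> (1 + M)\<^sup>2 + 2 + 2 / cl" using cl by simp
  finally show ?thesis .
next
  case True
  define u where "u = cl * (norm x)\<^sup>2"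
  have u: "u \<ge> 0" using cl by (simp add: u_def)
  have "0 \<le> (1 - norm x)\<^sup>2" by simp
  then have "(1 + norm x)\<^sup>2 \<le> 2 + 2 * (norm x)\<^sup>2" by (simp add: power2_sum power2_diff)
  then have "exp (- h x) * (1 + norm x)\<^sup>2 \<le> exp (- u) * (2 + 2 * (norm x)\<^sup>2)"
    using lower[OF True] by (intro mult_mono) (auto simp: u_def)
  also have "\<dots> = 2 * exp (- u) + 2 / cl * (u * exp (- u))"
    using cl by (simp add: u_def field_simps)
  also have "\<dots> \<le> 2 * 1 + 2 / cl * 1"
  proof (intro add_mono mult_left_mono)
    have "u \<le> exp u" using exp_ge_add_one_self[of u] by linarith
    then show "u * exp (- u) \<le> 1" by (simp add: exp_minus field_simps)
  qed (use u cl in auto)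
  also have "\<dots> \<le> (1 + M)\<^sup>2 + 2 + 2 / cl" by simp
  finally show ?thesis .
qed

text \<open>The local Lipschitz constant of \<open>h\<close> and the factor \<open>x - c\<close>
  each grow linearly in the norm, and the Gibbs weight absorbs the resulting
  \<open>(1 + norm x)\<^sup>2\<close>. Since \<alpha> \<ge> 1, the weight is dominated by the one
  for \<alpha> = 1, so \<alpha> enters only linearly, through the derivative of the exponential.
  Points at distance above 1 are handled by boundedness alone.\<close>

lemma gibbs_lipschitz:
  fixes h :: "'a::euclidean_space \<Rightarrow> real"
  assumes nn: "\<And>x. h x \<ge> 0" and C: "\<And>x. exp (- h x) * (1 + norm x)\<^sup>2 \<le> C"
    and Lf: "Lf \<ge> 0" "\<And>x y. \<bar>h x - h y\<bar> \<le> Lf * (1 + norm x + norm y) * norm (x - y)"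
    and S: "S \<ge> 0" and \<alpha>: "\<alpha> \<ge> 1" and c: "norm c \<le> S"
  shows "norm (exp (- \<alpha> * h x) *\<^sub>R (x - c)) \<le> (1 + S) * C"
    and "norm (exp (- \<alpha> * h x) *\<^sub>R (x - c) - exp (- \<alpha> * h y) *\<^sub>R (y - c)) \<le>
      (1 + 2 * (1 + Lf) * (1 + S) * C) * \<alpha> * norm (x - y)"
proof -
  have C0: "C \<ge> 0" using C[of 0] by (meson exp_ge_zero mult_nonneg_nonneg order_trans zero_le_power2)
  have w1: "exp (- \<alpha> * h x) \<le> exp (- h x)" for x
    using nn[of x] \<alpha> mult_right_mono[of 1 \<alpha> "h x"] by simp
  have xc: "norm (x - c) \<le> (1 + S) * (1 + norm x)" for x
  proof -
    have "norm (x - c) \<le> norm x + S" using norm_triangle_ineq4[of x c] c by linarith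
    also have "\<dots> \<le> (1 + S) * (1 + norm x)" using S by (simp add: algebra_simps)
    finally show ?thesis .
  qed
  have lin: "exp (- \<alpha> * h x) * (1 + norm x) * (1 + norm x) \<le> C" for x
  proof -
    have "exp (- \<alpha> * h x) * (1 + norm x)\<^sup>2 \<le> exp (- h x) * (1 + norm x)\<^sup>2"
      using w1 by (intro mult_right_mono) auto
    then show ?thesis using C[of x] by (simp add: power2_eq_square mult.assoc)
  qed
  have bd: "norm (exp (- \<alpha> * h x) *\<^sub>R (x - c)) \<le> (1 + S) * C" for x
  proof -
    have "norm (exp (- \<alpha> * h x) *\<^sub>R (x - c)) \<le> exp (- \<alpha> * h x) * ((1 + S) * (1 + norm x))"
      using xc[of x] by (simp add: mult_left_mono)
    also have "\<dots> \<le> (1 + S) * (exp (- \<alpha> * h x) * (1 + norm x) * (1 + norm x))"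
    proof -
      have "exp (- \<alpha> * h x) * (1 + norm x) * 1 \<le> exp (- \<alpha> * h x) * (1 + norm x) * (1 + norm x)"
        by (intro mult_left_mono) auto
      from mult_left_mono[OF this, of "1 + S"] S show ?thesis by (simp add: mult_ac)
    qed
    also have "\<dots> \<le> (1 + S) * C" using lin[of x] S by (intro mult_left_mono) auto
    finally show ?thesis .
  qed
  then show "norm (exp (- \<alpha> * h x) *\<^sub>R (x - c)) \<le> (1 + S) * C" .
  \<comment> \<open>The larger of the two weights, the one at \<open>y\<close>, is factored out, so
    the decay and the growth are evaluated at the same point; since the points are at distance at
    most 1, the norm of \<open>x\<close> is bounded by that of \<open>y\<close> plus 1.\<close>
  have near: "norm (exp (- \<alpha> * h x) *\<^sub>R (x - c) - exp (- \<alpha> * h y) *\<^sub>R (y - c)) \<le>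
      (1 + 2 * (1 + Lf) * (1 + S) * C) * \<alpha> * norm (x - y)"
    if d: "norm (x - y) \<le> 1" and hyx: "h y \<le> h x" for x y
  proof -
    have nx: "norm x \<le> norm y + 1"
      using norm_triangle_sub[of x y] d by linarith
    have "norm (exp (- \<alpha> * h x) *\<^sub>R (x - c) - exp (- \<alpha> * h y) *\<^sub>R (y - c)) =
       norm (exp (- \<alpha> * h x) *\<^sub>R (x - y) + (exp (- \<alpha> * h x) - exp (- \<alpha> * h y)) *\<^sub>R (y - c))"
      by (simp add: algebra_simps)
    also have "\<dots> \<le> exp (- \<alpha> * h x) * norm (x - y) + \<bar>exp (- \<alpha> * h x) - exp (- \<alpha> * h y)\<bar> * norm (y - c)"
      by (rule order_trans[OF norm_triangle_ineq]) simp
    also have "\<dots> \<le> \<alpha> * norm (x - y) + (exp (- \<alpha> * h y) * (\<alpha> * (Lf * (2 * (1 + norm y)) * norm (x - y)))) * ((1 + S) * (1 + norm y))"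
    proof (intro add_mono mult_mono xc)
      show "exp (- \<alpha> * h x) \<le> \<alpha>"
        using \<alpha> nn[of x] by (intro order_trans[OF _ \<alpha>]) simp
      have "\<alpha> * h y \<le> \<alpha> * h x" using hyx \<alpha> by (intro mult_left_mono) auto
      then have "\<bar>exp (- \<alpha> * h x) - exp (- \<alpha> * h y)\<bar> = exp (- \<alpha> * h y) * (1 - exp (- (\<alpha> * (h x - h y))))"
        by (simp add: exp_add[symmetric] algebra_simps)
      also have "\<dots> \<le> exp (- \<alpha> * h y) * (\<alpha> * (h x - h y))"
        using exp_ge_add_one_self[of "- (\<alpha> * (h x - h y))"] by (intro mult_left_mono) auto
      also have "\<dots> \<le> exp (- \<alpha> * h y) * (\<alpha> * (Lf * (2 * (1 + norm y)) * norm (x - y)))"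
      proof (intro mult_left_mono)
        have "h x - h y \<le> Lf * (1 + norm x + norm y) * norm (x - y)" using Lf(2)[of x y] by linarith
        also have "\<dots> \<le> Lf * (2 * (1 + norm y)) * norm (x - y)"
          using nx Lf by (intro mult_right_mono mult_left_mono) auto
        finally show "h x - h y \<le> Lf * (2 * (1 + norm y)) * norm (x - y)" .
      qed (use \<alpha> in auto)
      finally show "\<bar>exp (- \<alpha> * h x) - exp (- \<alpha> * h y)\<bar> \<le> exp (- \<alpha> * h y) * (\<alpha> * (Lf * (2 * (1 + norm y)) * norm (x - y)))" .
    qed (use \<alpha> Lf in auto)
    also have "\<dots> = \<alpha> * norm (x - y) + 2 * Lf * (1 + S) * \<alpha> * norm (x - y) * (exp (- \<alpha> * h y) * (1 + norm y) * (1 + norm y))"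
      by (simp add: algebra_simps)
    also have "\<dots> \<le> \<alpha> * norm (x - y) + 2 * Lf * (1 + S) * \<alpha> * norm (x - y) * C"
      using \<alpha> Lf S lin[of y] by (intro add_left_mono mult_left_mono) auto
    \<comment> \<open>The additional term is there to reach the constant that also covers points far
      apart.\<close>
    also have "\<dots> \<le> \<alpha> * norm (x - y) + 2 * Lf * (1 + S) * \<alpha> * norm (x - y) * C + 2 * (1 + S) * C * \<alpha> * norm (x - y)"
      using \<alpha> S C0 by simp
    also have "\<dots> = (1 + 2 * (1 + Lf) * (1 + S) * C) * \<alpha> * norm (x - y)"
      by (simp add: algebra_simps)
    finally show ?thesis .
  qed
  show "norm (exp (- \<alpha> * h x) *\<^sub>R (x - c) - exp (- \<alpha> * h y) *\<^sub>R (y - c)) \<le>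
      (1 + 2 * (1 + Lf) * (1 + S) * C) * \<alpha> * norm (x - y)"
  proof (cases "norm (x - y) \<le> 1")
    case True
    show ?thesis
      using near[OF True] near[of y x] True by (cases "h y \<le> h x") (auto simp: norm_minus_commute)
  next
    case False
    have "norm (exp (- \<alpha> * h x) *\<^sub>R (x - c) - exp (- \<alpha> * h y) *\<^sub>R (y - c)) \<le> (1 + S) * C + (1 + S) * C"
      by (rule order_trans[OF norm_triangle_ineq4 add_mono[OF bd bd]])
    also have "\<dots> = (2 * (1 + S) * C) * 1 * 1" by simp
    also have "\<dots> \<le> (1 + 2 * (1 + Lf) * (1 + S) * C) * \<alpha> * norm (x - y)"
      using False \<alpha> S C0 Lf by (intro mult_mono) (auto simp: algebra_simps)
    finally show ?thesis .
  qed
qed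

section \<open>Stability of the consensus point, and a lower bound for its Lipschitz constant in
  \<open>W2\<close>\<close>

lemma consensus_point_shift:
  "consensus_point f \<alpha> \<rho> = consensus_point (\<lambda>x. f x - m) \<alpha> \<rho>"
proof -
  have e: "exp (- \<alpha> * f x) = exp (- \<alpha> * m) * exp (- \<alpha> * (f x - m))" for x
    by (simp add: exp_add[symmetric] algebra_simps)
  show ?thesis
    unfolding consensus_point_def e scaleR_scaleR[symmetric] integral_scaleR_right integral_mult_right_zero
    by (simp add: divideR_right[symmetric])
qed

text \<open>A strictly positive integrand cannot vanish almost everywhere, so the quotient in
  \<open>consensus_point\<close> never falls back on division by 0.\<close>

lemma gibbs_normaliser_pos:
  fixes h :: "'a::euclidean_space \<Rightarrow> real"
  assumes "prob_space \<rho>" and [measurable_cong]: "sets \<rho> = sets borel"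
    and [measurable]: "h \<in> borel_measurable borel" and "\<And>x. h x \<ge> 0" "\<alpha> \<ge> 0"
  shows "integrable \<rho> (\<lambda>x. exp (- \<alpha> * h x))" "(\<integral>x. exp (- \<alpha> * h x) \<partial>\<rho>) > 0"
proof -
  interpret prob_space \<rho> by fact
  show i: "integrable \<rho> (\<lambda>x. exp (- \<alpha> * h x))"
  proof (rule integrable_const_bound[where B=1])
    show "AE x in \<rho>. norm (exp (- \<alpha> * h x)) \<le> 1"
      using assms(4,5) by (intro AE_I2) (simp add: mult_nonneg_nonneg)
  qed measurable
  have "(\<integral>x. exp (- \<alpha> * h x) \<partial>\<rho>) \<noteq> 0"
    using integral_nonneg_eq_0_iff_AE[OF i] by (simp add: AE_False)
  moreover have "(\<integral>x. exp (- \<alpha> * h x) \<partial>\<rho>) \<ge> 0" by simp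
  ultimately show "(\<integral>x. exp (- \<alpha> * h x) \<partial>\<rho>) > 0" by linarith
qed

text \<open>A Laplace-type bound: near the minimiser \<open>h\<close> stays below \<open>e\<close>,
  and every Gaussian of variance \<open>v\<close> with mean in the ball of radius \<open>S\<close>
  gives that neighbourhood at least the mass \<open>p\<close>, uniformly in \<alpha>.\<close>

lemma gibbs_normaliser_normal_lower:
  fixes h :: "'a::euclidean_space \<Rightarrow> real"
  assumes cont: "isCont h xs" and h0: "h xs = 0" and [measurable]: "h \<in> borel_measurable borel"
    and nn: "\<And>x. h x \<ge> 0" and v: "v > 0" and e: "e > 0"
  obtains p where "p > 0"
    "\<And>\<alpha> m. \<alpha> \<ge> 0 \<Longrightarrow> norm m \<le> S \<Longrightarrow> (\<integral>x. exp (- \<alpha> * h x) \<partial>isotropic_normal m v) \<ge> p * exp (- \<alpha> * e)"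
proof -
  obtain \<eta> where \<eta>: "\<eta> > 0" "\<And>x. dist x xs < \<eta> \<Longrightarrow> dist (h x) (h xs) < e"
    using cont e unfolding continuous_at_eps_delta by (auto simp: dist_norm)
  have he: "h x \<le> e" if "x \<in> ball xs \<eta>" for x
    using \<eta>(2)[of x] that h0 nn[of x] by (auto simp: dist_commute dist_real_def)
  \<comment> \<open>A lower bound for the density on the ball, valid for all admissible means: there
    \<open>norm (x - m)\<close> is at most \<open>norm xs + \<eta> + S\<close>.\<close>
  define k where "k = exp (- (norm xs + \<eta> + S)\<^sup>2 / (2 * v)) / sqrt (2 * pi * v) ^ DIM('a)"
  have k: "k > 0" using v by (simp add: k_def)
  define p where "p = k * measure lborel (ball xs \<eta>)"
  have p: "p > 0" using k content_ball_pos[OF \<eta>(1), of xs] by (simp add: p_def)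
  show ?thesis
  proof (rule that[OF p])
    fix \<alpha> :: real and m :: 'a assume \<alpha>: "\<alpha> \<ge> 0" and m: "norm m \<le> S"
    interpret N: prob_space "isotropic_normal m v" by (rule prob_space_isotropic_normal[OF v])
    have "ennreal p = (\<integral>\<^sup>+x. ennreal k * indicator (ball xs \<eta>) x \<partial>lborel)"
      using k emeasure_lborel_ball_finite[of xs \<eta>]
      by (subst nn_integral_cmult_indicator) (simp_all add: p_def ennreal_mult emeasure_eq_ennreal_measure)
    also have "\<dots> \<le> (\<integral>\<^sup>+x. ennreal (iso_density m v x) * indicator (ball xs \<eta>) x \<partial>lborel)"
    proof (intro nn_integral_mono)
      fix x
      have "k \<le> iso_density m v x" if x: "x \<in> ball xs \<eta>"
      proof -
        have "norm (x - m) \<le> norm x + S" using norm_triangle_ineq4[of x m] m by linarith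
        moreover have "norm x \<le> norm xs + \<eta>"
          using norm_triangle_sub[of x xs] x by (simp add: dist_norm norm_minus_commute)
        ultimately have "(norm (x - m))\<^sup>2 \<le> (norm xs + \<eta> + S)\<^sup>2" by (intro power_mono) auto
        then show ?thesis using v unfolding k_def iso_density_def
          by (intro divide_right_mono) (auto simp: divide_right_mono)
      qed
      then show "ennreal k * indicator (ball xs \<eta>) x \<le> ennreal (iso_density m v x) * indicator (ball xs \<eta>) x"
        by (auto simp: indicator_def intro: ennreal_leI)
    qed
    also have "\<dots> = emeasure (isotropic_normal m v) (ball xs \<eta>)"
      unfolding isotropic_normal_density by (subst emeasure_density) auto
    finally have pm: "p \<le> measure (isotropic_normal m v) (ball xs \<eta>)"
      by (simp add: N.emeasure_eq_measure)
    have "p * exp (- \<alpha> * e) \<le> measure (isotropic_normal m v) (ball xs \<eta>) * exp (- \<alpha> * e)"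
      using pm by (intro mult_right_mono) auto
    also have "\<dots> = (\<integral>x. exp (- \<alpha> * e) * indicator (ball xs \<eta>) x \<partial>isotropic_normal m v)" by simp
    also have "\<dots> \<le> (\<integral>x. exp (- \<alpha> * h x) \<partial>isotropic_normal m v)"
    proof (rule integral_mono)
      show "integrable (isotropic_normal m v) (\<lambda>x. exp (- \<alpha> * h x))"
        by (rule gibbs_normaliser_pos) (use nn \<alpha> N.prob_space_axioms in auto)
      show "exp (- \<alpha> * e) * indicator (ball xs \<eta>) x \<le> exp (- \<alpha> * h x)" for x
        using he[of x] \<alpha> by (auto simp: indicator_def intro: mult_left_mono)
      show "integrable (isotropic_normal m v) (\<lambda>x. exp (- \<alpha> * e) * indicator (ball xs \<eta>) x)"
        by (intro integrable_mult_right N.integrable_const_bound[where B=1]) (auto simp: indicator_def)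
    qed
    finally show "(\<integral>x. exp (- \<alpha> * h x) \<partial>isotropic_normal m v) \<ge> p * exp (- \<alpha> * e)" .
  qed
qed

text \<open>Recentring at the consensus point \<open>c\<close> of \<rho> makes the weighted integral
  under \<rho> vanish. The difference of two consensus points becomes a difference of integrals of
  one function, divided by the normaliser of \<nu> alone. As \<nu> will be a Gaussian, a
  quantitative lower bound on that normaliser is at hand.\<close>

lemma consensus_point_diff:
  fixes h :: "'a::euclidean_space \<Rightarrow> real"
  assumes \<rho>: "prob_space \<rho>" and s\<rho> [measurable_cong]: "sets \<rho> = sets borel"
    and \<nu>: "prob_space \<nu>" and s\<nu> [measurable_cong]: "sets \<nu> = sets borel"
    and hm [measurable]: "h \<in> borel_measurable borel" and nn: "\<And>x. h x \<ge> 0" and \<alpha>: "\<alpha> \<ge> 0"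
    and bd: "\<And>x. norm (exp (- \<alpha> * h x) *\<^sub>R x) \<le> b"
  defines "c \<equiv> consensus_point h \<alpha> \<rho>"
  shows "(\<integral>x. exp (- \<alpha> * h x) *\<^sub>R (x - c) \<partial>\<rho>) = 0"
    "(\<integral>x. exp (- \<alpha> * h x) *\<^sub>R (x - c) \<partial>\<nu>) = (\<integral>x. exp (- \<alpha> * h x) \<partial>\<nu>) *\<^sub>R (consensus_point h \<alpha> \<nu> - c)"
proof -
  have *: "(\<integral>x. exp (- \<alpha> * h x) *\<^sub>R (x - c) \<partial>\<nu>) = (\<integral>x. exp (- \<alpha> * h x) \<partial>\<nu>) *\<^sub>R (consensus_point h \<alpha> \<nu> - c)"
    if \<nu>: "prob_space \<nu>" and [measurable_cong]: "sets \<nu> = sets borel" for \<nu> :: "'a measure"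
  proof -
    interpret prob_space \<nu> by fact
    note Z = gibbs_normaliser_pos[OF \<nu> that(2) hm nn \<alpha>]
    have i: "integrable \<nu> (\<lambda>x. exp (- \<alpha> * h x) *\<^sub>R x)"
      using bd by (intro integrable_const_bound[where B=b]) auto
    have "(\<integral>x. exp (- \<alpha> * h x) *\<^sub>R (x - c) \<partial>\<nu>) = (\<integral>x. exp (- \<alpha> * h x) *\<^sub>R x \<partial>\<nu>) - (\<integral>x. exp (- \<alpha> * h x) \<partial>\<nu>) *\<^sub>R c"
      using i Z(1) by (simp add: scaleR_diff_right)
    also have "(\<integral>x. exp (- \<alpha> * h x) *\<^sub>R x \<partial>\<nu>) = (\<integral>x. exp (- \<alpha> * h x) \<partial>\<nu>) *\<^sub>R consensus_point h \<alpha> \<nu>"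
      using Z(2) by (simp add: consensus_point_def)
    finally show ?thesis by (simp add: scaleR_diff_right)
  qed
  show "(\<integral>x. exp (- \<alpha> * h x) *\<^sub>R (x - c) \<partial>\<rho>) = 0"
    using *[OF \<rho> s\<rho>] by (simp add: c_def)
  show "(\<integral>x. exp (- \<alpha> * h x) *\<^sub>R (x - c) \<partial>\<nu>) = (\<integral>x. exp (- \<alpha> * h x) \<partial>\<nu>) *\<^sub>R (consensus_point h \<alpha> \<nu> - c)"
    by (rule *[OF \<nu> s\<nu>])
qed

text \<open>The recentred integrand has Lipschitz constant \<open>l * \<alpha>\<close>, and the
  Gaussian normaliser is at least \<open>p * exp (- \<alpha> * e)\<close>. The constant
  \<open>G = l / p\<close> is uniform in \<alpha>, the measure, the mean and the coupling, which
  lets \<alpha> tend to infinity later.\<close>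

lemma consensus_point_normal_lipschitz:
  fixes h :: "'a::euclidean_space \<Rightarrow> real"
  assumes hc: "continuous_on UNIV h" and h0: "h xs = 0" and nn: "\<And>x. h x \<ge> 0"
    and C: "\<And>x. exp (- h x) * (1 + norm x)\<^sup>2 \<le> C"
    and Lf: "Lf \<ge> 0" "\<And>x y. \<bar>h x - h y\<bar> \<le> Lf * (1 + norm x + norm y) * norm (x - y)"
    and S: "S \<ge> 0" and v: "v > 0" and e: "e > 0"
  obtains G where "G \<ge> 0"
    "\<And>\<alpha> \<rho> m \<pi> K. \<alpha> \<ge> 1 \<Longrightarrow> prob_space \<rho> \<Longrightarrow> sets \<rho> = sets borel \<Longrightarrow> norm (consensus_point h \<alpha> \<rho>) \<le> S \<Longrightarrow>
      norm m \<le> S \<Longrightarrow> \<pi> \<in> couplings \<rho> (isotropic_normal m v) \<Longrightarrow> K > 0 \<Longrightarrow> transport_cost \<pi> \<le> ennreal (K\<^sup>2) \<Longrightarrow>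
      norm (consensus_point h \<alpha> \<rho> - consensus_point h \<alpha> (isotropic_normal m v)) \<le> G * \<alpha> * exp (\<alpha> * e) * K"
proof -
  have hm [measurable]: "h \<in> borel_measurable borel"
    by (rule borel_measurable_continuous_onI[OF hc])
  have ic: "isCont h xs" using hc by (simp add: continuous_on_eq_continuous_at)
  obtain p where p: "p > 0"
    and Z: "\<And>\<alpha> m. \<alpha> \<ge> 0 \<Longrightarrow> norm m \<le> S \<Longrightarrow> (\<integral>x. exp (- \<alpha> * h x) \<partial>isotropic_normal m v) \<ge> p * exp (- \<alpha> * e)"
    using gibbs_normaliser_normal_lower[OF ic h0 hm nn v e, of S] by metis
  have C0: "C \<ge> 0" using C[of 0] by (meson exp_ge_zero mult_nonneg_nonneg order_trans zero_le_power2)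
  define l where "l = 1 + 2 * (1 + Lf) * (1 + S) * C"
  have l: "l \<ge> 0" using Lf S C0 by (simp add: l_def)
  show ?thesis
  proof (rule that[of "l / p"])
    show "l / p \<ge> 0" using l p by simp
    fix \<alpha> K :: real and \<rho> \<pi> and m :: 'a
    assume \<alpha>: "\<alpha> \<ge> 1" and \<rho>: "prob_space \<rho>" "sets \<rho> = sets borel"
      and c: "norm (consensus_point h \<alpha> \<rho>) \<le> S" and m: "norm m \<le> S"
      and \<pi>: "\<pi> \<in> couplings \<rho> (isotropic_normal m v)" and K: "K > 0"
      and cost: "transport_cost \<pi> \<le> ennreal (K\<^sup>2)"
    let ?N = "isotropic_normal m v" and ?c = "consensus_point h \<alpha> \<rho>"
    let ?Z = "\<integral>x. exp (- \<alpha> * h x) \<partial>?N"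
    have N: "prob_space ?N" by (rule prob_space_isotropic_normal[OF v])
    have \<alpha>0: "\<alpha> \<ge> 0" using \<alpha> by simp
    have b0: "norm (exp (- \<alpha> * h x) *\<^sub>R x) \<le> (1 + S) * C" for x
      using gibbs_lipschitz(1)[OF nn C Lf S \<alpha>, of 0 x] S by simp
    note d = consensus_point_diff[OF \<rho> N sets_isotropic_normal hm nn \<alpha>0 b0]
    have "norm ((\<integral>x. exp (- \<alpha> * h x) *\<^sub>R (x - ?c) \<partial>\<rho>) - (\<integral>x. exp (- \<alpha> * h x) *\<^sub>R (x - ?c) \<partial>?N)) \<le> (l * \<alpha>) * K"
      by (rule coupling_lipschitz[OF \<pi> cost K, where b="(1 + S) * C"])
        (use gibbs_lipschitz[OF nn C Lf S \<alpha> c] l \<alpha> in \<open>auto simp: l_def\<close>)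
    then have le: "?Z * norm (?c - consensus_point h \<alpha> ?N) \<le> l * \<alpha> * K"
      using gibbs_normaliser_pos(2)[OF N sets_isotropic_normal hm nn \<alpha>0]
      unfolding d by (simp add: norm_minus_commute)
    have "p * exp (- \<alpha> * e) * norm (?c - consensus_point h \<alpha> ?N) \<le> l * \<alpha> * K"
      using Z[OF \<alpha>0 m] by (intro order_trans[OF _ le] mult_right_mono) auto
    then show "norm (?c - consensus_point h \<alpha> ?N) \<le> l / p * \<alpha> * exp (\<alpha> * e) * K"
      using p by (simp add: exp_minus field_simps)
  qed
qed

text \<open>Compare the Dirac measure at \<open>a\<close> with the measure that has mass
  \<open>p = exp (- \<alpha> * \<Delta>)\<close> at \<open>xs\<close> and the rest at
  \<open>a\<close>. The Gibbs factor at \<open>xs\<close> exceeds that at \<open>a\<close> by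
  \<open>1 / p\<close>, so the tiny mass shifts the consensus point at least halfway to
  \<open>xs\<close>, while the transport distance is at most
  \<open>sqrt p * norm (xs - a)\<close>.\<close>

lemma wasserstein_lipschitz_constant_lower:
  fixes f :: "'a::euclidean_space \<Rightarrow> real"
  assumes fc: "continuous_on UNIV f" and min: "\<And>x. f xs \<le> f x" and uniq: "\<And>x. f x = f xs \<Longrightarrow> x = xs" and S: "S > 0"
  obtains e where "e > 0"
    "\<forall>\<^sub>F \<alpha> in at_top. \<forall>l. (\<forall>\<mu>\<in>P4. \<forall>\<nu>\<in>P4. (\<integral>x. norm x ^ 4 \<partial>\<mu>) \<le> S \<and> (\<integral>x. norm x ^ 4 \<partial>\<nu>) \<le> S \<longrightarrow>
       norm (consensus_point f \<alpha> \<mu> - consensus_point f \<alpha> \<nu>) \<le> l * W2 \<mu> \<nu>) \<longrightarrow> l \<ge> 0 \<longrightarrow> exp (\<alpha> * e) / 2 \<le> l"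
proof -
  have fm [measurable]: "f \<in> borel_measurable borel" by (rule borel_measurable_continuous_onI[OF fc])
  \<comment> \<open>Of the two points 0 and \<open>s *\<^sub>R u\<close> at least one is not
    \<open>xs\<close>. The strict bound leaves room for the fourth moment contributed by the small
    mass at \<open>xs\<close>.\<close>
  obtain a where a: "a \<noteq> xs" "norm a ^ 4 < S"
  proof -
    obtain u :: 'a where u: "norm u = 1" using nonempty_Basis norm_Basis by blast
    define s where "s = min 1 (S / 2)"
    have s: "s > 0" "s \<le> 1" "s < S" using S by (auto simp: s_def)
    have le: "norm (k *\<^sub>R u) ^ 4 < S" if "0 \<le> k" "k \<le> s" for k
    proof -
      have "norm (k *\<^sub>R u) ^ 4 \<le> (k::real) ^ 1"
        using that s u by (simp add: power_decreasing[of 1 4 k, simplified])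
      then show ?thesis using that s by simp
    qed
    have "s *\<^sub>R u \<noteq> (0::real) *\<^sub>R u" using s u by auto
    then show ?thesis using that[of 0] that[of "s *\<^sub>R u"] le[of s] S s by (cases "s *\<^sub>R u = xs") auto
  qed
  define \<Delta> where "\<Delta> = f a - f xs"
  have \<Delta>: "\<Delta> > 0" using min[of a] uniq[of a] a by (auto simp: \<Delta>_def less_le)
  have "((\<lambda>\<alpha>. exp (- \<alpha> * \<Delta>)) \<longlongrightarrow> 0) at_top"
  proof (rule filterlim_compose[OF exp_at_bot])
    have "LIM \<alpha> at_top. \<Delta> * \<alpha> :> at_top"
      by (rule filterlim_tendsto_pos_mult_at_top[OF tendsto_const \<Delta> filterlim_ident])
    then show "LIM \<alpha> at_top. - \<alpha> * \<Delta> :> at_bot"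
      by (simp add: filterlim_uminus_at_bot mult.commute)
  qed
  then have "((\<lambda>\<alpha>. exp (- \<alpha> * \<Delta>) * norm xs ^ 4 + norm a ^ 4) \<longlongrightarrow> 0 * norm xs ^ 4 + norm a ^ 4) at_top"
    by (intro tendsto_intros)
  then have "\<forall>\<^sub>F \<alpha> in at_top. exp (- \<alpha> * \<Delta>) * norm xs ^ 4 + norm a ^ 4 < S"
    using a by (intro order_tendstoD(2)) auto
  then have ev: "\<forall>\<^sub>F \<alpha> in at_top. exp (- \<alpha> * \<Delta>) * norm xs ^ 4 + norm a ^ 4 < S \<and> \<alpha> > 0"
    using eventually_gt_at_top[of 0] by eventually_elim simp
  show ?thesis
  proof (rule that[of "\<Delta> / 2"])
    show "\<Delta> / 2 > 0" using \<Delta> by simp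
    show "\<forall>\<^sub>F \<alpha> in at_top. \<forall>l. (\<forall>\<mu>\<in>P4. \<forall>\<nu>\<in>P4. (\<integral>x. norm x ^ 4 \<partial>\<mu>) \<le> S \<and> (\<integral>x. norm x ^ 4 \<partial>\<nu>) \<le> S \<longrightarrow>
       norm (consensus_point f \<alpha> \<mu> - consensus_point f \<alpha> \<nu>) \<le> l * W2 \<mu> \<nu>) \<longrightarrow> l \<ge> 0 \<longrightarrow> exp (\<alpha> * (\<Delta> / 2)) / 2 \<le> l"
      using ev
    proof (eventually_elim, intro allI impI)
      fix \<alpha> l :: real
      assume \<alpha>: "exp (- \<alpha> * \<Delta>) * norm xs ^ 4 + norm a ^ 4 < S \<and> \<alpha> > 0" and l0: "l \<ge> 0"
        and l: "\<forall>\<mu>\<in>P4. \<forall>\<nu>\<in>P4. (\<integral>x. norm x ^ 4 \<partial>\<mu>) \<le> S \<and> (\<integral>x. norm x ^ 4 \<partial>\<nu>) \<le> S \<longrightarrow>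
          norm (consensus_point f \<alpha> \<mu> - consensus_point f \<alpha> \<nu>) \<le> l * W2 \<mu> \<nu>"
      \<comment> \<open>With this mass the Gibbs-weighted contributions of \<open>xs\<close> and
        \<open>a\<close> become \<open>p * E\<close> and \<open>p * E * (1 - p)\<close>: they are of
        the same order, and \<open>p * E\<close> cancels in the quotient.\<close>
      define p where "p = exp (- \<alpha> * \<Delta>)"
      have p: "0 < p" "p < 1" using \<alpha> \<Delta> by (auto simp: p_def)
      define y where "y = (\<lambda>b. if b then xs else a)"
      let ?b = "measure_pmf (bernoulli_pmf p)"
      define \<mu> where "\<mu> = return borel a"
      define \<nu> where "\<nu> = distr ?b borel y"
      define \<pi> where "\<pi> = distr ?b borel (\<lambda>b. (a, y b))"
      have int: "(\<integral>b. g b \<partial>?b) = p *\<^sub>R g True + (1 - p) *\<^sub>R g False" for g :: "bool \<Rightarrow> 'b::{banach, second_countable_topology}"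
        using p by (subst integral_measure_pmf[of UNIV]) (auto simp: UNIV_bool)
      have i\<nu>: "(\<integral>x. g x \<partial>\<nu>) = p *\<^sub>R g xs + (1 - p) *\<^sub>R g a" if [measurable]: "g \<in> borel_measurable borel"
        for g :: "'a \<Rightarrow> 'b::{banach, second_countable_topology}"
        unfolding \<nu>_def by (subst integral_distr) (simp_all add: int y_def)
      have i\<mu>: "(\<integral>x. g x \<partial>\<mu>) = g a" if [measurable]: "g \<in> borel_measurable borel"
        for g :: "'a \<Rightarrow> 'b::{banach, second_countable_topology}"
        unfolding \<mu>_def by (rule integral_return) simp_all
      have P\<mu>: "prob_space \<mu>" unfolding \<mu>_def by (rule prob_space_return) simp
      have P\<nu>: "prob_space \<nu>" unfolding \<nu>_def by (rule measure_pmf.prob_space_distr) simp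
      have P\<pi>: "prob_space \<pi>" unfolding \<pi>_def by (rule measure_pmf.prob_space_distr) simp
      have \<mu>4: "\<mu> \<in> P4"
        using P\<mu> by (auto simp: P4_def \<mu>_def nn_integral_return intro!: integrableI_bounded)
      have "integrable ?b (\<lambda>b. norm (y b) ^ 4)"
        by (rule integrable_measure_pmf_finite) simp
      then have \<nu>4: "\<nu> \<in> P4"
        using P\<nu> by (simp add: P4_def \<nu>_def integrable_distr_eq)
      have [measurable]: "fst \<in> borel_measurable (borel :: ('a \<times> 'a) measure)" "snd \<in> borel_measurable (borel :: ('a \<times> 'a) measure)"
        by (intro borel_measurable_continuous_onI continuous_intros)+
      have "distr \<pi> borel fst = distr ?b borel (\<lambda>b. a)"
        unfolding \<pi>_def by (subst distr_distr) (auto simp: comp_def)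
      also have "\<dots> = \<mu>" unfolding \<mu>_def by (rule measure_pmf.distr_const) simp
      finally have "distr \<pi> borel fst = \<mu>" .
      moreover have "distr \<pi> borel snd = \<nu>"
        unfolding \<pi>_def \<nu>_def by (subst distr_distr) (auto simp: comp_def)
      ultimately have \<pi>: "\<pi> \<in> couplings \<mu> \<nu>" using P\<pi> by (simp add: couplings_def \<pi>_def)
      have "transport_cost \<pi> = (\<integral>\<^sup>+b. ennreal ((dist a (y b))\<^sup>2) \<partial>?b)"
        unfolding \<pi>_def by (subst nn_integral_distr) auto
      also have "\<dots> = ennreal (p * (norm (xs - a))\<^sup>2)"
        using p by (simp add: y_def dist_norm norm_minus_commute ennreal_mult mult.commute)
      finally have W: "W2 \<mu> \<nu> \<le> sqrt p * norm (xs - a)"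
        using p by (intro W2_le[OF \<pi>]) (auto simp: power_mult_distrib)
      define E where "E = exp (- \<alpha> * f xs)"
      have E: "E > 0" by (simp add: E_def)
      have q: "exp (- (\<alpha> * f a)) = p * E" "exp (- (\<alpha> * f xs)) = E"
        by (simp_all add: E_def p_def \<Delta>_def exp_add[symmetric] algebra_simps)
      have c\<mu>: "consensus_point f \<alpha> \<mu> = a"
        by (simp add: consensus_point_def i\<mu>)
      have "(\<integral>x. exp (- \<alpha> * f x) *\<^sub>R x \<partial>\<nu>) = (p * E) *\<^sub>R (xs + (1 - p) *\<^sub>R a)"
        by (simp add: i\<nu> q algebra_simps)
      moreover have "(\<integral>x. exp (- \<alpha> * f x) \<partial>\<nu>) = (p * E) * (2 - p)"
        by (simp add: i\<nu> q algebra_simps)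
      ultimately have "consensus_point f \<alpha> \<nu> = (p * E) *\<^sub>R (xs + (1 - p) *\<^sub>R a) /\<^sub>R ((p * E) * (2 - p))"
        unfolding consensus_point_def by simp
      also have "\<dots> = (1 / (2 - p)) *\<^sub>R (xs + (1 - p) *\<^sub>R a)"
      proof -
        have "(k *\<^sub>R w) /\<^sub>R (k * j) = (1 / j) *\<^sub>R w" if "k \<noteq> 0" for k j :: real and w :: 'a
          using that by (simp add: field_simps)
        from this[of "p * E"] show ?thesis using E p by auto
      qed
      finally have c\<nu>: "consensus_point f \<alpha> \<nu> = (1 / (2 - p)) *\<^sub>R (xs + (1 - p) *\<^sub>R a)" .
      have "a = (1 / (2 - p)) *\<^sub>R ((2 - p) *\<^sub>R a)" using p by simp
      then have "consensus_point f \<alpha> \<mu> - consensus_point f \<alpha> \<nu> = (1 / (2 - p)) *\<^sub>R ((2 - p) *\<^sub>R a) - (1 / (2 - p)) *\<^sub>R (xs + (1 - p) *\<^sub>R a)"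
        unfolding c\<mu> c\<nu> by simp
      also have "\<dots> = (1 / (2 - p)) *\<^sub>R (a - xs)"
        unfolding scaleR_diff_right[symmetric] by (simp add: algebra_simps scaleR_2)
      finally have "norm (consensus_point f \<alpha> \<mu> - consensus_point f \<alpha> \<nu>) = (1 / (2 - p)) * norm (xs - a)"
        using p by (simp add: norm_minus_commute)
      moreover have "(1 / 2) * norm (xs - a) \<le> (1 / (2 - p)) * norm (xs - a)"
        using p by (intro mult_right_mono) (auto simp: field_simps)
      moreover have "norm (consensus_point f \<alpha> \<mu> - consensus_point f \<alpha> \<nu>) \<le> l * W2 \<mu> \<nu>"
      proof -
        have "(\<integral>x. norm x ^ 4 \<partial>\<nu>) = p * norm xs ^ 4 + (1 - p) * norm a ^ 4" by (simp add: i\<nu>)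
        also have "\<dots> \<le> p * norm xs ^ 4 + 1 * norm a ^ 4"
          using p by (intro add_left_mono mult_right_mono) auto
        also have "\<dots> \<le> S" using \<alpha> by (simp add: p_def)
        finally show ?thesis using l \<mu>4 \<nu>4 a by (auto simp: i\<mu>)
      qed
      moreover have "l * W2 \<mu> \<nu> \<le> l * (sqrt p * norm (xs - a))"
        using W l0 by (rule mult_left_mono)
      ultimately have "(1 / 2) * norm (xs - a) \<le> l * (sqrt p * norm (xs - a))" by linarith
      then have "(1 / 2) * norm (xs - a) \<le> (l * sqrt p) * norm (xs - a)" by (simp only: mult.assoc)
      then have "1 / 2 \<le> l * sqrt p" using a(1) by (auto simp: mult_le_cancel_right)
      moreover have "sqrt p = exp (- (\<alpha> * (\<Delta> / 2)))"
        by (rule real_sqrt_unique) (simp_all add: p_def exp_double[symmetric])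
      ultimately show "exp (\<alpha> * (\<Delta> / 2)) / 2 \<le> l"
        by (simp add: exp_minus field_simps)
    qed
  qed
qed

section \<open>The law of the CBO dynamics\<close>

lemma at_within_atLeast_0:
  fixes t :: real
  assumes "t \<ge> 0"
  shows "at t within {0..t + 1} = at t within {0..}"
  by (rule at_within_nhd[where S="{..<t + 1}"]) auto

text \<open>Variation of constants. For \<open>a\<close> the path of the consensus point,
  \<open>c\<close> is the deterministic path whose subtraction leaves the homogeneous linear
  dynamics.\<close>

lemma linear_ode_solution:
  fixes a :: "real \<Rightarrow> 'a::euclidean_space"
  assumes a: "continuous_on {0..} a"
  obtains c where "c 0 = 0"
    "\<And>t. t \<ge> 0 \<Longrightarrow> (c has_vector_derivative lam *\<^sub>R (a t - c t)) (at t within {0..})"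
proof -
  define J where "J t = integral {0..t} (\<lambda>s. (lam * exp (lam * s)) *\<^sub>R a s)" for t
  define c where "c t = exp (- lam * t) *\<^sub>R J t" for t
  have "(c has_vector_derivative lam *\<^sub>R (a t - c t)) (at t within {0..})" if t: "t \<ge> 0" for t
  proof -
    have "continuous_on {0..t + 1} (\<lambda>s. (lam * exp (lam * s)) *\<^sub>R a s)"
      by (intro continuous_intros continuous_on_subset[OF a]) auto
    then have "(J has_vector_derivative (lam * exp (lam * t)) *\<^sub>R a t) (at t within {0..t + 1})"
      unfolding J_def[abs_def] by (rule integral_has_vector_derivative) (use t in auto)
    then have J: "(J has_vector_derivative (lam * exp (lam * t)) *\<^sub>R a t) (at t within {0..})"
      by (simp only: at_within_atLeast_0[OF t])
    have e: "((\<lambda>t. exp (- lam * t)) has_real_derivative - lam * exp (- lam * t)) (at t within {0..})"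
      by (auto intro!: derivative_eq_intros)
    have "(c has_vector_derivative exp (- lam * t) *\<^sub>R ((lam * exp (lam * t)) *\<^sub>R a t) + (- lam * exp (- lam * t)) *\<^sub>R J t) (at t within {0..})"
      unfolding c_def[abs_def] by (rule has_vector_derivative_scaleR[OF e J])
    also have "exp (- lam * t) *\<^sub>R ((lam * exp (lam * t)) *\<^sub>R a t) + (- lam * exp (- lam * t)) *\<^sub>R J t = lam *\<^sub>R (a t - c t)"
      by (simp add: c_def exp_minus scaleR_diff_right)
    finally show ?thesis .
  qed
  moreover have "c 0 = 0" by (simp add: c_def J_def)
  ultimately show ?thesis using that by blast
qed

text \<open>Both integrands of the quotient are bounded and continuous, so almost sure continuity of
  the paths passes to the integrals by dominated convergence. This continuity makes the linear
  equation for \<open>c\<close> classically solvable.\<close>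

lemma consensus_point_continuous_in_time:
  fixes h :: "'a::euclidean_space \<Rightarrow> real" and X :: "real \<Rightarrow> 'w \<Rightarrow> 'a"
  assumes "prob_space P" and Xm: "\<And>t. t \<ge> 0 \<Longrightarrow> X t \<in> borel_measurable P"
    and cont: "AE \<omega> in P. continuous_on {0..} (\<lambda>t. X t \<omega>)"
    and \<rho>: "\<And>t. t \<ge> 0 \<Longrightarrow> distr P borel (X t) = \<rho> t"
    and hc: "continuous_on UNIV h" and nn: "\<And>x. h x \<ge> 0" and \<alpha>: "\<alpha> \<ge> 0"
    and bd: "\<And>x. norm (exp (- \<alpha> * h x) *\<^sub>R x) \<le> b"
  shows "continuous_on {0..} (\<lambda>t. consensus_point h \<alpha> (\<rho> t))"
proof (rule continuous_on_sequentiallyI)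
  fix u :: "nat \<Rightarrow> real" and t :: real
  assume u: "\<forall>n. u n \<in> {0..}" and t: "t \<in> {0..}" and lim: "u \<longlonglongrightarrow> t"
  interpret P: prob_space P by fact
  have hm [measurable]: "h \<in> borel_measurable borel" by (rule borel_measurable_continuous_onI[OF hc])
  have [measurable]: "X t \<in> borel_measurable P" "X (u n) \<in> borel_measurable P" for n
    using Xm u t by auto
  have conv: "(\<lambda>n. \<integral>x. g x \<partial>\<rho> (u n)) \<longlonglongrightarrow> (\<integral>x. g x \<partial>\<rho> t)"
    if gc: "continuous_on UNIV g" and gb: "\<And>x. norm (g x) \<le> k" for g :: "'a \<Rightarrow> 'b::euclidean_space" and k
  proof -
    have [measurable]: "g \<in> borel_measurable borel" by (rule borel_measurable_continuous_onI[OF gc])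
    have ic: "isCont g x" for x using gc by (simp add: continuous_on_eq_continuous_at)
    have e: "(\<integral>x. g x \<partial>\<rho> s) = (\<integral>\<omega>. g (X s \<omega>) \<partial>P)" if s: "s \<ge> 0" for s
      unfolding \<rho>[OF s, symmetric] by (rule integral_distr) (use Xm s in auto)
    have "(\<lambda>n. \<integral>\<omega>. g (X (u n) \<omega>) \<partial>P) \<longlonglongrightarrow> (\<integral>\<omega>. g (X t \<omega>) \<partial>P)"
    proof (rule integral_dominated_convergence[where w="\<lambda>_. k"])
      show "AE \<omega> in P. (\<lambda>n. g (X (u n) \<omega>)) \<longlonglongrightarrow> g (X t \<omega>)"
        using cont
      proof eventually_elim
        case (elim \<omega>)
        have "(\<lambda>n. X (u n) \<omega>) \<longlonglongrightarrow> X t \<omega>"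
          using elim u t lim by (intro continuous_on_tendsto_compose[OF elim lim]) auto
        then show ?case by (rule isCont_tendsto_compose[OF ic])
      qed
    qed (use gb in auto)
    then show ?thesis using u t by (simp add: e)
  qed
  have "\<rho> t = distr P borel (X t)" using \<rho> t by simp
  then have "prob_space (\<rho> t)" "sets (\<rho> t) = sets borel" by (auto intro: P.prob_space_distr)
  then have Z: "(\<integral>x. exp (- \<alpha> * h x) \<partial>\<rho> t) \<noteq> 0"
    using gibbs_normaliser_pos(2)[OF _ _ hm nn \<alpha>] by (metis less_irrefl)
  have ec: "continuous_on UNIV (\<lambda>x. exp (- \<alpha> * h x))" by (intro continuous_intros hc)
  show "(\<lambda>n. consensus_point h \<alpha> (\<rho> (u n))) \<longlonglongrightarrow> consensus_point h \<alpha> (\<rho> t)"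
    unfolding consensus_point_def
  proof (intro tendsto_scaleR tendsto_inverse Z conv)
    show "norm (exp (- \<alpha> * h x)) \<le> 1" for x using nn[of x] \<alpha> by (simp add: mult_nonneg_nonneg)
  qed (use bd in \<open>auto intro!: continuous_intros hc\<close>)
qed

text \<open>Along a given solution the consensus point is just a continuous function of time, so the
  nonlinear equation is linear with an inhomogeneity. The difference \<open>V = X - c\<close>
  satisfies the homogeneous equation and has the same initial value, as
  \<open>c 0 = 0\<close>.\<close>

lemma delta_CBO_law:
  fixes f :: "'a::euclidean_space \<Rightarrow> real" and X :: "real \<Rightarrow> 'w \<Rightarrow> 'a"
  assumes cbo: "delta_CBO f lam \<delta> \<alpha> \<rho>0 P F B X \<rho>" and lam: "lam > 0" and \<delta>: "\<delta> > 0" and \<alpha>: "\<alpha> \<ge> 0"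
    and fc: "continuous_on UNIV f" and min: "\<And>x. f xs \<le> f x"
    and bd: "\<And>x. norm (exp (- \<alpha> * (f x - f xs)) *\<^sub>R x) \<le> b"
  obtains c where "c 0 = 0"
    "\<And>t. t \<ge> 0 \<Longrightarrow> (c has_vector_derivative lam *\<^sub>R (consensus_point f \<alpha> (\<rho> t) - c t)) (at t within {0..})"
    "\<And>t. t \<ge> 0 \<Longrightarrow> \<rho> t = distr (\<rho>0 \<Otimes>\<^sub>M std_gauss) borel (\<lambda>(x, z). exp (- lam * t) *\<^sub>R x +
       (c t + sqrt (\<delta>\<^sup>2 / (2 * lam) * (1 - exp (- 2 * lam * t))) *\<^sub>R z))"
proof -
  have bm: "brownian_motion P F B"
    and ad: "\<And>t. t \<ge> 0 \<Longrightarrow> X t \<in> borel_measurable (F t)"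
    and cont: "AE \<omega> in P. continuous_on {0..} (\<lambda>t. X t \<omega>)"
    and \<rho>: "\<And>t. t \<ge> 0 \<Longrightarrow> distr P borel (X t) = \<rho> t" and \<rho>0: "\<rho> 0 = \<rho>0"
    and eq: "AE \<omega> in P. \<forall>t\<ge>0. ((\<lambda>s. - lam *\<^sub>R (X s \<omega> - consensus_point f \<alpha> (\<rho> s)))
           has_integral (X t \<omega> - X 0 \<omega> - \<delta> *\<^sub>R B t \<omega>)) {0..t}"
    using cbo by (auto simp: delta_CBO_def)
  have P: "prob_space P" using bm by (simp add: brownian_motion_def)
  have Xm: "X t \<in> borel_measurable P" if "t \<ge> 0" for t
    by (rule brownian_motion_measurable[OF bm that ad[OF that]])
  define a where "a t = consensus_point f \<alpha> (\<rho> t)" for t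
  have "continuous_on {0..} (\<lambda>t. consensus_point (\<lambda>x. f x - f xs) \<alpha> (\<rho> t))"
    using min by (intro consensus_point_continuous_in_time[OF P Xm cont \<rho> _ _ \<alpha> bd] continuous_intros fc) auto
  then have ac: "continuous_on {0..} a"
    unfolding a_def consensus_point_shift[of f \<alpha> _ "f xs", symmetric] .
  obtain c where c0: "c 0 = 0"
    and c: "\<And>t. t \<ge> 0 \<Longrightarrow> (c has_vector_derivative lam *\<^sub>R (a t - c t)) (at t within {0..})"
    using linear_ode_solution[OF ac, of lam] by blast
  have cc: "continuous_on {0..} c"
    using c has_vector_derivative_continuous by (fastforce simp: continuous_on_eq_continuous_within)
  define V where "V t \<omega> = X t \<omega> - c t" for t \<omega>
  have V0: "V 0 = X 0" by (simp add: V_def c0 fun_eq_iff)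
  have lawV: "distr P borel (V t) = distr (distr P borel (V 0) \<Otimes>\<^sub>M std_gauss) borel
     (\<lambda>(x, z). exp (- lam * t) *\<^sub>R x + sqrt (\<delta>\<^sup>2 / (2 * lam) * (1 - exp (- 2 * lam * t))) *\<^sub>R z)" if t: "t \<ge> 0" for t
  proof (rule ornstein_uhlenbeck_law[OF bm lam \<delta> _ _ _ t])
    show "V t \<in> borel_measurable (F t)" if "t \<ge> 0" for t
      unfolding V_def[abs_def] using ad[OF that] by measurable
    show "AE \<omega> in P. continuous_on {0..} (\<lambda>t. V t \<omega>)"
      using cont unfolding V_def by eventually_elim (intro continuous_intros cc)
    show "AE \<omega> in P. \<forall>t\<ge>0. ((\<lambda>s. - lam *\<^sub>R V s \<omega>) has_integral (V t \<omega> - V 0 \<omega> - \<delta> *\<^sub>R B t \<omega>)) {0..t}"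
      using eq
    proof (eventually_elim, intro allI impI)
      fix \<omega> and t :: real
      assume *: "\<forall>t\<ge>0. ((\<lambda>s. - lam *\<^sub>R (X s \<omega> - consensus_point f \<alpha> (\<rho> s)))
           has_integral (X t \<omega> - X 0 \<omega> - \<delta> *\<^sub>R B t \<omega>)) {0..t}" and t: "t \<ge> 0"
      have "((\<lambda>s. lam *\<^sub>R (a s - c s)) has_integral (c t - c 0)) {0..t}"
        using t by (intro fundamental_theorem_of_calculus has_vector_derivative_within_subset[OF c]) auto
      with * t have "((\<lambda>s. - lam *\<^sub>R (X s \<omega> - a s) - lam *\<^sub>R (a s - c s)) has_integral
          ((X t \<omega> - X 0 \<omega> - \<delta> *\<^sub>R B t \<omega>) - (c t - c 0))) {0..t}"
        unfolding a_def by (intro has_integral_diff) auto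
      moreover have "(\<lambda>s. - lam *\<^sub>R (X s \<omega> - a s) - lam *\<^sub>R (a s - c s)) = (\<lambda>s. - lam *\<^sub>R V s \<omega>)"
        by (simp add: V_def fun_eq_iff algebra_simps)
      ultimately show "((\<lambda>s. - lam *\<^sub>R V s \<omega>) has_integral (V t \<omega> - V 0 \<omega> - \<delta> *\<^sub>R B t \<omega>)) {0..t}"
        by (simp add: V_def algebra_simps)
    qed
  qed
  have law: "\<rho> t = distr (\<rho>0 \<Otimes>\<^sub>M std_gauss) borel (\<lambda>(x, z). exp (- lam * t) *\<^sub>R x +
       (c t + sqrt (\<delta>\<^sup>2 / (2 * lam) * (1 - exp (- 2 * lam * t))) *\<^sub>R z))" if t: "t \<ge> 0" for t
  proof -
    have [measurable]: "V t \<in> borel_measurable P" unfolding V_def[abs_def] using Xm[OF t] by measurable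
    have d0: "distr P borel (V 0) = \<rho>0" using \<rho>[of 0] \<rho>0 V0 by simp
    then have [measurable_cong]: "sets \<rho>0 = sets borel" by auto
    have "\<rho> t = distr P borel (\<lambda>\<omega>. c t + V t \<omega>)" using \<rho>[OF t] by (simp add: V_def)
    also have "\<dots> = distr (distr P borel (V t)) borel (\<lambda>x. c t + x)"
      by (subst distr_distr) (auto simp: comp_def)
    also have "\<dots> = distr (\<rho>0 \<Otimes>\<^sub>M std_gauss) borel (\<lambda>(x, z). exp (- lam * t) *\<^sub>R x +
       (c t + sqrt (\<delta>\<^sup>2 / (2 * lam) * (1 - exp (- 2 * lam * t))) *\<^sub>R z))"
      unfolding lawV[OF t] d0 by (subst distr_distr) (auto simp: comp_def case_prod_unfold algebra_simps)
    finally show ?thesis .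
  qed
  show ?thesis by (rule that[of c]) (use c0 c law in \<open>auto simp: a_def\<close>)
qed

text \<open>The assumption \<open>es\<close> expresses that \<open>v\<close> is the stationary
  variance: the variance lost by contracting with \<open>e\<close> is restored by the noise, and
  only the mean moves.\<close>

lemma isotropic_normal_push:
  fixes m c :: "'a::euclidean_space"
  assumes v: "v > 0" and e: "e > 0" and s: "s \<ge> 0" and es: "e\<^sup>2 * v + s\<^sup>2 = v"
  shows "distr (isotropic_normal m v \<Otimes>\<^sub>M std_gauss) borel (\<lambda>(x, z). e *\<^sub>R x + (c + s *\<^sub>R z)) =
    isotropic_normal (e *\<^sub>R m + c) v"
proof (rule measure_eqI_nn_integral)
  fix g :: "'a \<Rightarrow> ennreal"
  assume "g \<in> borel_measurable (distr (isotropic_normal m v \<Otimes>\<^sub>M std_gauss) borel (\<lambda>(x, z). e *\<^sub>R x + (c + s *\<^sub>R z)))"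
  then have [measurable]: "g \<in> borel_measurable borel" by simp
  interpret N: prob_space "std_gauss :: 'a measure" by (rule prob_space_isotropic_normal) simp
  have iso: "isotropic_normal k v = distr std_gauss borel (\<lambda>z. k + sqrt v *\<^sub>R z)" for k :: 'a
    using isotropic_normal_eq_distr[of "sqrt v" k] v by simp
  have "(\<integral>\<^sup>+x. g x \<partial>distr (isotropic_normal m v \<Otimes>\<^sub>M std_gauss) borel (\<lambda>(x, z). e *\<^sub>R x + (c + s *\<^sub>R z))) =
     (\<integral>\<^sup>+w. (\<lambda>(x, z). g (e *\<^sub>R x + (c + s *\<^sub>R z))) w \<partial>(isotropic_normal m v \<Otimes>\<^sub>M std_gauss))"
    by (subst nn_integral_distr) (auto intro!: nn_integral_cong)
  also have "\<dots> = (\<integral>\<^sup>+x. \<integral>\<^sup>+z. g (e *\<^sub>R x + (c + s *\<^sub>R z)) \<partial>std_gauss \<partial>isotropic_normal m v)"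
    by (subst N.nn_integral_fst[symmetric]) auto
  also have "\<dots> = (\<integral>\<^sup>+y. \<integral>\<^sup>+z. g ((e *\<^sub>R m + c) + (s *\<^sub>R z + (e * sqrt v) *\<^sub>R y)) \<partial>std_gauss \<partial>std_gauss)"
    unfolding iso[of m] by (subst nn_integral_distr) (auto simp: algebra_simps)
  also have "\<dots> = (\<integral>\<^sup>+z. g ((e *\<^sub>R m + c) + sqrt (s\<^sup>2 + (e * sqrt v)\<^sup>2) *\<^sub>R z) \<partial>std_gauss)"
    using v e s by (intro pair_std_gauss_lincomb[of "\<lambda>u. g (_ + u)"]) auto
  also have "s\<^sup>2 + (e * sqrt v)\<^sup>2 = v" using es v by (simp add: power_mult_distrib)
  also have "(\<integral>\<^sup>+z. g ((e *\<^sub>R m + c) + sqrt v *\<^sub>R z) \<partial>std_gauss) = (\<integral>\<^sup>+x. g x \<partial>isotropic_normal (e *\<^sub>R m + c) v)"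
    unfolding iso by (subst nn_integral_distr) auto
  finally show "(\<integral>\<^sup>+x. g x \<partial>distr (isotropic_normal m v \<Otimes>\<^sub>M std_gauss) borel (\<lambda>(x, z). e *\<^sub>R x + (c + s *\<^sub>R z))) =
     (\<integral>\<^sup>+x. g x \<partial>isotropic_normal (e *\<^sub>R m + c) v)" .
qed simp

lemma mean_noise_push:
  fixes \<rho> :: "'a::euclidean_space measure"
  assumes \<rho>: "prob_space \<rho>" "sets \<rho> = sets borel" and int: "integrable \<rho> (\<lambda>x. x)"
  shows "(\<integral>x. x \<partial>distr (\<rho> \<Otimes>\<^sub>M std_gauss) borel (\<lambda>(x, z). e *\<^sub>R x + (c + s *\<^sub>R z))) = e *\<^sub>R (\<integral>x. x \<partial>\<rho>) + c"
proof -
  have N: "prob_space (std_gauss :: 'a measure)" by (rule prob_space_isotropic_normal) simp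
  note [measurable_cong] = \<rho>(2)
  let ?M = "\<rho> \<Otimes>\<^sub>M (std_gauss :: 'a measure)"
  note cp = couplingsD[OF pair_measure_coupling[OF \<rho>(1) N \<rho>(2) sets_isotropic_normal]]
  interpret M: prob_space ?M by (rule cp)
  have f: "fst \<in> borel_measurable ?M" "snd \<in> borel_measurable ?M" by measurable
  have "integrable (distr ?M borel fst) (\<lambda>x. x)" by (simp only: cp(3) int)
  moreover have "integrable (distr ?M borel snd) (\<lambda>x. x)" by (simp only: cp(4) integrable_std_gauss_id)
  ultimately have i: "integrable ?M fst" "integrable ?M snd"
    using integrable_distr[OF f(1), of "\<lambda>x. x"] integrable_distr[OF f(2), of "\<lambda>x. x"] by blast+
  have m: "integral\<^sup>L ?M fst = (\<integral>x. x \<partial>\<rho>)" "integral\<^sup>L ?M snd = 0"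
    using integral_distr[OF f(1), of "\<lambda>x. x"] integral_distr[OF f(2), of "\<lambda>x. x"]
    unfolding cp(3,4) integral_std_gauss_id by simp_all
  have "(\<integral>x. x \<partial>distr ?M borel (\<lambda>(x, z). e *\<^sub>R x + (c + s *\<^sub>R z))) = (\<integral>w. e *\<^sub>R fst w + (c + s *\<^sub>R snd w) \<partial>?M)"
    by (subst integral_distr) (auto simp: case_prod_unfold)
  also have "\<dots> = e *\<^sub>R (\<integral>x. x \<partial>\<rho>) + c"
    using i m by (simp add: M.prob_space)
  finally show ?thesis .
qed

section \<open>Convergence to the invariant measure\<close>

lemma gronwall_norm:
  fixes n n' :: "real \<Rightarrow> 'a::euclidean_space"
  assumes der: "\<And>t. t \<ge> 0 \<Longrightarrow> (n has_vector_derivative n' t) (at t within {0..})"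
    and bd: "\<And>t. t \<ge> 0 \<Longrightarrow> norm (n' t) \<le> A + l * norm (n t)"
    and A: "A \<ge> 0" and l: "l > 0" and t: "t \<ge> 0"
  shows "norm (n t) \<le> norm (n 0) * exp (l * t) + A / l * (exp (l * t) - 1)"
proof (cases "t = 0")
  case False
  with t have t: "t > 0" by simp
  have eps: "norm (n t) \<le> sqrt ((norm (n 0))\<^sup>2 + e\<^sup>2) * exp (l * t) + A / l * (exp (l * t) - 1)" if e: "e > 0" for e
  proof -
    \<comment> \<open>The norm is not differentiable at \<open>0\<close>, hence the regularisation by \<open>e\<close>.\<close>
    define g where "g t = sqrt (n t \<bullet> n t + e\<^sup>2)" for t
    have pos: "n s \<bullet> n s + e\<^sup>2 > 0" for s using e by (simp add: add_nonneg_pos)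
    have g: "g s > 0" "norm (n s) \<le> g s" for s
    proof -
      show "g s > 0" using pos[of s] by (simp add: g_def)
      show "norm (n s) \<le> g s" unfolding g_def norm_eq_sqrt_inner by (intro real_sqrt_le_mono) simp
    qed
    \<comment> \<open>Adding \<open>A / l\<close> turns the affine inequality
      \<open>g' \<le> A + l g\<close> into a homogeneous one, and the exponential is its integrating
      factor. By the mean value theorem \<phi> does not increase from 0 to \<open>t\<close>.\<close>
    define \<phi> where "\<phi> s = (g s + A / l) * exp (- l * s)" for s
    have d: "(\<phi> has_real_derivative exp (- l * s) * ((n s \<bullet> n' s) / g s - l * g s - A)) (at s within {0..t})" if s: "s \<in> {0..t}" for s
    proof -
      have "(n has_derivative (\<lambda>h. h *\<^sub>R n' s)) (at s within {0..t})"
        using der[of s] s has_derivative_subset[of n _ s "{0..}" "{0..t}"] by (auto simp: has_vector_derivative_def)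
      then have "((\<lambda>s. n s \<bullet> n s) has_derivative (\<lambda>h. n s \<bullet> (h *\<^sub>R n' s) + (h *\<^sub>R n' s) \<bullet> n s)) (at s within {0..t})"
        by (intro has_derivative_inner)
      then have "((\<lambda>s. n s \<bullet> n s) has_real_derivative 2 * (n s \<bullet> n' s)) (at s within {0..t})"
        unfolding has_field_derivative_def by (rule has_derivative_eq_rhs) (auto simp: inner_commute fun_eq_iff)
      then have "((\<lambda>s. n s \<bullet> n s + e\<^sup>2) has_real_derivative 2 * (n s \<bullet> n' s)) (at s within {0..t})"
        by (auto intro!: derivative_eq_intros)
      from DERIV_chain2[OF DERIV_real_sqrt[OF pos] this]
      have dg: "(g has_real_derivative (n s \<bullet> n' s) / g s) (at s within {0..t})"
        by (simp add: g_def[abs_def] field_simps)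
      show ?thesis unfolding \<phi>_def[abs_def]
        by (rule derivative_eq_intros dg refl | simp)+ (use l in \<open>simp add: field_simps\<close>)
    qed
    have "\<exists>x\<in>{0<..<t}. \<phi> t - \<phi> 0 = exp (- l * x) * ((n x \<bullet> n' x) / g x - l * g x - A) * (t - 0)"
      by (rule mvt_simple[OF t]) (use d in \<open>auto simp: has_field_derivative_def\<close>)
    then obtain x where x: "0 < x" "x < t" "\<phi> t - \<phi> 0 = exp (- l * x) * ((n x \<bullet> n' x) / g x - l * g x - A) * t"
      by auto
    have "n x \<bullet> n' x \<le> norm (n x) * norm (n' x)" by (rule norm_cauchy_schwarz)
    also have "\<dots> \<le> g x * (A + l * g x)"
    proof (intro mult_mono)
      have "l * norm (n x) \<le> l * g x" using g(2)[of x] l by (intro mult_left_mono) auto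
      then show "norm (n' x) \<le> A + l * g x" using bd[of x] x by simp
    qed (use g[of x] in auto)
    finally have "(n x \<bullet> n' x) / g x - l * g x - A \<le> 0"
      using g(1)[of x] by (simp add: field_simps)
    then have "exp (- l * x) * ((n x \<bullet> n' x) / g x - l * g x - A) * t \<le> 0"
      using t by (intro mult_nonpos_nonneg mult_nonneg_nonpos) auto
    then have "\<phi> t \<le> \<phi> 0" using x(3) by simp
    then have "\<phi> t * exp (l * t) \<le> \<phi> 0 * exp (l * t)" by (intro mult_right_mono) auto
    then have "g t + A / l \<le> (g 0 + A / l) * exp (l * t)"
      by (simp add: \<phi>_def mult.assoc exp_add[symmetric])
    then have "norm (n t) \<le> g 0 * exp (l * t) + A / l * (exp (l * t) - 1)"
      using g(2)[of t] by (simp add: algebra_simps)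
    then show ?thesis by (simp add: g_def power2_norm_eq_inner)
  qed
  have "((\<lambda>e. sqrt ((norm (n 0))\<^sup>2 + e\<^sup>2) * exp (l * t) + A / l * (exp (l * t) - 1)) \<longlongrightarrow>
      sqrt ((norm (n 0))\<^sup>2 + 0\<^sup>2) * exp (l * t) + A / l * (exp (l * t) - 1)) (at_right 0)"
    by (intro tendsto_intros)
  then have "norm (n t) \<le> sqrt ((norm (n 0))\<^sup>2 + 0\<^sup>2) * exp (l * t) + A / l * (exp (l * t) - 1)"
    by (rule tendsto_lowerbound) (use eps in \<open>auto simp: eventually_at_right_less eventually_at_filter\<close>)
  then show ?thesis by simp
qed simp

section \<open>Finiteness of the moments needed for couplings and means\<close>

lemma P4_moments:
  assumes "\<rho> \<in> P4"
  shows "integrable \<rho> (\<lambda>x. x)" "(\<integral>\<^sup>+x. ennreal ((norm x)\<^sup>2) \<partial>\<rho>) < \<infinity>"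
proof -
  interpret prob_space \<rho> using assms by (simp add: P4_def)
  have [measurable_cong]: "sets \<rho> = sets borel" and i4: "integrable \<rho> (\<lambda>x. norm x ^ 4)"
    using assms by (auto simp: P4_def)
  have i: "integrable \<rho> (\<lambda>x. 1 + norm x ^ 4)" using i4 by simp
  have pw: "norm x ^ k \<le> 1 + norm x ^ 4" if "k \<le> 4" for k and x :: 'a
  proof (cases "norm x \<le> 1")
    case True
    then have "norm x ^ k \<le> 1" by (simp add: power_le_one)
    then show ?thesis by (simp add: add_increasing2)
  next
    case False
    then have "norm x ^ k \<le> norm x ^ 4" using that by (intro power_increasing) auto
    then show ?thesis by simp
  qed
  show "integrable \<rho> (\<lambda>x. x)"
    by (rule Bochner_Integration.integrable_bound[OF i]) (use pw[of 1] in auto)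
  have "integrable \<rho> (\<lambda>x. (norm x)\<^sup>2)"
    by (rule Bochner_Integration.integrable_bound[OF i]) (use pw[of 2] in auto)
  then show "(\<integral>\<^sup>+x. ennreal ((norm x)\<^sup>2) \<partial>\<rho>) < \<infinity>"
    by (simp add: integrable_iff_bounded)
qed

lemma isotropic_normal_sq_finite:
  assumes "v > 0"
  shows "(\<integral>\<^sup>+x. ennreal ((norm x)\<^sup>2) \<partial>isotropic_normal m v) < \<infinity>"
proof -
  interpret N: prob_space "std_gauss :: 'a measure" by (rule prob_space_isotropic_normal) simp
  have i: "integrable std_gauss (\<lambda>z::'a. 2 * (norm m)\<^sup>2 + 2 * v * (norm z)\<^sup>2)"
    using integrable_std_gauss_sq by auto
  have "(norm (m + sqrt v *\<^sub>R z))\<^sup>2 \<le> 2 * (norm m)\<^sup>2 + 2 * v * (norm z)\<^sup>2" for z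
  proof -
    have "(norm (m + sqrt v *\<^sub>R z))\<^sup>2 \<le> (norm m + sqrt v * norm z)\<^sup>2"
      using norm_triangle_ineq[of m "sqrt v *\<^sub>R z"] assms by (intro power_mono) auto
    moreover have "0 \<le> (norm m - sqrt v * norm z)\<^sup>2" by simp
    ultimately show ?thesis using assms by (simp add: power2_sum power2_diff power_mult_distrib)
  qed
  then have "integrable std_gauss (\<lambda>z. (norm (m + sqrt v *\<^sub>R z))\<^sup>2)"
    using assms by (intro Bochner_Integration.integrable_bound[OF i] AE_I2) auto
  then have "(\<integral>\<^sup>+z. ennreal ((norm (m + sqrt v *\<^sub>R z))\<^sup>2) \<partial>std_gauss) < \<infinity>"
    by (simp add: integrable_iff_bounded)
  then show ?thesis
    using assms isotropic_normal_eq_distr[of "sqrt v" m] by (simp add: nn_integral_distr)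
qed

text \<open>The estimate for a fixed \<alpha>. The assumption \<open>near\<close> isolates the
  stability of the consensus point and is phrased for arbitrary couplings, so that it applies to the
  synchronous ones constructed here; \<open>LX \<alpha>\<close> will take the place of
  \<open>l\<close>. The three terms of the bound are the contraction of the coupling, the decay of
  the initial error of the mean, and the feedback of the coupling error into the mean.\<close>

lemma delta_CBO_W2_bound:
  fixes f :: "'a::euclidean_space \<Rightarrow> real" and X :: "real \<Rightarrow> 'w \<Rightarrow> 'a"
  defines "mean \<equiv> \<lambda>\<rho>. \<integral>x. x \<partial>\<rho>"
  assumes cbo: "delta_CBO f lam \<delta> \<alpha> \<rho>0 P F B X \<rho>" and lam: "lam > 0" and \<delta>: "\<delta> > 0" and \<alpha>: "\<alpha> \<ge> 0"
    and fc: "continuous_on UNIV f" and min: "\<And>x. f xs \<le> f x"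
    and bd: "\<And>x. norm (exp (- \<alpha> * (f x - f xs)) *\<^sub>R x) \<le> b"
    and init: "\<rho>0 \<in> P4" and S: "\<And>t. t \<ge> 0 \<Longrightarrow> (\<integral>x. norm x \<partial>\<rho> t) \<le> S" and xs: "norm xs \<le> S"
    and v: "v = \<delta>\<^sup>2 / (2 * lam)"
    and near: "\<And>t m \<pi> K. t \<ge> 0 \<Longrightarrow> norm m \<le> S \<Longrightarrow> \<pi> \<in> couplings (\<rho> t) (isotropic_normal m v) \<Longrightarrow> K > 0 \<Longrightarrow>
       transport_cost \<pi> \<le> ennreal (K\<^sup>2) \<Longrightarrow> norm (consensus_point f \<alpha> (\<rho> t) - T_map f lam \<delta> \<alpha> m) \<le> l * K"
    and l: "l \<ge> 0" and L: "L > 0" and lip: "lipschitz_on L (cball xs (2 * S)) (T_map f lam \<delta> \<alpha>)"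
    and \<mu>: "\<mu> \<in> cball xs (2 * S)" "T_map f lam \<delta> \<alpha> \<mu> = \<mu>"
    and D: "D = W2 \<rho>0 (isotropic_normal (mean \<rho>0) v)" and t: "t \<ge> 0"
  shows "W2 (\<rho> t) (isotropic_normal \<mu> v) \<le> exp (- lam * t) * D
       + norm (mean \<rho>0 - \<mu>) * exp (- lam * (1 - L) * t)
       + l / L * D * (exp (- lam * (1 - L) * t) - exp (- lam * t))"
proof -
  have \<rho>0: "prob_space \<rho>0" "sets \<rho>0 = sets borel" using init by (auto simp: P4_def)
  have vpos: "v > 0" using v lam \<delta> by simp
  define m0 where "m0 = mean \<rho>0"
  define s where "s t = sqrt (v * (1 - exp (- 2 * lam * t)))" for t
  obtain c where c0: "c 0 = 0"
    and c: "\<And>t. t \<ge> 0 \<Longrightarrow> (c has_vector_derivative lam *\<^sub>R (consensus_point f \<alpha> (\<rho> t) - c t)) (at t within {0..})"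
    and law: "\<And>t. t \<ge> 0 \<Longrightarrow> \<rho> t = distr (\<rho>0 \<Otimes>\<^sub>M std_gauss) borel (\<lambda>(x, z). exp (- lam * t) *\<^sub>R x + (c t + s t *\<^sub>R z))"
    unfolding s_def v by (rule delta_CBO_law[OF cbo lam \<delta> \<alpha> fc min bd]) blast
  have s: "s t \<ge> 0" "(exp (- lam * t))\<^sup>2 * v + (s t)\<^sup>2 = v" if "t \<ge> 0" for t
  proof -
    have "exp (- 2 * lam * t) \<le> 1" using that lam by simp
    moreover have "(exp (- lam * t))\<^sup>2 = exp (- 2 * lam * t)" by (simp add: exp_double[symmetric] mult.assoc)
    ultimately show "s t \<ge> 0" "(exp (- lam * t))\<^sup>2 * v + (s t)\<^sup>2 = v"
      using vpos by (auto simp: s_def algebra_simps)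
  qed
  define m where "m t = exp (- lam * t) *\<^sub>R m0 + c t" for t
  have m_mean: "m t = (\<integral>x. x \<partial>\<rho> t)" if "t \<ge> 0" for t
    unfolding law[OF that] m_def m0_def mean_def
    by (rule mean_noise_push[OF \<rho>0 P4_moments(1)[OF init], symmetric])
  have m_S: "norm (m t) \<le> S" if "t \<ge> 0" for t
    unfolding m_mean[OF that] by (rule order_trans[OF integral_norm_bound S[OF that]])
  \<comment> \<open>Both \<open>xs\<close> and the mean have norm at most \<open>S\<close>; this is
    the origin of the radius \<open>2 * S\<close>.\<close>
  have ball: "x \<in> cball xs (2 * S)" if "norm x \<le> S" for x
    using norm_triangle_ineq4[of xs x] that xs by (simp add: dist_norm)
  have bound: "W2 (\<rho> t) (isotropic_normal \<mu> v) \<le> exp (- lam * t) * K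
       + norm (m0 - \<mu>) * exp (- lam * (1 - L) * t)
       + l / L * K * (exp (- lam * (1 - L) * t) - exp (- lam * t))" if K: "K > D" for K
  proof -
    have "D \<ge> 0" by (simp add: D)
    then have K0: "K > 0" using K by simp
    obtain \<pi>0 where \<pi>0: "\<pi>0 \<in> couplings \<rho>0 (isotropic_normal m0 v)" "transport_cost \<pi>0 < \<infinity>"
      using finite_cost_coupling[OF \<rho>0(1) prob_space_isotropic_normal[OF vpos] \<rho>0(2) sets_isotropic_normal
          P4_moments(2)[OF init] isotropic_normal_sq_finite[OF vpos]] .
    have KD: "K - D > 0" using K by simp
    obtain \<pi> where \<pi>: "\<pi> \<in> couplings \<rho>0 (isotropic_normal m0 v)"
      and cost: "transport_cost \<pi> \<le> ennreal ((W2 \<rho>0 (isotropic_normal m0 v) + (K - D))\<^sup>2)"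
      by (rule near_optimal_coupling[OF \<pi>0 KD])
    have cost: "transport_cost \<pi> \<le> ennreal (K\<^sup>2)" using cost by (simp add: D m0_def)
    \<comment> \<open>The free shift \<open>w\<close> of the Gaussian's mean serves twice:
      \<open>w = 0\<close> compares with the Gaussian that has the same mean as
      \<open>\<rho> t\<close>, and \<open>w = \<mu> - m t\<close> compares directly with the
      invariant measure.\<close>
    have push: "\<exists>\<pi>'\<in>couplings (\<rho> t) (isotropic_normal (m t + w) v).
        transport_cost \<pi>' \<le> ennreal ((exp (- lam * t) * K + norm w)\<^sup>2)" if t: "t \<ge> 0" for t w
    proof -
      note cp = coupling_push[OF \<pi> cost K0, of "exp (- lam * t)" "c t" "s t" "c t + w"]
      have "isotropic_normal (m t + w) v = distr (isotropic_normal m0 v \<Otimes>\<^sub>M std_gauss) borel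
          (\<lambda>(x, z). exp (- lam * t) *\<^sub>R x + ((c t + w) + s t *\<^sub>R z))"
        by (subst isotropic_normal_push[OF vpos _ s[OF t]]) (simp_all add: m_def add.assoc)
      then show ?thesis using cp law[OF t] by auto
    qed
    have err: "norm (consensus_point f \<alpha> (\<rho> t) - \<mu>) \<le> l * (exp (- lam * t) * K) + L * norm (m t - \<mu>)"
      if t: "t \<ge> 0" for t
    proof -
      obtain \<pi>' where "\<pi>' \<in> couplings (\<rho> t) (isotropic_normal (m t) v)"
        "transport_cost \<pi>' \<le> ennreal ((exp (- lam * t) * K)\<^sup>2)"
        using push[OF t, of 0] by auto
      then have "norm (consensus_point f \<alpha> (\<rho> t) - T_map f lam \<delta> \<alpha> (m t)) \<le> l * (exp (- lam * t) * K)"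
        by (intro near[OF t m_S[OF t]]) (use K0 in auto)
      moreover have "norm (T_map f lam \<delta> \<alpha> (m t) - \<mu>) \<le> L * norm (m t - \<mu>)"
        using lipschitz_onD[OF lip ball[OF m_S[OF t]] \<mu>(1)] by (simp add: \<mu>(2) dist_norm)
      ultimately show ?thesis
        using norm_triangle_ineq[of "consensus_point f \<alpha> (\<rho> t) - T_map f lam \<delta> \<alpha> (m t)" "T_map f lam \<delta> \<alpha> (m t) - \<mu>"]
        by simp
    qed
    \<comment> \<open>Multiplying by \<open>exp (lam * t)\<close> removes the decay of the mean and
      turns the coupling error, of order \<open>exp (- lam * t) * K\<close>, into a constant.
      Gronwall's inequality then applies with rate \<open>lam * L\<close> and constant term
      \<open>lam * l * K\<close>.\<close>
    define n where "n t = exp (lam * t) *\<^sub>R (m t - \<mu>)" for t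
    define n' where "n' t = (lam * exp (lam * t)) *\<^sub>R (consensus_point f \<alpha> (\<rho> t) - \<mu>)" for t
    have der: "(n has_vector_derivative n' t) (at t within {0..})" if t: "t \<ge> 0" for t
    proof -
      have e: "((\<lambda>t. exp (- lam * t)) has_real_derivative - lam * exp (- lam * t)) (at t within {0..})"
        "((\<lambda>t. exp (lam * t)) has_real_derivative lam * exp (lam * t)) (at t within {0..})"
        by (auto intro!: derivative_eq_intros)
      have "((\<lambda>t. exp (- lam * t) *\<^sub>R m0) has_vector_derivative
          exp (- lam * t) *\<^sub>R 0 + (- lam * exp (- lam * t)) *\<^sub>R m0) (at t within {0..})"
        by (rule has_vector_derivative_scaleR[OF e(1) has_vector_derivative_const])
      from has_vector_derivative_add[OF this c[OF t]]
      have "(m has_vector_derivative lam *\<^sub>R (consensus_point f \<alpha> (\<rho> t) - m t)) (at t within {0..})"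
        unfolding m_def[abs_def] by (simp add: algebra_simps)
      then have "((\<lambda>t. m t - \<mu>) has_vector_derivative lam *\<^sub>R (consensus_point f \<alpha> (\<rho> t) - m t)) (at t within {0..})"
        using has_vector_derivative_diff[OF _ has_vector_derivative_const] by fastforce
      from has_vector_derivative_scaleR[OF e(2) this] show ?thesis
        unfolding n_def[abs_def] n'_def by (simp add: algebra_simps)
    qed
    have "norm (n t) \<le> norm (n 0) * exp (lam * L * t) + (lam * l * K) / (lam * L) * (exp (lam * L * t) - 1)"
    proof (rule gronwall_norm[OF der _ _ _ t])
      fix t :: real assume t: "t \<ge> 0"
      have "norm (n' t) = lam * exp (lam * t) * norm (consensus_point f \<alpha> (\<rho> t) - \<mu>)"
        using lam by (simp add: n'_def)
      also have "\<dots> \<le> lam * exp (lam * t) * (l * (exp (- lam * t) * K) + L * norm (m t - \<mu>))"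
        using err[OF t] lam by (intro mult_left_mono) auto
      also have "\<dots> = lam * l * K + lam * L * norm (n t)"
      proof -
        have "norm (n t) = exp (lam * t) * norm (m t - \<mu>)" by (simp add: n_def)
        moreover have "exp (lam * t) * exp (- lam * t) = 1" by (simp add: exp_minus)
        ultimately show ?thesis by (simp add: algebra_simps)
      qed
      finally show "norm (n' t) \<le> lam * l * K + lam * L * norm (n t)" .
    qed (use lam l L K0 in auto)
    also have "n 0 = m0 - \<mu>" by (simp add: n_def m_def c0)
    also have "(lam * l * K) / (lam * L) = l / L * K" using lam by simp
    finally have n: "norm (n t) \<le> norm (m0 - \<mu>) * exp (lam * L * t) + l / L * K * (exp (lam * L * t) - 1)" .
    have "norm (m t - \<mu>) = exp (- lam * t) * norm (n t)"
      by (simp add: n_def exp_minus)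
    also have "\<dots> \<le> exp (- lam * t) * (norm (m0 - \<mu>) * exp (lam * L * t) + l / L * K * (exp (lam * L * t) - 1))"
      using n by (rule mult_left_mono) simp
    also have "\<dots> = norm (m0 - \<mu>) * (exp (- lam * t) * exp (lam * L * t)) +
        l / L * K * (exp (- lam * t) * exp (lam * L * t) - exp (- lam * t))"
      by (simp add: algebra_simps)
    also have "exp (- lam * t) * exp (lam * L * t) = exp (- lam * (1 - L) * t)"
      by (simp add: exp_add[symmetric] algebra_simps)
    finally have m: "norm (m t - \<mu>) \<le> norm (m0 - \<mu>) * exp (- lam * (1 - L) * t) +
        l / L * K * (exp (- lam * (1 - L) * t) - exp (- lam * t))" .
    obtain \<pi>' where "\<pi>' \<in> couplings (\<rho> t) (isotropic_normal \<mu> v)"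
      "transport_cost \<pi>' \<le> ennreal ((exp (- lam * t) * K + norm (m t - \<mu>))\<^sup>2)"
      using push[OF t, of "\<mu> - m t"] by (auto simp: norm_minus_commute)
    then have "W2 (\<rho> t) (isotropic_normal \<mu> v) \<le> exp (- lam * t) * K + norm (m t - \<mu>)"
      by (rule W2_le) (use K0 in simp)
    then show ?thesis using m by linarith
  qed
  \<comment> \<open>The bound is continuous in \<open>K\<close>, so the slack in the choice of the
    coupling disappears as \<open>K\<close> decreases to \<open>D\<close>.\<close>
  let ?R = "\<lambda>K. exp (- lam * t) * K
       + norm (m0 - \<mu>) * exp (- lam * (1 - L) * t)
       + l / L * K * (exp (- lam * (1 - L) * t) - exp (- lam * t))"
  have "(?R \<longlongrightarrow> ?R D) (at_right D)" by (intro tendsto_intros)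
  moreover have "eventually (\<lambda>K. W2 (\<rho> t) (isotropic_normal \<mu> v) \<le> ?R K) (at_right D)"
    using eventually_at_right_less[of D] by eventually_elim (rule bound)
  ultimately have "W2 (\<rho> t) (isotropic_normal \<mu> v) \<le> ?R D"
    by (intro tendsto_lowerbound) auto
  then show ?thesis by (simp add: m0_def)
qed

section \<open>Absorbing the constant at a Gaussian into \<open>LX\<close>, and the exponential
  rate\<close>

lemma eventually_linear_exp_le:
  fixes G e :: real
  assumes "G \<ge> 0" "e > 0"
  shows "\<forall>\<^sub>F \<alpha> in at_top. G * \<alpha> * exp (\<alpha> * (e / 2)) \<le> exp (\<alpha> * e) / 2"
  using eventually_ge_at_top[of "16 * G / e\<^sup>2 + 1"]
proof eventually_elim
  case (elim \<alpha>)
  have "16 * G / e\<^sup>2 \<ge> 0" using assms by simp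
  \<comment> \<open>The threshold is chosen such that \<open>G * \<alpha>\<close> is at most a
    quarter of the square of \<open>\<alpha> * (e / 2)\<close>, hence at most half of
    \<open>exp (\<alpha> * (e / 2))\<close> by the quadratic Taylor bound.\<close>
  then have \<alpha>: "\<alpha> \<ge> 1" "16 * G / e\<^sup>2 \<le> \<alpha>" using elim by linarith+
  have "16 * G \<le> \<alpha> * e\<^sup>2" using \<alpha>(2) assms(2) by (simp add: pos_divide_le_eq)
  then have "16 * G * \<alpha> \<le> (\<alpha> * e\<^sup>2) * \<alpha>" using \<alpha> by (intro mult_right_mono) auto
  then have "G * \<alpha> \<le> (\<alpha> * (e / 2))\<^sup>2 / 2 / 2" by (simp add: power2_eq_square algebra_simps)
  also have "(\<alpha> * (e / 2))\<^sup>2 / 2 \<le> exp (\<alpha> * (e / 2))"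
  proof -
    have "\<alpha> * (e / 2) \<ge> 0" using \<alpha> assms by simp
    from exp_lower_Taylor_quadratic[OF this] this show ?thesis by linarith
  qed
  finally have "G * \<alpha> * exp (\<alpha> * (e / 2)) \<le> exp (\<alpha> * (e / 2)) / 2 * exp (\<alpha> * (e / 2))"
    by (intro mult_right_mono) auto
  also have "\<dots> = exp (\<alpha> * e) / 2" by (simp add: exp_add[symmetric])
  finally show ?case .
qed

theorem theorem3p15:
  fixes f :: "'a::euclidean_space \<Rightarrow> real" and xs :: 'a
    and Lf cl cu M lam \<delta> S r :: real
    and \<rho>0 :: "'a measure"
    and P :: "real \<Rightarrow> 'w measure" and F :: "real \<Rightarrow> real \<Rightarrow> 'w measure"
    and B X :: "real \<Rightarrow> real \<Rightarrow> 'w \<Rightarrow> 'a"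
    and \<rho> :: "real \<Rightarrow> real \<Rightarrow> 'a measure"
    and \<mu> :: "real \<Rightarrow> 'a" and \<rho>inf :: "real \<Rightarrow> 'a measure"
    and LX L :: "real \<Rightarrow> real" and D :: real
  assumes f_cont: "continuous_on UNIV f"
    and min: "\<forall>x. f xs \<le> f x" and min_unique: "\<forall>x. f x = f xs \<longrightarrow> x = xs"
    and Lf: "Lf > 0" "\<forall>x y. \<bar>f x - f y\<bar> \<le> Lf * (1 + norm x + norm y) * norm (x - y)"
    and growth_pos: "cl > 0" "cu > 0" "M > 0"
    and growth_upper: "\<forall>x. f x - f xs \<le> cu * ((norm x)\<^sup>2 + 1)"
    and growth_lower: "\<forall>x. norm x \<ge> M \<longrightarrow> cl * (norm x)\<^sup>2 \<le> f x - f xs"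
    and params: "lam > 0" "\<delta> > 0"
    and init: "\<rho>0 \<in> P4"
    and sol: "\<forall>\<alpha>>0. delta_CBO f lam \<delta> \<alpha> \<rho>0 (P \<alpha>) (F \<alpha>) (B \<alpha>) (X \<alpha>) (\<rho> \<alpha>)"
    and S_pos: "S > 0"
    and S_bound: "\<forall>\<^sub>F \<alpha> in at_top. \<forall>t\<ge>0.
        (\<forall>q\<in>{1..4::nat}. integrable (\<rho> \<alpha> t) (\<lambda>x. norm x ^ q) \<and> (\<integral>x. norm x ^ q \<partial>\<rho> \<alpha> t) \<le> S) \<and>
        norm (consensus_point f \<alpha> (\<rho> \<alpha> t)) \<le> S"
    and S_xs: "xs \<in> cball 0 S" and S_mean: "(\<integral>x. x \<partial>\<rho>0) \<in> cball 0 S"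
    and r: "r = 2 * S"
    and LX: "\<forall>\<^sub>F \<alpha> in at_top. LX \<alpha> > 0 \<and>
        (\<forall>\<mu>\<in>P4. \<forall>\<nu>\<in>P4. (\<integral>x. norm x ^ 4 \<partial>\<mu>) \<le> S \<and> (\<integral>x. norm x ^ 4 \<partial>\<nu>) \<le> S \<longrightarrow>
           norm (consensus_point f \<alpha> \<mu> - consensus_point f \<alpha> \<nu>) \<le> LX \<alpha> * W2 \<mu> \<nu>)"
    and L: "\<forall>\<^sub>F \<alpha> in at_top. L \<alpha> > 0 \<and> lipschitz_on (L \<alpha>) (cball xs r) (T_map f lam \<delta> \<alpha>)"
    and L_lim: "(L \<longlongrightarrow> 0) at_top"
    and fixed_point: "\<forall>\<^sub>F \<alpha> in at_top. {m \<in> cball xs r. T_map f lam \<delta> \<alpha> m = m} = {\<mu> \<alpha>}"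
    and \<rho>inf: "\<forall>\<alpha>. \<rho>inf \<alpha> = isotropic_normal (\<mu> \<alpha>) (\<delta>\<^sup>2 / (2 * lam))"
    and D: "D = W2 \<rho>0 (isotropic_normal (\<integral>x. x \<partial>\<rho>0) (\<delta>\<^sup>2 / (2 * lam)))"
  shows "(\<forall>\<^sub>F \<alpha> in at_top. \<forall>t\<ge>0.
            W2 (\<rho> \<alpha> t) (\<rho>inf \<alpha>) \<le>
              exp (- lam * t) * D
              + norm ((\<integral>x. x \<partial>\<rho>0) - \<mu> \<alpha>) * exp (- lam * (1 - L \<alpha>) * t)
              + LX \<alpha> / L \<alpha> * D * (exp (- lam * (1 - L \<alpha>) * t) - exp (- lam * t)))
       \<and> (\<forall>\<gamma>. exp (- lam) < \<gamma> \<and> \<gamma> < 1 \<longrightarrow>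
            (\<forall>\<^sub>F \<alpha> in at_top. \<exists>C>0. \<forall>t\<ge>0. W2 (\<rho> \<alpha> t) (\<rho>inf \<alpha>) \<le> C * \<gamma> powr t))"
proof -
  define h where "h x = f x - f xs" for x
  define v where "v = \<delta>\<^sup>2 / (2 * lam)"
  define m0 where "m0 = (\<integral>x. x \<partial>\<rho>0)"
  have vpos: "v > 0" using params by (simp add: v_def)
  have hc: "continuous_on UNIV h" unfolding h_def by (intro continuous_intros f_cont)
  have h0: "h xs = 0" and nn: "h x \<ge> 0" for x using min by (auto simp: h_def)
  have hLf: "Lf \<ge> 0" "\<bar>h x - h y\<bar> \<le> Lf * (1 + norm x + norm y) * norm (x - y)" for x y
    using Lf by (auto simp: h_def)
  define C where "C = (1 + M)\<^sup>2 + 2 + 2 / cl"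
  have C: "exp (- h x) * (1 + norm x)\<^sup>2 \<le> C" for x
    unfolding C_def by (rule gibbs_weight_growth) (use nn growth_pos growth_lower in \<open>auto simp: h_def\<close>)
  \<comment> \<open>The factor \<open>exp (- \<alpha> * f xs)\<close> cancels in the quotient, so
    \<open>f\<close> may be normalised to have minimum 0.\<close>
  have cons: "consensus_point f = consensus_point h"
    unfolding h_def by (intro ext consensus_point_shift)
  have S0: "S \<ge> 0" using S_pos by simp
  obtain e where e: "e > 0"
    and low: "\<forall>\<^sub>F \<alpha> in at_top. \<forall>l. (\<forall>\<mu>\<in>P4. \<forall>\<nu>\<in>P4. (\<integral>x. norm x ^ 4 \<partial>\<mu>) \<le> S \<and> (\<integral>x. norm x ^ 4 \<partial>\<nu>) \<le> S \<longrightarrow>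
       norm (consensus_point f \<alpha> \<mu> - consensus_point f \<alpha> \<nu>) \<le> l * W2 \<mu> \<nu>) \<longrightarrow> l \<ge> 0 \<longrightarrow> exp (\<alpha> * e) / 2 \<le> l"
    by (rule wasserstein_lipschitz_constant_lower[of f xs S]) (use f_cont min min_unique S_pos in auto)
  \<comment> \<open>Half of the growth exponent of \<open>LX\<close> is spent on the Gaussian
    normaliser; the other half beats the linear factor \<open>G * \<alpha>\<close>.\<close>
  have e2: "e / 2 > 0" using e by simp
  obtain G where G: "G \<ge> 0"
    and near: "\<And>\<alpha> \<rho> m \<pi> K. \<alpha> \<ge> 1 \<Longrightarrow> prob_space \<rho> \<Longrightarrow> sets \<rho> = sets borel \<Longrightarrow> norm (consensus_point h \<alpha> \<rho>) \<le> S \<Longrightarrow>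
      norm m \<le> S \<Longrightarrow> \<pi> \<in> couplings \<rho> (isotropic_normal m v) \<Longrightarrow> K > 0 \<Longrightarrow> transport_cost \<pi> \<le> ennreal (K\<^sup>2) \<Longrightarrow>
      norm (consensus_point h \<alpha> \<rho> - consensus_point h \<alpha> (isotropic_normal m v)) \<le> G * \<alpha> * exp (\<alpha> * (e / 2)) * K"
    by (rule consensus_point_normal_lipschitz[OF hc h0 nn C hLf S0 vpos e2]) blast
  have main: "\<forall>\<^sub>F \<alpha> in at_top. \<forall>t\<ge>0. W2 (\<rho> \<alpha> t) (\<rho>inf \<alpha>) \<le>
      exp (- lam * t) * D + norm (m0 - \<mu> \<alpha>) * exp (- lam * (1 - L \<alpha>) * t)
      + LX \<alpha> / L \<alpha> * D * (exp (- lam * (1 - L \<alpha>) * t) - exp (- lam * t))"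
    using eventually_ge_at_top[of 1] S_bound LX L fixed_point low eventually_linear_exp_le[OF G e]
  proof (eventually_elim, intro allI impI)
    fix \<alpha> t :: real
    assume \<alpha>: "1 \<le> \<alpha>" and Sb: "\<forall>t\<ge>0. (\<forall>q\<in>{1..4::nat}. integrable (\<rho> \<alpha> t) (\<lambda>x. norm x ^ q) \<and> (\<integral>x. norm x ^ q \<partial>\<rho> \<alpha> t) \<le> S) \<and>
        norm (consensus_point f \<alpha> (\<rho> \<alpha> t)) \<le> S"
      and LX: "LX \<alpha> > 0 \<and> (\<forall>\<mu>\<in>P4. \<forall>\<nu>\<in>P4. (\<integral>x. norm x ^ 4 \<partial>\<mu>) \<le> S \<and> (\<integral>x. norm x ^ 4 \<partial>\<nu>) \<le> S \<longrightarrow>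
           norm (consensus_point f \<alpha> \<mu> - consensus_point f \<alpha> \<nu>) \<le> LX \<alpha> * W2 \<mu> \<nu>)"
      and L: "L \<alpha> > 0 \<and> lipschitz_on (L \<alpha>) (cball xs r) (T_map f lam \<delta> \<alpha>)"
      and fp: "{m \<in> cball xs r. T_map f lam \<delta> \<alpha> m = m} = {\<mu> \<alpha>}"
      and low: "\<forall>l. (\<forall>\<mu>\<in>P4. \<forall>\<nu>\<in>P4. (\<integral>x. norm x ^ 4 \<partial>\<mu>) \<le> S \<and> (\<integral>x. norm x ^ 4 \<partial>\<nu>) \<le> S \<longrightarrow>
       norm (consensus_point f \<alpha> \<mu> - consensus_point f \<alpha> \<nu>) \<le> l * W2 \<mu> \<nu>) \<longrightarrow> l \<ge> 0 \<longrightarrow> exp (\<alpha> * e) / 2 \<le> l"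
      and Ge: "G * \<alpha> * exp (\<alpha> * (e / 2)) \<le> exp (\<alpha> * e) / 2" and t: "0 \<le> t"
    have cbo: "delta_CBO f lam \<delta> \<alpha> \<rho>0 (P \<alpha>) (F \<alpha>) (B \<alpha>) (X \<alpha>) (\<rho> \<alpha>)" using sol \<alpha> by simp
    \<comment> \<open>The lower bound holds for every admissible Lipschitz constant, in particular
      for the prescribed one.\<close>
    have "exp (\<alpha> * e) / 2 \<le> LX \<alpha>" using low LX by simp
    with Ge have GLX: "G * \<alpha> * exp (\<alpha> * (e / 2)) \<le> LX \<alpha>" by simp
    have law: "prob_space (\<rho> \<alpha> t)" "sets (\<rho> \<alpha> t) = sets borel" if t: "t \<ge> 0" for t
    proof -
      have bm: "brownian_motion (P \<alpha>) (F \<alpha>) (B \<alpha>)" and Xt: "X \<alpha> t \<in> borel_measurable (F \<alpha> t)"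
        and d: "distr (P \<alpha>) borel (X \<alpha> t) = \<rho> \<alpha> t"
        using cbo t by (auto simp: delta_CBO_def)
      interpret prob_space "P \<alpha>" using bm by (simp add: brownian_motion_def)
      show "prob_space (\<rho> \<alpha> t)" "sets (\<rho> \<alpha> t) = sets borel"
        unfolding d[symmetric] using brownian_motion_measurable[OF bm t Xt] by (auto intro: prob_space_distr)
    qed
    have mu: "\<mu> \<alpha> \<in> cball xs (2 * S)" "T_map f lam \<delta> \<alpha> (\<mu> \<alpha>) = \<mu> \<alpha>"
      using fp unfolding r by auto
    have "W2 (\<rho> \<alpha> t) (isotropic_normal (\<mu> \<alpha>) v) \<le>
      exp (- lam * t) * D + norm ((\<integral>x. x \<partial>\<rho>0) - \<mu> \<alpha>) * exp (- lam * (1 - L \<alpha>) * t)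
      + LX \<alpha> / L \<alpha> * D * (exp (- lam * (1 - L \<alpha>) * t) - exp (- lam * t))"
    proof (rule delta_CBO_W2_bound[OF cbo params _ f_cont])
      show "norm (exp (- \<alpha> * (f x - f xs)) *\<^sub>R x) \<le> (1 + S) * C" for x
        using gibbs_lipschitz(1)[OF nn C hLf S0 \<alpha>, of 0 x] S0 by (simp add: h_def)
      show "(\<integral>x. norm x \<partial>\<rho> \<alpha> t) \<le> S" if "t \<ge> 0" for t
      proof -
        have "(1::nat) \<in> {1..4}" by simp
        then have "(\<integral>x. norm x ^ 1 \<partial>\<rho> \<alpha> t) \<le> S" using Sb that by blast
        then show ?thesis by simp
      qed
      show "norm (consensus_point f \<alpha> (\<rho> \<alpha> t) - T_map f lam \<delta> \<alpha> m) \<le> LX \<alpha> * K"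
        if "t \<ge> 0" "norm m \<le> S" "\<pi> \<in> couplings (\<rho> \<alpha> t) (isotropic_normal m v)" "K > 0"
          "transport_cost \<pi> \<le> ennreal (K\<^sup>2)" for t m \<pi> K
      proof -
        have "norm (consensus_point f \<alpha> (\<rho> \<alpha> t) - T_map f lam \<delta> \<alpha> m) \<le> G * \<alpha> * exp (\<alpha> * (e / 2)) * K"
          unfolding T_map_def v_def[symmetric] cons
          by (rule near[OF \<alpha> law[OF that(1)] _ that(2-5)]) (use Sb that(1) cons in auto)
        also have "\<dots> \<le> LX \<alpha> * K" using GLX that(4) by (intro mult_right_mono) auto
        finally show ?thesis .
      qed
    qed (use \<alpha> min init S_xs L LX mu t D in \<open>auto simp: v_def r\<close>)
    then show "W2 (\<rho> \<alpha> t) (\<rho>inf \<alpha>) \<le>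
      exp (- lam * t) * D + norm (m0 - \<mu> \<alpha>) * exp (- lam * (1 - L \<alpha>) * t)
      + LX \<alpha> / L \<alpha> * D * (exp (- lam * (1 - L \<alpha>) * t) - exp (- lam * t))"
      by (simp add: \<rho>inf v_def m0_def)
  qed
  have "\<forall>\<^sub>F \<alpha> in at_top. \<exists>C>0. \<forall>t\<ge>0. W2 (\<rho> \<alpha> t) (\<rho>inf \<alpha>) \<le> C * \<gamma> powr t"
    if \<gamma>: "exp (- lam) < \<gamma>" for \<gamma>
  proof -
    have \<gamma>0: "\<gamma> > 0" using \<gamma> by (meson exp_gt_zero less_trans)
    have ln: "- lam < ln \<gamma>" using \<gamma> \<gamma>0 by (metis exp_less_cancel_iff exp_ln)
    \<comment> \<open>As soon as \<open>L \<alpha>\<close> lies below this positive number, the rate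
      \<open>lam * (1 - L \<alpha>)\<close> is at least \<open>- ln \<gamma>\<close>.\<close>
    then have "0 < (lam + ln \<gamma>) / lam" using params by simp
    from order_tendstoD(2)[OF L_lim this]
    show ?thesis using main L LX
    proof eventually_elim
      case (elim \<alpha>)
      define A where "A = D + norm (m0 - \<mu> \<alpha>) + LX \<alpha> / L \<alpha> * D"
      have D0: "D \<ge> 0" by (simp add: D)
      have k: "LX \<alpha> / L \<alpha> * D \<ge> 0" using elim D0 by simp
      have A: "A \<ge> 0" using D0 k by (simp add: A_def)
      have "lam * L \<alpha> < lam + ln \<gamma>" using elim(1) params by (simp add: field_simps)
      then have rate: "- lam * (1 - L \<alpha>) \<le> ln \<gamma>" by (simp add: algebra_simps)
      show ?case
      \<comment> \<open>The number \<open>A\<close> collects the three coefficients and may be 0,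
        whereas the constant has to be positive.\<close>
      proof (intro exI[of _ "A + 1"] conjI allI impI)
        show "A + 1 > 0" using A by simp
        fix t :: real assume t: "t \<ge> 0"
        define g where "g = \<gamma> powr t"
        have ge: "g = exp (ln \<gamma> * t)" using \<gamma>0 by (simp add: g_def powr_def mult.commute)
        have "- lam * t \<le> ln \<gamma> * t" "- lam * (1 - L \<alpha>) * t \<le> ln \<gamma> * t"
          by (rule mult_right_mono; use ln rate t in simp)+
        then have g: "exp (- lam * t) \<le> g" "exp (- lam * (1 - L \<alpha>) * t) \<le> g" "g \<ge> 0"
          unfolding ge by (simp_all only: exp_le_cancel_iff exp_ge_zero)
        have "W2 (\<rho> \<alpha> t) (\<rho>inf \<alpha>) \<le> exp (- lam * t) * D + norm (m0 - \<mu> \<alpha>) * exp (- lam * (1 - L \<alpha>) * t)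
            + LX \<alpha> / L \<alpha> * D * (exp (- lam * (1 - L \<alpha>) * t) - exp (- lam * t))"
          using elim(2) t by simp
        also have "\<dots> \<le> g * D + norm (m0 - \<mu> \<alpha>) * g + LX \<alpha> / L \<alpha> * D * g"
        proof (intro add_mono mult_left_mono mult_right_mono g D0 k)
          show "exp (- lam * (1 - L \<alpha>) * t) - exp (- lam * t) \<le> g"
            using g(2) exp_gt_zero[of "- lam * t"] by linarith
        qed simp
        also have "\<dots> = A * g" by (simp add: A_def algebra_simps)
        also have "\<dots> \<le> (A + 1) * g" using g(3) by (intro mult_right_mono) auto
        finally show "W2 (\<rho> \<alpha> t) (\<rho>inf \<alpha>) \<le> (A + 1) * \<gamma> powr t" by (simp add: g_def)
      qed
    qed
  qed
  with main show ?thesis unfolding m0_def by blast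
qed

end
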